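(* Let $F$ be an algebraically closed field of characteristic $0$ and $G=\mathrm{GL}(m|n)$ over $F$. Let $\lambda$ be a dominant polynomial weight of $G$ and let $(I|J)$ be admissible (with respect to $\lambda$), such that $\lambda_{I|J}$ is a dominant polynomial weight. If the simple $G$-supermodule $L_G(\lambda_{I|J})$ is a composition factor of $\nabla(\lambda)$, then $\lambda\sim_{podd}\lambda_{I|J}$.
   Context: Weights of $G=\mathrm{GL}(m|n)$ are tuples $\lambda=(\lambda^+|\lambda^-)=(\lambda^+_1,\dots,\lambda^+_m|\lambda^-_1,\dots,\lambda^-_n)\in\mathbb{Z}^{m+n}$; $\lambda$ is dominant if $\lambda^+_1\ge\dots\ge\lambda^+_m$ and $\lambda^-_1\ge\dots\ge\lambda^-_n$. $\delta_s$ ($1\le s\le m+n$) is the weight with $s$-th component $1$ and all other components $0$. $F[G]$ is the localization at $\det(C_{11})\det(C_{22})$ of the superbialgebra $A(m|n)$ freely generated, as a supercommutative superalgebra, by the entries $c_{ij}$ of a generic $(m+n)\times(m+n)$ matrix $C=\begin{pmatrix}C_{11}&C_{12}\\C_{21}&C_{22}\end{pmatrix}$ in $(m|n)$-block form ($c_{ij}$ is even in the diagonal blocks and odd in the off-diagonal blocks), with $\Delta(c_{ij})=\sum_k c_{ik}\otimes c_{kj}$. $H^0_G(\lambda)$ is the $G$-supermodule induced from the one-dimensional supermodule of weight $\lambda$ of the lower triangular Borel subsupergroup; for dominant $\lambda$ its socle is the simple $G$-supermodule $L_G(\lambda)$ of highest weight $\lambda$ (with respect to the upper triangular Borel subsupergroup).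 Simple supermodules are considered up to parity change. $\nabla(\lambda)$ is the largest polynomial $G$-subsupermodule of $H^0_G(\lambda)$ (polynomial means that its coefficient functions lie in $A(m|n)$). A weight $\lambda$ is polynomial if $\nabla(\lambda)\ne0$. Dominant polynomial weights correspond bijectively to $(m|n)$-hook partitions, i.e. partitions $(\lambda_1,\dots,\lambda_s)$ with $\lambda_{m+1}\le n$, via $\lambda^+=(\lambda_1,\dots,\lambda_m)$ and $\lambda^-$ the conjugate partition of $(\lambda_{m+1},\dots,\lambda_s)$. For a multi-index $(I|J)=(i_1\cdots i_k|j_1\cdots j_k)$ with $1\le i_s\le m$, $1\le j_s\le n$, put $\lambda_{I|J}=\lambda-\sum_{s=1}^k\delta_{i_s}+\sum_{s=1}^k\delta_{m+j_s}$; for $k=1$ write $\lambda_{ij}$. $(I|J)$ is admissible if $\lambda_{I|J}$ is dominant, $i_1\le\dots\le i_k$, and whenever $t_1<t_2$ and $i_{t_1}=i_{t_2}$ then $j_{t_1}<j_{t_2}$. For $1\le i\le m$, $1\le j\le n$ put $\omega_{ij}(\lambda)=\lambda^+_i+\lambda^-_j+m+1-i-j$. Weights $\lambda,\mu$ are simply-odd-linked, $\lambda\sim_{sodd}\mu$, if for some $i,j$ one has $\lambda_{ij}=\mu$ or $\mu_{ij}=\lambda$, and $\omega_{ij}(\lambda)=0$. They are odd-linked, $\lambda\sim_{odd}\mu$, if there is a chain of weights $\lambda=\lambda_1\sim_{sodd}\lambda_2\sim_{sodd}\cdots\sim_{sodd}\lambda_t=\mu$. One writes $\lambda\sim_{podd}\mu$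 if there is such a chain in which all the weights $\lambda_1,\dots,\lambda_t$ are polynomial weights. *)

theory Defs
  imports
    "HOL-Library.Product_Lexorder"
    "HOL-Library.Poly_Mapping"
    "HOL-Computational_Algebra.Fraction_Field"
    "HOL-Computational_Algebra.Polynomial"
    "Jordan_Normal_Form.Determinant"
begin

section \<open>Grassmann algebras\<close>

text \<open>
  The Grassmann algebra over a commutative ring on linearly ordered odd generators
  \<open>\<xi>\<^sub>v\<close>. An element is its family of coefficients with respect to the basis of
  increasing products \<open>\<xi>\<^sub>S = \<xi>\<^sub>v\<^sub>1 \<dots> \<xi>\<^sub>v\<^sub>r\<close>, where \<open>S = {v\<^sub>1 < \<dots> < v\<^sub>r}\<close> is a finite set.
\<close>

typedef (overloaded) ('v, 'k) grassmann =
  "{f :: 'v set \<Rightarrow> 'k::zero. finite {S. f S \<noteq> 0} \<and> (\<forall>S. f S \<noteq> 0 \<longrightarrow> finite S)}"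
  morphisms gcoeff Abs_grassmann
  by (rule exI[of _ "\<lambda>_. 0"]) simp

setup_lifting type_definition_grassmann

lemma grassmann_eqI: "(\<And>S. gcoeff f S = gcoeff g S) \<Longrightarrow> f = g"
  by (simp add: gcoeff_inject[symmetric] fun_eq_iff)

text \<open>The sign with \<open>\<xi>\<^sub>S \<xi>\<^sub>T = shuffle_sign S T \<xi>\<^sub>S\<^sub>\<union>\<^sub>T\<close> for disjoint \<open>S\<close> and \<open>T\<close>.\<close>

definition shuffle_sign :: "'v::linorder set \<Rightarrow> 'v set \<Rightarrow> 'k::comm_ring_1" where
  "shuffle_sign S T = (- 1) ^ card {(a, b). a \<in> S \<and> b \<in> T \<and> b < a}"

lemma shuffle_sign_empty [simp]: "shuffle_sign {} T = 1" "shuffle_sign S {} = 1"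
  by (simp_all add: shuffle_sign_def)

lemma shuffle_sign_Un_left:
  assumes "finite S" "finite S'" "finite T" "S \<inter> S' = {}"
  shows "shuffle_sign (S \<union> S') T = shuffle_sign S T * shuffle_sign S' T"
proof -
  let ?i = "\<lambda>S. {(a, b). a \<in> S \<and> b \<in> T \<and> b < a}"
  have "finite (?i S)" by (rule finite_subset[of _ "S \<times> T"]) (use assms in auto)
  moreover have "finite (?i S')" by (rule finite_subset[of _ "S' \<times> T"]) (use assms in auto)
  moreover have "?i S \<inter> ?i S' = {}" using assms by auto
  moreover have "?i (S \<union> S') = ?i S \<union> ?i S'" by auto
  ultimately show ?thesis
    by (simp only: shuffle_sign_def card_Un_disjoint power_add)
qed

lemma shuffle_sign_Un_right:
  assumes "finite S" "finite T" "finite T'" "T \<inter> T' = {}"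
  shows "shuffle_sign S (T \<union> T') = shuffle_sign S T * shuffle_sign S T'"
proof -
  let ?i = "\<lambda>T. {(a, b). a \<in> S \<and> b \<in> T \<and> b < a}"
  have "finite (?i T)" by (rule finite_subset[of _ "S \<times> T"]) (use assms in auto)
  moreover have "finite (?i T')" by (rule finite_subset[of _ "S \<times> T'"]) (use assms in auto)
  moreover have "?i T \<inter> ?i T' = {}" using assms by auto
  moreover have "?i (T \<union> T') = ?i T \<union> ?i T'" by auto
  ultimately show ?thesis
    by (simp only: shuffle_sign_def card_Un_disjoint power_add)
qed

instantiation grassmann :: (type, ab_group_add) ab_group_add
begin

lift_definition zero_grassmann :: "('a, 'b) grassmann" is "\<lambda>_. 0" by simp

lift_definition plus_grassmann :: "('a, 'b) grassmann \<Rightarrow> ('a, 'b) grassmann \<Rightarrow> ('a, 'b) grassmann"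
  is "\<lambda>f g S. f S + g S"
proof (intro conjI allI impI)
  fix f g :: "'a set \<Rightarrow> 'b"
  assume f: "finite {S. f S \<noteq> 0} \<and> (\<forall>S. f S \<noteq> 0 \<longrightarrow> finite S)"
     and g: "finite {S. g S \<noteq> 0} \<and> (\<forall>S. g S \<noteq> 0 \<longrightarrow> finite S)"
  show "finite {S. f S + g S \<noteq> 0}"
    by (rule finite_subset[of _ "{S. f S \<noteq> 0} \<union> {S. g S \<noteq> 0}"]) (use f g in auto)
  show "finite S" if "f S + g S \<noteq> 0" for S
    using that f g by (cases "f S = 0") auto
qed

lift_definition uminus_grassmann :: "('a, 'b) grassmann \<Rightarrow> ('a, 'b) grassmann"
  is "\<lambda>f S. - f S" by simp

definition minus_grassmann :: "('a, 'b) grassmann \<Rightarrow> ('a, 'b) grassmann \<Rightarrow> ('a, 'b) grassmann"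
  where "minus_grassmann f g = f + - g"

instance
proof
  fix f g h :: "('a, 'b) grassmann"
  show "f + g + h = f + (g + h)" "f + g = g + f" "0 + f = f" "- f + f = 0"
    by (transfer; simp add: fun_eq_iff algebra_simps)+
qed (simp add: minus_grassmann_def)

end

lemma finite_support_mult:
  fixes f g :: "'v::linorder set \<Rightarrow> 'k::comm_ring_1"
  assumes f: "finite {S. f S \<noteq> 0} \<and> (\<forall>S. f S \<noteq> 0 \<longrightarrow> finite S)"
     and g: "finite {S. g S \<noteq> 0} \<and> (\<forall>S. g S \<noteq> 0 \<longrightarrow> finite S)"
  defines "h \<equiv> \<lambda>U. \<Sum>S\<in>Pow U. shuffle_sign S (U - S) * f S * g (U - S)"
  shows "finite {U. h U \<noteq> 0} \<and> (\<forall>U. h U \<noteq> 0 \<longrightarrow> finite U)"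
proof
  have "{U. h U \<noteq> 0} \<subseteq> (\<lambda>(S, T). S \<union> T) ` ({S. f S \<noteq> 0} \<times> {S. g S \<noteq> 0})"
  proof
    fix U assume "U \<in> {U. h U \<noteq> 0}"
    then obtain S where S: "S \<in> Pow U" "shuffle_sign S (U - S) * f S * g (U - S) \<noteq> 0"
      unfolding h_def using sum.not_neutral_contains_not_neutral by blast
    then have "U = (\<lambda>(S, T). S \<union> T) (S, U - S)" "f S \<noteq> 0" "g (U - S) \<noteq> 0" by auto
    then show "U \<in> (\<lambda>(S, T). S \<union> T) ` ({S. f S \<noteq> 0} \<times> {S. g S \<noteq> 0})" by blast
  qed
  then show "finite {U. h U \<noteq> 0}" by (rule finite_subset) (use f g in auto)
  show "\<forall>U. h U \<noteq> 0 \<longrightarrow> finite U"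
  proof (intro allI impI)
    fix U assume "h U \<noteq> 0"
    then show "finite U" by (rule contrapos_np) (simp add: h_def)
  qed
qed

instantiation grassmann :: (linorder, comm_ring_1) ring_1
begin

lift_definition one_grassmann :: "('a, 'b) grassmann" is "\<lambda>S. if S = {} then 1 else 0"
  by auto

lift_definition times_grassmann :: "('a, 'b) grassmann \<Rightarrow> ('a, 'b) grassmann \<Rightarrow> ('a, 'b) grassmann"
  is "\<lambda>f g U. \<Sum>S\<in>Pow U. shuffle_sign S (U - S) * f S * g (U - S)"
  by (rule finite_support_mult)

instance
proof
  fix f g h :: "('a, 'b) grassmann"
  show "f * g * h = f * (g * h)"
  proof (rule grassmann_eqI)
    fix U
    show "gcoeff (f * g * h) U = gcoeff (f * (g * h)) U"
    proof (cases "finite U")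
      case False
      then show ?thesis by (simp add: times_grassmann.rep_eq)
    next
      case True
      note fin = finite_subset[OF _ True]
      let ?s = "shuffle_sign :: 'a set \<Rightarrow> 'a set \<Rightarrow> 'b"
      let ?f = "gcoeff f" and ?g = "gcoeff g" and ?h = "gcoeff h"
      have "gcoeff (f * g * h) U =
          (\<Sum>V\<in>Pow U. \<Sum>S\<in>Pow V. ?s V (U - V) * ?s S (V - S) * (?f S * ?g (V - S) * ?h (U - V)))"
        by (simp add: times_grassmann.rep_eq sum_distrib_left sum_distrib_right algebra_simps)
      also have "\<dots> = (\<Sum>(V, S)\<in>Sigma (Pow U) Pow.
          ?s V (U - V) * ?s S (V - S) * (?f S * ?g (V - S) * ?h (U - V)))"
        by (rule sum.Sigma) (use True fin in auto)
      also have "\<dots> = (\<Sum>(S, T)\<in>Sigma (Pow U) (\<lambda>S. Pow (U - S)).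
          ?s S (U - S) * ?s T (U - S - T) * (?f S * ?g T * ?h (U - S - T)))"
      proof (rule sum.reindex_bij_witness
          [where i = "\<lambda>(S, T). (S \<union> T, S)" and j = "\<lambda>(V, S). (S, V - S)"], goal_cases)
        case (5 x)
        then obtain V S where x: "x = (V, S)" "S \<subseteq> V" "V \<subseteq> U" by auto
        let ?T = "V - S" and ?W = "U - V"
        have V: "V = S \<union> ?T" and US: "U - S = ?T \<union> ?W" and W: "U - S - ?T = ?W"
          using x by auto
        have fi: "finite S" "finite ?T" "finite ?W"
          using x True by (auto intro: finite_subset)
        have 1: "?s V ?W = ?s S ?W * ?s ?T ?W"
          by (subst V, rule shuffle_sign_Un_left) (use fi in auto)
        have 2: "?s S (U - S) = ?s S ?T * ?s S ?W"
          by (subst US, rule shuffle_sign_Un_right) (use fi in auto)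
        show ?case unfolding x using 1 2 W by (simp add: algebra_simps)
      qed auto
      also have "\<dots> = (\<Sum>S\<in>Pow U. \<Sum>T\<in>Pow (U - S).
          ?s S (U - S) * ?s T (U - S - T) * (?f S * ?g T * ?h (U - S - T)))"
        by (rule sum.Sigma[symmetric]) (use True in auto)
      also have "\<dots> = gcoeff (f * (g * h)) U"
        by (simp add: times_grassmann.rep_eq sum_distrib_left algebra_simps)
      finally show ?thesis .
    qed
  qed
  show "1 * f = f"
  proof (rule grassmann_eqI)
    fix U
    have "gcoeff (1 * f) U = (\<Sum>S\<in>Pow U. if S = {} then gcoeff f U else 0)"
      by (auto simp: times_grassmann.rep_eq one_grassmann.rep_eq intro!: sum.cong)
    also have "\<dots> = gcoeff f U"
    proof (cases "finite U")
      case False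
      then show ?thesis using gcoeff[of f] by auto
    qed simp
    finally show "gcoeff (1 * f) U = gcoeff f U" .
  qed
  show "f * 1 = f"
  proof (rule grassmann_eqI)
    fix U
    have "gcoeff (f * 1) U = (\<Sum>S\<in>Pow U. if S = U then gcoeff f U else 0)"
      by (auto simp: times_grassmann.rep_eq one_grassmann.rep_eq intro!: sum.cong)
    also have "\<dots> = gcoeff f U"
    proof (cases "finite U")
      case False
      then show ?thesis using gcoeff[of f] by auto
    qed simp
    finally show "gcoeff (f * 1) U = gcoeff f U" .
  qed
  show "(f + g) * h = f * h + g * h" "f * (g + h) = f * g + f * h"
    by (rule grassmann_eqI; simp add: times_grassmann.rep_eq plus_grassmann.rep_eq
        sum.distrib[symmetric] algebra_simps)+
  show "(0 :: ('a, 'b) grassmann) \<noteq> 1"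
    by transfer (simp add: fun_eq_iff)
qed

end

lift_definition gscalar :: "'k::comm_ring_1 \<Rightarrow> ('v::linorder, 'k) grassmann"
  is "\<lambda>c S. if S = {} then c else 0" by auto

lift_definition ggen :: "'v::linorder \<Rightarrow> ('v, 'k::comm_ring_1) grassmann"
  is "\<lambda>v S. if S = {v} then 1 else 0" by auto

text \<open>\<open>gpart True\<close> and \<open>gpart False\<close> are the even and the odd component.\<close>

lift_definition gpart :: "bool \<Rightarrow> ('v::linorder, 'k::comm_ring_1) grassmann \<Rightarrow> ('v, 'k) grassmann"
  is "\<lambda>p f S. if even (card S) = p then f S else 0"
proof (intro conjI allI impI)
  fix p and f :: "'v set \<Rightarrow> 'k"
  assume f: "finite {S. f S \<noteq> 0} \<and> (\<forall>S. f S \<noteq> 0 \<longrightarrow> finite S)"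
  show "finite {S. (if even (card S) = p then f S else 0) \<noteq> 0}"
    by (rule finite_subset[of _ "{S. f S \<noteq> 0}"]) (use f in auto)
  show "finite S" if "(if even (card S) = p then f S else 0) \<noteq> 0" for S
    using that f by (simp split: if_splits)
qed

lemma gscalar_add: "gscalar (a + b) = gscalar a + gscalar b"
  by (rule grassmann_eqI) (simp add: gscalar.rep_eq plus_grassmann.rep_eq)

lemma gscalar_mult: "gscalar (a * b) = gscalar a * gscalar b"
proof (rule grassmann_eqI)
  fix U :: "'a set"
  have "gcoeff (gscalar a * gscalar b) U = (\<Sum>S\<in>Pow U. if S = {} then gcoeff (gscalar (a * b)) U else 0)"
    by (auto simp: times_grassmann.rep_eq gscalar.rep_eq intro!: sum.cong)
  also have "\<dots> = gcoeff (gscalar (a * b)) U"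
  proof (cases "finite U")
    case False
    then show ?thesis by (auto simp: gscalar.rep_eq)
  qed simp
  finally show "gcoeff (gscalar (a * b)) U = gcoeff (gscalar a * gscalar b) U" by simp
qed

lemma gscalar_1: "gscalar 1 = 1"
  by (rule grassmann_eqI) (simp add: gscalar.rep_eq one_grassmann.rep_eq)

section \<open>The coordinate superalgebras of \<open>GL(m|n)\<close> and of \<open>GL(m|n) \<times> GL(m|n)\<close>\<close>

text \<open>
  The variable \<open>(t, i, j)\<close> stands for the entry \<open>c\<^sub>i\<^sub>j\<close> of the \<open>t\<close>-th of several generic matrices.
  A free supercommutative superalgebra is a polynomial ring in the even generators tensored with
  the Grassmann algebra on the odd generators. It lies in the Grassmann algebra over the field of
  rational functions in the even generators, and so do its localizations at nonzero polynomials
  in the even generators; all superalgebras below are taken inside that Grassmann algebra.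
\<close>

type_synonym var = "nat \<times> nat \<times> nat"

type_synonym 'a rat_fun = "((var \<Rightarrow>\<^sub>0 nat) \<Rightarrow>\<^sub>0 'a) fract"

type_synonym 'a sfun = "(var, 'a rat_fun) grassmann"

definition rat_const :: "'a::field \<Rightarrow> 'a rat_fun" where
  "rat_const a = Fract (Poly_Mapping.single 0 a) 1"

definition rat_var :: "var \<Rightarrow> 'a::field rat_fun" where
  "rat_var v = Fract (Poly_Mapping.single (Poly_Mapping.single v 1) 1) 1"

definition sconst :: "'a::field \<Rightarrow> 'a sfun" where
  "sconst a = gscalar (rat_const a)"

definition sscale :: "'a::field \<Rightarrow> 'a sfun \<Rightarrow> 'a sfun" where
  "sscale a f = sconst a * f"

lemma sconst_add: "sconst (a + b) = sconst a + sconst b"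
  by (simp add: sconst_def rat_const_def single_add flip: gscalar_add)

lemma sconst_mult: "sconst (a * b) = sconst a * sconst b"
  by (simp add: sconst_def rat_const_def mult_single flip: gscalar_mult)

lemma sconst_1: "sconst 1 = 1"
  by (simp add: sconst_def rat_const_def gscalar_1 flip: One_fract_def)

interpretation sfun: vector_space "sscale :: 'a::field \<Rightarrow> 'a sfun \<Rightarrow> 'a sfun"
  by unfold_locales
    (simp_all add: sscale_def sconst_add sconst_mult sconst_1 algebra_simps)

definition entry :: "nat \<Rightarrow> nat \<Rightarrow> nat \<Rightarrow> nat \<Rightarrow> 'a::field sfun" where
  "entry m t i j =
    (if (i \<le> m) = (j \<le> m) then gscalar (rat_var (t, i, j)) else ggen (t, i, j))"

text \<open>\<open>det_blocks m n t\<close> is \<open>det C\<^sub>1\<^sub>1 det C\<^sub>2\<^sub>2\<close> for the \<open>t\<close>-th generic matrix \<open>C\<close>; the library's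
  matrices are indexed from 0.\<close>

definition det_blocks :: "nat \<Rightarrow> nat \<Rightarrow> nat \<Rightarrow> 'a::field rat_fun" where
  "det_blocks m n t =
    det (mat m m (\<lambda>(i, j). rat_var (t, i + 1, j + 1))) *
    det (mat n n (\<lambda>(i, j). rat_var (t, m + i + 1, m + j + 1)))"

text \<open>\<open>mat_alg m n T\<close> is freely generated, as a supercommutative superalgebra, by the entries of
  one generic matrix for each \<open>t \<in> T\<close>; \<open>mat_alg m n {1}\<close> is \<open>A(m|n)\<close>.\<close>

inductive_set mat_alg :: "nat \<Rightarrow> nat \<Rightarrow> nat set \<Rightarrow> 'a::field sfun set"
  for m n :: nat and T :: "nat set" where
  const: "sconst a \<in> mat_alg m n T"
| entry: "t \<in> T \<Longrightarrow> i \<in> {1..m + n} \<Longrightarrow> j \<in> {1..m + n} \<Longrightarrow> entry m t i j \<in> mat_alg m n T"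
| add: "f \<in> mat_alg m n T \<Longrightarrow> g \<in> mat_alg m n T \<Longrightarrow> f + g \<in> mat_alg m n T"
| mult: "f \<in> mat_alg m n T \<Longrightarrow> g \<in> mat_alg m n T \<Longrightarrow> f * g \<in> mat_alg m n T"

text \<open>The localization of \<open>mat_alg m n T\<close> at the elements \<open>det_blocks m n t\<close> for \<open>t \<in> T\<close>, which
  are central and not zero divisors: \<open>F[G]\<close> is \<open>loc_alg m n {1}\<close>. Since the tensor product of free
  supercommutative superalgebras is free on the union of the generators, \<open>F[G] \<otimes> F[G]\<close> with its
  multiplication \<open>(a \<otimes> b)(c \<otimes> d) = (- 1)\<^bsup>|b||c|\<^esup> ac \<otimes> bd\<close> is \<open>loc_alg m n {1, 2}\<close>.\<close>

definition loc_alg :: "nat \<Rightarrow> nat \<Rightarrow> nat set \<Rightarrow> 'a::field sfun set" where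
  "loc_alg m n T = {f. \<exists>k. gscalar ((\<Prod>t\<in>T. det_blocks m n t) ^ k) * f \<in> mat_alg m n T}"

definition coord_alg :: "nat \<Rightarrow> nat \<Rightarrow> 'a::field sfun set" where
  "coord_alg m n = loc_alg m n {1}"

definition alg_hom_on :: "'a::field sfun set \<Rightarrow> ('a sfun \<Rightarrow> 'a sfun) \<Rightarrow> bool" where
  "alg_hom_on R \<phi> \<longleftrightarrow>
    \<phi> 1 = 1 \<and>
    (\<forall>f\<in>R. \<forall>g\<in>R. \<phi> (f + g) = \<phi> f + \<phi> g \<and> \<phi> (f * g) = \<phi> f * \<phi> g) \<and>
    (\<forall>a. \<forall>f\<in>R. \<phi> (sscale a f) = sscale a (\<phi> f))"

text \<open>The homomorphism on \<open>loc_alg m n T\<close> that maps the entry \<open>c\<^sub>i\<^sub>j\<close> of the \<open>t\<close>-th generic matrix to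
  \<open>\<sigma> t i j\<close>. It exists if each \<open>\<sigma> t i j\<close> has the parity of \<open>c\<^sub>i\<^sub>j\<close> and the images of the
  determinants are invertible, and it is unique because the determinants are units of
  \<open>loc_alg m n T\<close>; the last conjunct only fixes its values off the domain.\<close>

definition subst_hom ::
  "nat \<Rightarrow> nat \<Rightarrow> nat set \<Rightarrow> (nat \<Rightarrow> nat \<Rightarrow> nat \<Rightarrow> 'a::field sfun) \<Rightarrow> 'a sfun \<Rightarrow> 'a sfun" where
  "subst_hom m n T \<sigma> = (THE \<phi>. alg_hom_on (loc_alg m n T) \<phi> \<and>
    (\<forall>t\<in>T. \<forall>i\<in>{1..m + n}. \<forall>j\<in>{1..m + n}. \<phi> (entry m t i j) = \<sigma> t i j) \<and>
    (\<forall>f. f \<notin> loc_alg m n T \<longrightarrow> \<phi> f = 0))"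

definition comult :: "nat \<Rightarrow> nat \<Rightarrow> 'a::field sfun \<Rightarrow> 'a sfun" where
  "comult m n = subst_hom m n {1} (\<lambda>_ i j. \<Sum>k = 1..m + n. entry m 1 i k * entry m 2 k j)"

text \<open>\<open>f \<mapsto> f \<otimes> 1\<close> is the inclusion of \<open>loc_alg m n {1}\<close> in \<open>loc_alg m n {1, 2}\<close>, and
  \<open>right_factor m n\<close> is \<open>f \<mapsto> 1 \<otimes> f\<close>.\<close>

definition right_factor :: "nat \<Rightarrow> nat \<Rightarrow> 'a::field sfun \<Rightarrow> 'a sfun" where
  "right_factor m n = subst_hom m n {1} (\<lambda>_ i j. entry m 2 i j)"

definition tensor :: "nat \<Rightarrow> nat \<Rightarrow> 'a::field sfun \<Rightarrow> 'a sfun \<Rightarrow> 'a sfun" where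
  "tensor m n f g = f * right_factor m n g"

definition tensor_space :: "nat \<Rightarrow> nat \<Rightarrow> 'a::field sfun set \<Rightarrow> 'a sfun set \<Rightarrow> 'a sfun set" where
  "tensor_space m n V W = sfun.span {tensor m n f g | f g. f \<in> V \<and> g \<in> W}"

section \<open>Subsupermodules of \<open>F[G]\<close>\<close>

text \<open>\<open>G\<close>-supermodules are right \<open>F[G]\<close>-supercomodules. All those needed here are contained in
  \<open>F[G]\<close>, on which \<open>G\<close> acts by right translations, i.e. the coaction is the comultiplication.\<close>

definition subsupermodule :: "nat \<Rightarrow> nat \<Rightarrow> 'a::field sfun set \<Rightarrow> bool" where
  "subsupermodule m n W \<longleftrightarrow>
    W \<subseteq> coord_alg m n \<and> sfun.subspace W \<and>
    (\<forall>f\<in>W. gpart True f \<in> W \<and> gpart False f \<in> W) \<and>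
    comult m n ` W \<subseteq> tensor_space m n W (coord_alg m n)"

definition polynomial_supermodule :: "nat \<Rightarrow> nat \<Rightarrow> 'a::field sfun set \<Rightarrow> bool" where
  "polynomial_supermodule m n W \<longleftrightarrow>
    subsupermodule m n W \<and> comult m n ` W \<subseteq> tensor_space m n W (mat_alg m n {1})"

definition simple_supermodule :: "nat \<Rightarrow> nat \<Rightarrow> 'a::field sfun set \<Rightarrow> bool" where
  "simple_supermodule m n W \<longleftrightarrow> subsupermodule m n W \<and> W \<noteq> {0} \<and>
    (\<forall>U. subsupermodule m n U \<and> U \<subseteq> W \<longrightarrow> U = {0} \<or> U = W)"

definition socle :: "nat \<Rightarrow> nat \<Rightarrow> 'a::field sfun set \<Rightarrow> 'a sfun set" where
  "socle m n W = sfun.span (\<Union> {U. simple_supermodule m n U \<and> U \<subseteq> W})"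

text \<open>Morphisms \<open>V \<rightarrow> W\<close> of right supercomodules, of either parity: an odd one is a morphism from
  \<open>V\<close> to the parity change of \<open>W\<close>. The last conjunct is \<open>\<Delta> \<circ> \<phi> = (\<phi> \<otimes> id) \<circ> \<Delta>\<close>; there is no sign,
  since \<open>id\<close> is even.\<close>

definition supermodule_hom ::
  "nat \<Rightarrow> nat \<Rightarrow> 'a::field sfun set \<Rightarrow> 'a sfun set \<Rightarrow> ('a sfun \<Rightarrow> 'a sfun) \<Rightarrow> bool" where
  "supermodule_hom m n V W \<phi> \<longleftrightarrow>
    \<phi> ` V \<subseteq> W \<and>
    (\<forall>f\<in>V. \<forall>g\<in>V. \<phi> (f + g) = \<phi> f + \<phi> g) \<and>
    (\<forall>a. \<forall>f\<in>V. \<phi> (sscale a f) = sscale a (\<phi> f)) \<and>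
    (\<exists>p. \<forall>f\<in>V. \<forall>q. \<phi> (gpart q f) = gpart (q = p) (\<phi> f)) \<and>
    (\<forall>f\<in>V. \<forall>(r::nat) u a. (\<forall>k<r. u k \<in> V \<and> a k \<in> coord_alg m n) \<and>
        comult m n f = (\<Sum>k<r. tensor m n (u k) (a k)) \<longrightarrow>
      comult m n (\<phi> f) = (\<Sum>k<r. tensor m n (\<phi> (u k)) (a k)))"

text \<open>\<open>L\<close> is simple and, up to parity change, isomorphic to \<open>V / U\<close> for some \<open>U \<subseteq> V \<subseteq> M\<close>; the
  isomorphism is given as a surjective morphism \<open>V \<rightarrow> L\<close> with kernel \<open>U\<close>.\<close>

definition composition_factor :: "nat \<Rightarrow> nat \<Rightarrow> 'a::field sfun set \<Rightarrow> 'a sfun set \<Rightarrow> bool" where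
  "composition_factor m n L M \<longleftrightarrow> simple_supermodule m n L \<and>
    (\<exists>U V \<phi>. subsupermodule m n U \<and> subsupermodule m n V \<and> U \<subseteq> V \<and> V \<subseteq> M \<and>
      supermodule_hom m n V L \<phi> \<and> \<phi> ` V = L \<and> {f \<in> V. \<phi> f = 0} = U)"

section \<open>Weights and induced supermodules\<close>

text \<open>A weight \<open>(\<lambda>\<^sup>+|\<lambda>\<^sup>-)\<close> is a function on \<open>{1..m + n}\<close>, extended by 0, with
  \<open>\<lambda>\<^sup>+\<^sub>i = \<lambda> i\<close> and \<open>\<lambda>\<^sup>-\<^sub>j = \<lambda> (m + j)\<close>.\<close>

type_synonym weight = "nat \<Rightarrow> int"

definition weights :: "nat \<Rightarrow> nat \<Rightarrow> weight set" where
  "weights m n = {lam. \<forall>s. s \<notin> {1..m + n} \<longrightarrow> lam s = 0}"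

definition dominant :: "nat \<Rightarrow> nat \<Rightarrow> weight \<Rightarrow> bool" where
  "dominant m n lam \<longleftrightarrow> lam \<in> weights m n \<and>
    (\<forall>i i'. 1 \<le> i \<and> i \<le> i' \<and> i' \<le> m \<longrightarrow> lam i \<ge> lam i') \<and>
    (\<forall>j j'. 1 \<le> j \<and> j \<le> j' \<and> j' \<le> n \<longrightarrow> lam (m + j) \<ge> lam (m + j'))"

text \<open>\<open>\<pi> \<otimes> id\<close> for the restriction \<open>\<pi> : F[G] \<rightarrow> F[B]\<close> to the lower triangular Borel
  subsupergroup \<open>B\<close>. The superalgebra \<open>F[B]\<close> is free on the \<open>c\<^sub>i\<^sub>j\<close> with \<open>i \<ge> j\<close>, localized
  at \<open>det C\<^sub>1\<^sub>1 det C\<^sub>2\<^sub>2 = c\<^sub>1\<^sub>1 c\<^sub>2\<^sub>2 \<dots>\<close>.\<close>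

definition borel_restrict :: "nat \<Rightarrow> nat \<Rightarrow> 'a::field sfun \<Rightarrow> 'a sfun" where
  "borel_restrict m n =
    subst_hom m n {1, 2} (\<lambda>t i j. if t = 1 \<and> i < j then 0 else entry m t i j)"

definition borel_character :: "nat \<Rightarrow> nat \<Rightarrow> weight \<Rightarrow> 'a::field sfun" where
  "borel_character m n lam = gscalar (\<Prod>s = 1..m + n. rat_var (1, s, s) powi lam s)"

text \<open>\<open>H\<^sup>0\<^sub>G(\<lambda>)\<close> is the cotensor product of the one-dimensional \<open>F[B]\<close>-supercomodule of weight \<open>\<lambda>\<close>
  with \<open>F[G]\<close> over \<open>F[B]\<close>, i.e. it consists of the \<open>f\<close> with \<open>f (b g) = \<lambda>(b) f(g)\<close>.\<close>

definition induced :: "nat \<Rightarrow> nat \<Rightarrow> weight \<Rightarrow> 'a::field sfun set" where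
  "induced m n lam = {f \<in> coord_alg m n.
    borel_restrict m n (comult m n f) = tensor m n (borel_character m n lam) f}"

definition simple_module :: "nat \<Rightarrow> nat \<Rightarrow> weight \<Rightarrow> 'a::field sfun set" where
  "simple_module m n lam = socle m n (induced m n lam)"

text \<open>The largest element exists, since sums of polynomial subsupermodules are polynomial.\<close>

definition nabla :: "nat \<Rightarrow> nat \<Rightarrow> weight \<Rightarrow> 'a::field sfun set" where
  "nabla m n lam = (GREATEST W. polynomial_supermodule m n W \<and> W \<subseteq> induced m n lam)"

text \<open>The type argument is the ground field.\<close>

definition polynomial_weight :: "'a::field itself \<Rightarrow> nat \<Rightarrow> nat \<Rightarrow> weight \<Rightarrow> bool" where
  "polynomial_weight F m n lam \<longleftrightarrow>
    lam \<in> weights m n \<and> (nabla m n lam :: 'a sfun set) \<noteq> {0}"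

definition delta :: "nat \<Rightarrow> weight" where
  "delta s = (\<lambda>r. if r = s then 1 else 0)"

text \<open>\<open>\<lambda>\<^sub>I\<^sub>|\<^sub>J\<close>, where the multi-indices \<open>I\<close> and \<open>J\<close> are lists of the same length.\<close>

definition odd_shift :: "nat \<Rightarrow> weight \<Rightarrow> nat list \<Rightarrow> nat list \<Rightarrow> weight" where
  "odd_shift m lam I J =
    (\<lambda>r. lam r - (\<Sum>s<length I. delta (I ! s) r) + (\<Sum>s<length J. delta (m + J ! s) r))"

definition admissible :: "nat \<Rightarrow> nat \<Rightarrow> weight \<Rightarrow> nat list \<Rightarrow> nat list \<Rightarrow> bool" where
  "admissible m n lam I J \<longleftrightarrow>
    length I = length J \<and> set I \<subseteq> {1..m} \<and> set J \<subseteq> {1..n} \<and>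
    dominant m n (odd_shift m lam I J) \<and> sorted I \<and>
    (\<forall>t1 t2. t1 < t2 \<and> t2 < length I \<and> I ! t1 = I ! t2 \<longrightarrow> J ! t1 < J ! t2)"

definition omega :: "nat \<Rightarrow> weight \<Rightarrow> nat \<Rightarrow> nat \<Rightarrow> int" where
  "omega m lam i j = lam i + lam (m + j) + int m + 1 - int i - int j"

definition simply_odd_linked :: "nat \<Rightarrow> nat \<Rightarrow> weight \<Rightarrow> weight \<Rightarrow> bool" where
  "simply_odd_linked m n lam mu \<longleftrightarrow> lam \<in> weights m n \<and> mu \<in> weights m n \<and>
    (\<exists>i\<in>{1..m}. \<exists>j\<in>{1..n}.
      (odd_shift m lam [i] [j] = mu \<or> odd_shift m mu [i] [j] = lam) \<and> omega m lam i j = 0)"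

definition poly_odd_linked :: "'a::field itself \<Rightarrow> nat \<Rightarrow> nat \<Rightarrow> weight \<Rightarrow> weight \<Rightarrow> bool" where
  "poly_odd_linked F m n lam mu \<longleftrightarrow>
    (\<exists>ws. ws \<noteq> [] \<and> hd ws = lam \<and> last ws = mu \<and>
      successively (simply_odd_linked m n) ws \<and> (\<forall>w\<in>set ws. polynomial_weight F m n w))"

end

(*
  In characteristic 0 the conclusion holds because no proper step can occur: the quadratic Casimir
  element separates lambda from lambda_{I|J} unless I is empty. Left and right translations define
  superderivations of F[G], and the Casimir elements of the two actions coincide as operators on F[G].
  The left one acts on H^0(lambda) by a scalar c(lambda), since H^0(lambda) consists of highest weight
  vectors for left translations; the right one commutes with morphisms of supermodules. Hence a
  composition factor L(mu) of nabla(lambda) satisfies c(mu) = c(lambda). Up to a multiple of the degree,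
  c is twice the sum of the contents of the hook partition. Passing from lambda to a polynomial weight
  lambda_{I|J} moves boxes from the first m rows, at columns beyond max J, to rows below m and columns
  at most max J, which strictly decreases every content involved. That the weights are given by hook
  partitions is seen by applying odd lowering operators to a highest weight vector in A(m|n), all of
  whose weights are nonnegative.
*)
theory Submission
  imports Defs
begin

section \<open>Supercommutativity\<close>

text \<open>The obstacle is that group, coaction and induced module are given only through
  homomorphisms of superalgebras, characterized by their values on generators; neither points nor
  derivatives are at hand. Both are recovered inside the same Grassmann algebra: besides the entries
  of the generic matrices it contains the generators \<open>(0, 0, 0)\<close> and
  \<open>(0, 0, 1)\<close>, from which a square-zero element \<theta> of either parity is formed.
  Substituting 1 + \<theta> E for one of the two matrices in \<Delta>(f) and comparing coefficients
  of \<theta> turns the equivariance that defines H^0(\<lambda>) into the equations of a highest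
  weight vector, and compatibility with the coaction into commutation with \<open>Rop\<close>. The
  Casimir operators agree because they fail to commute with multiplication by an entry in the same
  way: the cross terms \<open>lcross\<close> and \<open>rcross\<close> are superderivations with
  equal values on generators. The final estimate has one parameter, c = max J, and every moved box
  lowers the eigenvalue by at least 4.\<close>

lemma gcoeff_0 [simp]: "gcoeff 0 S = 0"
  by (simp add: zero_grassmann.rep_eq)

lemma gcoeff_add [simp]: "gcoeff (f + g) S = gcoeff f S + gcoeff g S"
  by (simp add: plus_grassmann.rep_eq)

lemma gcoeff_minus [simp]: "gcoeff (- f) S = - gcoeff f S"
  by (simp add: uminus_grassmann.rep_eq)

lemma gcoeff_diff [simp]: "gcoeff (f - g) S = gcoeff f S - gcoeff g S"
  unfolding minus_grassmann_def gcoeff_add gcoeff_minus by simp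

lemma gcoeff_sum [simp]: "gcoeff (sum f A) S = (\<Sum>a\<in>A. gcoeff (f a) S)"
  by (induction A rule: infinite_finite_induct) auto

lemma gcoeff_1 [simp]: "gcoeff 1 S = (if S = {} then 1 else 0)"
  by (simp add: one_grassmann.rep_eq)

lemma gcoeff_gscalar [simp]: "gcoeff (gscalar c) S = (if S = {} then c else 0)"
  by (simp add: gscalar.rep_eq)

lemma gcoeff_ggen [simp]: "gcoeff (ggen v) S = (if S = {v} then 1 else 0)"
  by (simp add: ggen.rep_eq)

lemma gcoeff_mult:
  "gcoeff (f * g) U = (\<Sum>S\<in>Pow U. shuffle_sign S (U - S) * gcoeff f S * gcoeff g (U - S))"
  by (simp add: times_grassmann.rep_eq)

lemma gcoeff_mult_empty [simp]: "gcoeff (f * g) {} = gcoeff f {} * gcoeff g {}"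
  by (simp add: gcoeff_mult)

lemma gcoeff_finite: "gcoeff f S \<noteq> 0 \<Longrightarrow> finite S"
  using gcoeff[of f] by auto

lemma gcoeff_infinite: "infinite S \<Longrightarrow> gcoeff f S = 0"
  using gcoeff_finite by blast

lemma finite_gsupp: "finite {S. gcoeff f S \<noteq> 0}"
  using gcoeff[of f] by auto

lemma gcoeff_mult_nonzero:
  assumes "gcoeff (f * g) U \<noteq> 0"
  obtains S where "S \<subseteq> U" "gcoeff f S \<noteq> 0" "gcoeff g (U - S) \<noteq> 0"
proof -
  obtain S where "S \<in> Pow U" "shuffle_sign S (U - S) * gcoeff f S * gcoeff g (U - S) \<noteq> 0"
    using assms unfolding gcoeff_mult using sum.not_neutral_contains_not_neutral by blast
  then show thesis by (intro that[of S]) auto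
qed

lemma minus_one_power_even_eq: "even (a + b) \<Longrightarrow> (- 1 :: 'k::comm_ring_1) ^ a = (- 1) ^ b"
  by (cases "even a") auto

text \<open>For disjoint S and T each pair of S \<times> T is an inversion in exactly one of the two
  orders, so the two inversion counts add up to card S * card T.\<close>

lemma shuffle_sign_swap:
  assumes "finite S" "finite T" "S \<inter> T = {}"
  shows "shuffle_sign S T = (- 1) ^ (card S * card T) * shuffle_sign T S"
proof -
  let ?A = "{(a, b). a \<in> S \<and> b \<in> T \<and> b < a}" and ?B = "{(a, b). a \<in> T \<and> b \<in> S \<and> b < a}"
  have fin: "finite ?A" "finite ?B"
    by (rule finite_subset[of _ "S \<times> T"], use assms in auto)
       (rule finite_subset[of _ "T \<times> S"], use assms in auto)
  have "card S * card T = card (S \<times> T)" by (simp add: card_cartesian_product)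
  also have "S \<times> T = ?A \<union> prod.swap ` ?B"
    using assms by (auto simp: image_iff)
  also have "card \<dots> = card ?A + card (prod.swap ` ?B)"
    by (rule card_Un_disjoint) (use fin in auto)
  also have "card (prod.swap ` ?B) = card ?B" by (rule card_image) simp
  finally show ?thesis
    unfolding shuffle_sign_def power_add[symmetric]
    by (intro minus_one_power_even_eq) presburger
qed

text \<open>For \<open>b = True\<close> the parity automorphism, which multiplies odd elements by
  -1, otherwise the identity. The flag is the parity of a homogeneous element that is moved past f,
  so that sign rules can be written without splitting f into its even and odd part.\<close>

lift_definition ginv :: "bool \<Rightarrow> ('v, 'k::ab_group_add) grassmann \<Rightarrow> ('v, 'k) grassmann"
  is "\<lambda>b f S. if b \<and> odd (card S) then - f S else f S"
proof (intro conjI allI impI)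
  fix b and f :: "'v set \<Rightarrow> 'k"
  assume f: "finite {S. f S \<noteq> 0} \<and> (\<forall>S. f S \<noteq> 0 \<longrightarrow> finite S)"
  show "finite {S. (if b \<and> odd (card S) then - f S else f S) \<noteq> 0}"
    by (rule finite_subset[of _ "{S. f S \<noteq> 0}"]) (use f in auto)
  show "finite S" if "(if b \<and> odd (card S) then - f S else f S) \<noteq> 0" for S
    using that f by (simp split: if_splits)
qed

lemma gcoeff_ginv: "gcoeff (ginv b f) S = (if b \<and> odd (card S) then - gcoeff f S else gcoeff f S)"
  by (simp add: ginv.rep_eq)

lemma ginv_False [simp]: "ginv False f = f"
  by (rule grassmann_eqI) (simp add: gcoeff_ginv)

lemma ginv_0 [simp]: "ginv b 0 = 0"
  by (rule grassmann_eqI) (simp add: gcoeff_ginv)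

lemma ginv_add: "ginv b (f + g) = ginv b f + ginv b g"
  by (rule grassmann_eqI) (simp add: gcoeff_ginv)

lemma ginv_minus: "ginv b (- f) = - ginv b f"
  by (rule grassmann_eqI) (simp add: gcoeff_ginv)

lemma ginv_ginv [simp]: "ginv b (ginv c f) = ginv (b \<noteq> c) f"
  by (rule grassmann_eqI) (simp add: gcoeff_ginv)

lemma ginv_sum: "ginv b (sum f A) = (\<Sum>a\<in>A. ginv b (f a))"
  by (induction A rule: infinite_finite_induct) (auto simp: ginv_add)

lemma ginv_1 [simp]: "ginv b 1 = 1"
  and ginv_gscalar [simp]: "ginv b (gscalar c) = gscalar c"
  by (rule grassmann_eqI; auto simp: gcoeff_ginv)+

lemma ginv_mult:
  fixes f g :: "('v::linorder, 'k::comm_ring_1) grassmann"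
  shows "ginv b (f * g) = ginv b f * ginv b g"
proof (rule grassmann_eqI)
  fix U :: "'v set"
  show "gcoeff (ginv b (f * g)) U = gcoeff (ginv b f * ginv b g) U"
  proof (cases "finite U")
    case True
    have "card U = card S + card (U - S)" if "S \<subseteq> U" for S
      using that True card_Un_disjoint[of S "U - S"] by (auto simp: Un_absorb1 finite_subset)
    then show ?thesis
      by (auto simp: gcoeff_ginv gcoeff_mult sum_negf[symmetric] intro!: sum.cong)
  qed (simp add: gcoeff_infinite)
qed

text \<open>\<open>True\<close> means odd here, whereas \<open>gpart True\<close> is the even
  component. As only nonzero coefficients are tested, 0 has both parities.\<close>

definition ghom :: "bool \<Rightarrow> ('v, 'k::zero) grassmann \<Rightarrow> bool" where
  "ghom b f \<longleftrightarrow> (\<forall>S. gcoeff f S \<noteq> 0 \<longrightarrow> odd (card S) = b)"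

lemma ghom_0 [simp]: "ghom b 0"
  and ghom_1 [simp]: "ghom False 1"
  and ghom_gscalar [simp]: "ghom False (gscalar c)"
  and ghom_ggen [simp]: "ghom True (ggen v)"
  by (auto simp: ghom_def split: if_splits)

lemma ghom_add: "ghom b f \<Longrightarrow> ghom b g \<Longrightarrow> ghom b (f + g)"
  unfolding ghom_def by (metis add.right_neutral gcoeff_add)

lemma ghom_minus: "ghom b f \<Longrightarrow> ghom b (- f)"
  unfolding ghom_def by auto

lemma ghom_sum: "(\<And>a. a \<in> A \<Longrightarrow> ghom b (f a)) \<Longrightarrow> ghom b (sum f A)"
  by (induction A rule: infinite_finite_induct) (auto simp: ghom_add)

lemma ghom_mult:
  assumes "ghom b f" "ghom c g"
  shows "ghom (b \<noteq> c) (f * g)"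
  unfolding ghom_def
proof (intro allI impI)
  fix U assume U: "gcoeff (f * g) U \<noteq> 0"
  then obtain S where S: "S \<subseteq> U" "gcoeff f S \<noteq> 0" "gcoeff g (U - S) \<noteq> 0"
    by (rule gcoeff_mult_nonzero)
  have "card U = card S + card (U - S)"
    using S(1) gcoeff_finite[OF U] card_Un_disjoint[of S "U - S"]
    by (auto simp: Un_absorb1 finite_subset)
  then show "odd (card U) = (b \<noteq> c)"
    using assms S unfolding ghom_def by auto
qed

lemma ghom_mult_even: "ghom False f \<Longrightarrow> ghom False g \<Longrightarrow> ghom False (f * g)"
  using ghom_mult[of False f False g] by simp

lemma ginv_ghom: "ghom c f \<Longrightarrow> ginv b f = (if b \<and> c then - f else f)"
  by (rule grassmann_eqI) (simp add: gcoeff_ginv ghom_def, metis neg_equal_0_iff_equal)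

lemma ghom_ginv: "ghom c f \<Longrightarrow> ghom c (ginv b f)"
  by (cases c; cases b) (simp_all add: ginv_ghom ghom_minus)

text \<open>Only f has to be homogeneous: the sign depends on the component of g and is absorbed by
  \<open>ginv b\<close>. In each term that survives, the set belonging to f has parity b, so the
  sign of \<open>shuffle_sign_swap\<close> is determined by the set belonging to g.\<close>

lemma supercommute:
  fixes f g :: "('v::linorder, 'k::comm_ring_1) grassmann"
  assumes "ghom b f"
  shows "f * g = ginv b g * f"
proof (rule grassmann_eqI)
  fix U :: "'v set"
  show "gcoeff (f * g) U = gcoeff (ginv b g * f) U"
  proof (cases "finite U")
    case True
    have "gcoeff (f * g) U = (\<Sum>S\<in>Pow U. shuffle_sign (U - S) S * gcoeff f (U - S) * gcoeff g S)"
      unfolding gcoeff_mult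
      by (rule sum.reindex_bij_witness[of _ "\<lambda>S. U - S" "\<lambda>S. U - S"]) (auto simp: double_diff)
    also have "\<dots> = gcoeff (ginv b g * f) U"
      unfolding gcoeff_mult
    proof (rule sum.cong[OF refl])
      fix S assume "S \<in> Pow U"
      then have S: "S \<subseteq> U" "finite S" using True finite_subset by auto
      have "shuffle_sign (U - S) S = (- 1 :: 'k) ^ (card (U - S) * card S) * shuffle_sign S (U - S)"
        by (rule shuffle_sign_swap) (use True S in auto)
      moreover have "gcoeff f (U - S) = 0" if "odd (card (U - S)) \<noteq> b"
        using that assms unfolding ghom_def by blast
      ultimately show "shuffle_sign (U - S) S * gcoeff f (U - S) * gcoeff g S =
          shuffle_sign S (U - S) * gcoeff (ginv b g) S * gcoeff f (U - S)"
        by (cases "odd (card (U - S)) = b") (auto simp: gcoeff_ginv)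
    qed
    finally show ?thesis .
  qed (simp add: gcoeff_infinite)
qed

lemma even_commute: "ghom False f \<Longrightarrow> f * g = g * f"
  using supercommute[of False f g] by simp

lemma gscalar_commute: "gscalar c * f = f * gscalar c"
  by (simp add: even_commute)

lemma gcoeff_gscalar_mult [simp]: "gcoeff (gscalar c * f) U = c * gcoeff f U"
proof (cases "finite U")
  case True
  have "gcoeff (gscalar c * f) U = (\<Sum>S\<in>Pow U. if S = {} then c * gcoeff f U else 0)"
    unfolding gcoeff_mult by (rule sum.cong) auto
  then show ?thesis using True by simp
qed (simp add: gcoeff_infinite)

lemma gscalar_0 [simp]: "gscalar 0 = 0"
  by (rule grassmann_eqI) simp

lemma gscalar_minus: "gscalar (- c) = - gscalar c"
  by (rule grassmann_eqI) simp

lemma gscalar_sum: "gscalar (sum f A) = (\<Sum>a\<in>A. gscalar (f a))"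
  by (induction A rule: infinite_finite_induct) (auto simp: gscalar_add)

lemma gscalar_power: "gscalar (c ^ k) = gscalar c ^ k"
  by (induction k) (auto simp: gscalar_mult gscalar_1)

lemma gscalar_mult_inverse:
  fixes c :: "'k::field"
  assumes "c \<noteq> 0"
  shows "gscalar (inverse c) * (gscalar c * f) = f"
  by (rule grassmann_eqI) (use assms in simp)

lemma gscalar_mult_left_cancel:
  fixes c :: "'k::field"
  shows "c \<noteq> 0 \<Longrightarrow> gscalar c * f = gscalar c * g \<longleftrightarrow> f = g"
  by (metis gscalar_mult_inverse(1))

lemma gcoeff_ggen_mult:
  "gcoeff (ggen v * f) U = (if v \<in> U then shuffle_sign {v} (U - {v}) * gcoeff f (U - {v}) else 0)"
proof (cases "finite U")
  case True
  have "gcoeff (ggen v * f) U =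
      (\<Sum>S\<in>Pow U. if S = {v} then shuffle_sign {v} (U - {v}) * gcoeff f (U - {v}) else 0)"
    unfolding gcoeff_mult by (rule sum.cong) auto
  then show ?thesis using True by simp
qed (simp add: gcoeff_infinite)

text \<open>An odd element anticommutes with itself, so twice its square is 0, and 2 can be
  cancelled in the coefficients.\<close>

lemma odd_square_zero:
  fixes f :: "('v::linorder, 'k::{comm_ring_1, ring_char_0, semiring_no_zero_divisors}) grassmann"
  assumes "ghom True f"
  shows "f * f = 0"
proof (rule grassmann_eqI)
  fix S
  have "f * f = ginv True f * f" by (rule supercommute[OF assms])
  also have "\<dots> = - (f * f)" by (simp add: ginv_ghom[OF assms])
  finally have "gcoeff (f * f) S = - gcoeff (f * f) S" by (metis gcoeff_minus)
  then have "2 * gcoeff (f * f) S = 0" by (metis eq_neg_iff_add_eq_0 mult_2)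
  then show "gcoeff (f * f) S = gcoeff 0 S" by simp
qed

section \<open>Substitution homomorphisms\<close>

text \<open>A separate type makes the even part a commutative ring, so that determinants,
  divisibility and ring homomorphisms with values in it can be used. The images of the even
  generators lie there.\<close>

typedef (overloaded) ('v, 'k) geven = "{f :: ('v::linorder, 'k::comm_ring_1) grassmann. ghom False f}"
  morphisms of_even Abs_even
  by (rule exI[of _ 0]) simp

setup_lifting type_definition_geven

instantiation geven :: (linorder, comm_ring_1) comm_ring_1
begin

lift_definition zero_geven :: "('a, 'b) geven" is 0 by simp
lift_definition one_geven :: "('a, 'b) geven" is 1 by simp
lift_definition plus_geven :: "('a, 'b) geven \<Rightarrow> ('a, 'b) geven \<Rightarrow> ('a, 'b) geven" is "(+)"
  by (rule ghom_add)
lift_definition uminus_geven :: "('a, 'b) geven \<Rightarrow> ('a, 'b) geven" is uminus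
  by (rule ghom_minus)
lift_definition minus_geven :: "('a, 'b) geven \<Rightarrow> ('a, 'b) geven \<Rightarrow> ('a, 'b) geven" is "(-)"
  unfolding minus_grassmann_def by (intro ghom_add ghom_minus)
lift_definition times_geven :: "('a, 'b) geven \<Rightarrow> ('a, 'b) geven \<Rightarrow> ('a, 'b) geven" is "(*)"
  by (rule ghom_mult_even)

instance
proof
  fix a b c :: "('a, 'b) geven"
  show "a * b = b * a" by transfer (rule even_commute)
qed (transfer; simp add: algebra_simps)+

end

lemma of_even_0 [simp]: "of_even 0 = 0" by transfer (rule refl)
lemma of_even_1 [simp]: "of_even 1 = 1" by transfer (rule refl)
lemma of_even_add [simp]: "of_even (x + y) = of_even x + of_even y" by transfer (rule refl)
lemma of_even_minus [simp]: "of_even (- x) = - of_even x" by transfer (rule refl)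
lemma of_even_diff [simp]: "of_even (x - y) = of_even x - of_even y" by transfer (rule refl)
lemma of_even_mult [simp]: "of_even (x * y) = of_even x * of_even y" by transfer (rule refl)
lemma of_even_sum [simp]: "of_even (sum f A) = (\<Sum>a\<in>A. of_even (f a))"
  by (induction A rule: infinite_finite_induct) auto
lemma of_even_power [simp]: "of_even (x ^ k) = of_even x ^ k"
  by (induction k) auto
lemma ghom_of_even [simp]: "ghom False (of_even x)"
  using of_even[of x] by simp
lemma of_even_Abs: "ghom False f \<Longrightarrow> of_even (Abs_even f) = f"
  by (simp add: Abs_even_inverse)

text \<open>The residue modulo the ideal generated by the odd generators; it decides
  invertibility.\<close>

abbreviation body :: "('v::linorder, 'k::comm_ring_1) geven \<Rightarrow> 'k" where
  "body x \<equiv> gcoeff (of_even x) {}"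

lemma body_hom: "comm_ring_hom body"
  by unfold_locales auto

text \<open>An element without constant term contributes at least one generator per factor, so its
  k-th power contains only products of k or more generators.\<close>

lemma gcoeff_power_support:
  fixes f :: "('v::linorder, 'k::comm_ring_1) grassmann"
  assumes V: "\<And>S. gcoeff f S \<noteq> 0 \<Longrightarrow> S \<subseteq> V \<and> S \<noteq> {}"
  shows "gcoeff (f ^ k) S \<noteq> 0 \<Longrightarrow> S \<subseteq> V \<and> k \<le> card S"
proof (induction k arbitrary: S)
  case 0
  then show ?case by (auto split: if_splits)
next
  case (Suc k)
  then obtain T where T: "T \<subseteq> S" "gcoeff f T \<noteq> 0" "gcoeff (f ^ k) (S - T) \<noteq> 0"
    by (auto elim: gcoeff_mult_nonzero)
  have fin: "finite T" "finite (S - T)" using T gcoeff_finite by auto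
  have "card S = card T + card (S - T)"
    using card_Un_disjoint[OF fin] T(1) by (auto simp: Un_absorb1)
  moreover have "card T \<noteq> 0" using V[OF T(2)] fin by simp
  ultimately show ?case using V[OF T(2)] Suc.IH[OF T(3)] T(1) by auto
qed

text \<open>Only the finitely many generators in V occur, and a product of more than
  \<open>card V\<close> of them vanishes.\<close>

lemma geven_nilpotent:
  assumes "body x = 0"
  shows "\<exists>k. x ^ k = 0"
proof -
  define V where "V = \<Union> {S. gcoeff (of_even x) S \<noteq> 0}"
  have "finite V" unfolding V_def using finite_gsupp gcoeff_finite by blast
  have "S \<subseteq> V \<and> S \<noteq> {}" if "gcoeff (of_even x) S \<noteq> 0" for S
    using that assms unfolding V_def by auto
  note supp = gcoeff_power_support[OF this]
  have "gcoeff (of_even x ^ Suc (card V)) S = 0" for S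
    using supp[where k = "Suc (card V)" and S = S] card_mono[OF \<open>finite V\<close>, of S] by force
  then have "of_even x ^ Suc (card V) = 0" by (intro grassmann_eqI) simp
  then have "x ^ Suc (card V) = 0"
    by (simp add: of_even_inject[symmetric] del: power_Suc)
  then show ?thesis ..
qed

text \<open>With y the scalar given by the body of x, the difference y - x is nilpotent. If (y -
  x)^k = 0, then x = y - (y - x) divides y^k - (y - x)^k = y^k, which is a unit.\<close>

lemma geven_unit:
  fixes x :: "('v::linorder, 'k::field) geven"
  assumes "body x \<noteq> 0"
  shows "x dvd 1"
proof -
  define b where "b = body x"
  define y :: "('v, 'k) geven" where "y = Abs_even (gscalar b)"
  have y: "of_even y = gscalar b" by (simp add: y_def of_even_Abs)
  have "y * Abs_even (gscalar (inverse b)) = 1"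
    using assms by (simp add: of_even_inject[symmetric] y of_even_Abs b_def flip: gscalar_mult gscalar_1)
  then have "y dvd 1" by (metis dvdI)
  have "body (y - x) = 0" by (simp add: y b_def)
  then obtain k where "(y - x) ^ k = 0" using geven_nilpotent by blast
  moreover have "y ^ k - (y - x) ^ k = (y - (y - x)) * (\<Sum>i<k. (y - x) ^ (k - Suc i) * y ^ i)"
    by (rule power_diff_sumr2)
  ultimately have "x dvd y ^ k" by simp
  then show ?thesis using \<open>y dvd 1\<close> by (metis dvd_trans is_unit_power_iff power_one dvd_power_same)
qed

lemma body_unit:
  fixes x :: "('v::linorder, 'k::field) geven"
  shows "x dvd 1 \<longleftrightarrow> body x \<noteq> 0"
  using geven_unit by (auto elim!: dvdE simp: of_even_inject[symmetric] dest!: arg_cong[where f = "\<lambda>f. gcoeff f {}"])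

section \<open>Evaluation of polynomials in a commutative ring\<close>

definition monom_eval :: "('x \<Rightarrow> 'r) \<Rightarrow> ('x \<Rightarrow>\<^sub>0 nat) \<Rightarrow> 'r::comm_ring_1" where
  "monom_eval w k = (\<Prod>v\<in>Poly_Mapping.keys k. w v ^ Poly_Mapping.lookup k v)"

definition peval ::
  "('a::zero \<Rightarrow> 'r) \<Rightarrow> ('x \<Rightarrow> 'r) \<Rightarrow> (('x \<Rightarrow>\<^sub>0 nat) \<Rightarrow>\<^sub>0 'a) \<Rightarrow> 'r::comm_ring_1" where
  "peval c w p = (\<Sum>k\<in>Poly_Mapping.keys p. c (Poly_Mapping.lookup p k) * monom_eval w k)"

lemma monom_eval_superset:
  assumes "finite V" "Poly_Mapping.keys k \<subseteq> V"
  shows "monom_eval w k = (\<Prod>v\<in>V. w v ^ Poly_Mapping.lookup k v)"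
  unfolding monom_eval_def
  by (rule prod.mono_neutral_left) (use assms in \<open>auto simp: in_keys_iff\<close>)

lemma monom_eval_add: "monom_eval w (k + l) = monom_eval w k * monom_eval w l"
proof -
  let ?V = "Poly_Mapping.keys k \<union> Poly_Mapping.keys l"
  have "Poly_Mapping.keys (k + l) \<subseteq> ?V" by (rule keys_add)
  then show ?thesis
    by (simp add: monom_eval_superset[of ?V] lookup_add power_add prod.distrib)
qed

lemma monom_eval_0 [simp]: "monom_eval w 0 = 1"
  by (simp add: monom_eval_def)

lemma monom_eval_single [simp]: "monom_eval w (Poly_Mapping.single v 1) = w v"
  by (simp add: monom_eval_def)

lemma poly_mapping_sum_singles:
  fixes p :: "'a \<Rightarrow>\<^sub>0 'b::comm_monoid_add"
  shows "p = (\<Sum>k\<in>Poly_Mapping.keys p. Poly_Mapping.single k (Poly_Mapping.lookup p k))"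
  by (rule poly_mapping_eqI)
     (auto simp: lookup_sum lookup_single when_def in_keys_iff sum.delta if_distrib cong: if_cong)

context
  fixes c :: "'a::comm_ring_1 \<Rightarrow> 'r::comm_ring_1"
  assumes c: "comm_ring_hom c"
begin

interpretation comm_ring_hom c by (rule c)

lemma peval_superset:
  assumes "finite K" "Poly_Mapping.keys p \<subseteq> K"
  shows "peval c w p = (\<Sum>k\<in>K. c (Poly_Mapping.lookup p k) * monom_eval w k)"
  unfolding peval_def
  by (rule sum.mono_neutral_left) (use assms in \<open>auto simp: in_keys_iff\<close>)

lemma peval_add: "peval c w (p + q) = peval c w p + peval c w q"
proof -
  let ?K = "Poly_Mapping.keys p \<union> Poly_Mapping.keys q"
  have "Poly_Mapping.keys (p + q) \<subseteq> ?K" by (rule keys_add)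
  then show ?thesis
    by (simp add: peval_superset[of ?K] lookup_add hom_add algebra_simps sum.distrib)
qed

lemma peval_0 [simp]: "peval c w 0 = 0"
  by (simp add: peval_def)

lemma peval_sum: "peval c w (sum p A) = (\<Sum>a\<in>A. peval c w (p a))"
  by (induction A rule: infinite_finite_induct) (auto simp: peval_add)

lemma peval_single [simp]: "peval c w (Poly_Mapping.single k a) = c a * monom_eval w k"
  by (cases "a = 0") (auto simp: peval_def)

lemma peval_mult: "peval c w (p * q) = peval c w p * peval c w q"
proof -
  let ?s = "\<lambda>p k. Poly_Mapping.single k (Poly_Mapping.lookup p k)"
  have "p * q = (\<Sum>k\<in>Poly_Mapping.keys p. ?s p k) * (\<Sum>l\<in>Poly_Mapping.keys q. ?s q l)"
    using poly_mapping_sum_singles[of p] poly_mapping_sum_singles[of q] by simp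
  also have "\<dots> = (\<Sum>k\<in>Poly_Mapping.keys p. \<Sum>l\<in>Poly_Mapping.keys q.
      Poly_Mapping.single (k + l) (Poly_Mapping.lookup p k * Poly_Mapping.lookup q l))"
    by (simp add: sum_product mult_single)
  also have "peval c w \<dots> = peval c w p * peval c w q"
    by (simp add: peval_sum hom_mult monom_eval_add) (simp add: peval_def sum_product algebra_simps)
  finally show ?thesis .
qed

lemma peval_hom: "comm_ring_hom (peval c w)"
proof
  show "peval c w 1 = 1" by (simp flip: single_one)
qed (auto simp: peval_add peval_mult)

end

section \<open>Values of fractions whose denominators become units\<close>

definition fdom :: "('p::idom \<Rightarrow> 'r::comm_ring_1) \<Rightarrow> 'p fract set" where
  "fdom e = {Fract p q | p q. e q dvd 1}"

text \<open>The target may have zero divisors and has no division, so the value is described by the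
  equation \<open>y * e q = e p\<close>. A unit \<open>e q\<close> can be cancelled, which makes y
  independent of the representation of the fraction.\<close>

definition feval :: "('p::idom \<Rightarrow> 'r::comm_ring_1) \<Rightarrow> 'p fract \<Rightarrow> 'r" where
  "feval e x = (THE y. \<exists>p q. x = Fract p q \<and> e q dvd 1 \<and> y * e q = e p)"

lemma unit_mult_cancel: "(u :: 'r::comm_ring_1) dvd 1 \<Longrightarrow> x * u = y * u \<Longrightarrow> x = y"
  by (elim dvdE) (metis mult.assoc mult.right_neutral)

context
  fixes e :: "'p::idom \<Rightarrow> 'r::comm_ring_1"
  assumes e: "comm_ring_hom e"
begin

interpretation comm_ring_hom e by (rule e)

lemma unit_imp_nonzero: "e q dvd 1 \<Longrightarrow> q \<noteq> 0"
  by auto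

lemma feval_eqI:
  assumes "e q dvd 1" "y * e q = e p"
  shows "feval e (Fract p q) = y"
  unfolding feval_def
proof (rule the_equality)
  fix y' assume "\<exists>p' q'. Fract p q = Fract p' q' \<and> e q' dvd 1 \<and> y' * e q' = e p'"
  then obtain p' q' where *: "Fract p q = Fract p' q'" "e q' dvd 1" "y' * e q' = e p'" by blast
  then have "p * q' = p' * q" using assms(1) unit_imp_nonzero by (simp add: eq_fract)
  then have "e p * e q' = e p' * e q" by (metis hom_mult)
  then have "(y' * e q') * e q = (y * e q') * e q"
    using assms(2) *(3) by (simp add: mult_ac) (metis mult.assoc mult.commute)
  then show "y' = y" using assms(1) *(2) unit_mult_cancel by metis
qed (use assms in blast)

lemma feval_ex:
  assumes "x \<in> fdom e"
  obtains p q where "x = Fract p q" "e q dvd 1" "q \<noteq> 0" "feval e x * e q = e p"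
proof -
  obtain p q where x: "x = Fract p q" "e q dvd 1" using assms by (auto simp: fdom_def)
  then obtain u where "1 = e q * u" by (elim dvdE)
  then have "(e p * u) * e q = e p" by (metis mult.assoc mult.commute mult.right_neutral)
  then show thesis using that x feval_eqI[OF x(2)] unit_imp_nonzero by metis
qed

lemma fdom_add: "x \<in> fdom e \<Longrightarrow> y \<in> fdom e \<Longrightarrow> x + y \<in> fdom e \<and> feval e (x + y) = feval e x + feval e y"
proof -
  assume "x \<in> fdom e" "y \<in> fdom e"
  then obtain p q p' q' where
    x: "x = Fract p q" "e q dvd 1" "q \<noteq> 0" "feval e x * e q = e p" and
    y: "y = Fract p' q'" "e q' dvd 1" "q' \<noteq> 0" "feval e y * e q' = e p'"
    using feval_ex by metis
  have xy: "x + y = Fract (p * q' + p' * q) (q * q')" using x y by simp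
  have u: "e (q * q') dvd 1" using x(2) y(2) by (simp add: hom_mult)
  have "feval e (x + y) = feval e x + feval e y"
    unfolding xy by (rule feval_eqI[OF u]) (simp add: hom_mult hom_add flip: x(4) y(4), simp add: algebra_simps)
  then show ?thesis using xy u by (auto simp: fdom_def)
qed

lemma fdom_mult: "x \<in> fdom e \<Longrightarrow> y \<in> fdom e \<Longrightarrow> x * y \<in> fdom e \<and> feval e (x * y) = feval e x * feval e y"
proof -
  assume "x \<in> fdom e" "y \<in> fdom e"
  then obtain p q p' q' where
    x: "x = Fract p q" "e q dvd 1" "q \<noteq> 0" "feval e x * e q = e p" and
    y: "y = Fract p' q'" "e q' dvd 1" "q' \<noteq> 0" "feval e y * e q' = e p'"
    using feval_ex by metis
  have xy: "x * y = Fract (p * p') (q * q')" using x y by simp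
  have u: "e (q * q') dvd 1" using x(2) y(2) by (simp add: hom_mult)
  have "feval e (x * y) = feval e x * feval e y"
    unfolding xy by (rule feval_eqI[OF u]) (simp add: hom_mult x(4)[symmetric] y(4)[symmetric] mult_ac)
  then show ?thesis using xy u by (auto simp: fdom_def)
qed

lemma fdom_poly [simp]: "Fract p 1 \<in> fdom e"
  and feval_poly [simp]: "feval e (Fract p 1) = e p"
  by (force simp: fdom_def) (rule feval_eqI, auto)

lemma fdom_inverse:
  assumes "x \<in> fdom e" "feval e x dvd 1"
  shows "inverse x \<in> fdom e \<and> feval e (inverse x) * feval e x = 1"
proof -
  obtain p q where x: "x = Fract p q" "e q dvd 1" "q \<noteq> 0" "feval e x * e q = e p"
    using assms feval_ex by metis
  have u: "e p dvd 1" using assms(2) x(2) by (simp flip: x(4))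
  have inv: "inverse x \<in> fdom e" using u by (auto simp: fdom_def x(1))
  have "x * inverse x = 1" using u x unit_imp_nonzero by (simp add: One_fract_def eq_fract)
  then have "feval e x * feval e (inverse x) = feval e (Fract 1 1)"
    using fdom_mult[OF assms(1) inv] by (simp add: One_fract_def)
  then show ?thesis using inv by (simp add: mult.commute)
qed

end

section \<open>Ordered products of odd elements\<close>

definition oprod :: "('v::linorder \<Rightarrow> 'r) \<Rightarrow> 'v set \<Rightarrow> 'r::monoid_mult" where
  "oprod t S = prod_list (map t (sorted_list_of_set S))"

lemma oprod_empty [simp]: "oprod t {} = 1"
  by (simp add: oprod_def)

lemma oprod_insert_less:
  assumes "finite A" "\<And>a. a \<in> A \<Longrightarrow> b < a"
  shows "oprod t (insert b A) = t b * oprod t A"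
proof -
  have "sorted_list_of_set (insert b A) = insort b (sorted_list_of_set A)"
    using assms by (intro sorted_list_of_set.sorted_key_list_of_set_insert) auto
  also have "\<dots> = b # sorted_list_of_set A"
    using assms by (intro insort_is_Cons) (auto intro: less_imp_le)
  finally show ?thesis by (simp add: oprod_def)
qed

lemma shuffle_sign_below:
  assumes "\<And>a. a \<in> A \<Longrightarrow> b < a"
  shows "shuffle_sign {b} A = 1"
proof -
  have "{(x, a). x \<in> {b} \<and> a \<in> A \<and> a < x} = {}" using assms by (auto dest: less_asym)
  then show ?thesis by (simp only: shuffle_sign_def card.empty power_0)
qed

lemma shuffle_sign_above: "b < v \<Longrightarrow> shuffle_sign {v} {b} = - 1"
proof -
  assume "b < v"
  then have "{(x, a). x \<in> {v} \<and> a \<in> {b} \<and> a < x} = {(v, b)}" by auto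
  then show ?thesis by (simp add: shuffle_sign_def)
qed

text \<open>A factor is put in front and sorted into place. The induction adds a new minimum b, so
  that the ordered product starts with \<open>t b\<close>; if b < v, moving \<open>t v\<close> past
  \<open>t b\<close> costs exactly the sign that the inversion (v, b) contributes to
  \<open>shuffle_sign\<close>.\<close>

lemma oprod_mult_single:
  fixes t :: "'v::linorder \<Rightarrow> ('w::linorder, 'k::{comm_ring_1, ring_char_0, semiring_no_zero_divisors}) grassmann"
  assumes odd: "\<And>v. ghom True (t v)" and "finite T"
  shows "t v * oprod t T =
    (if v \<in> T then 0 else gscalar (shuffle_sign {v} T) * oprod t (insert v T))"
  using \<open>finite T\<close>
proof (induction T rule: finite_linorder_min_induct)
  case empty
  show ?case using oprod_insert_less[of "{}" v t] by (simp add: gscalar_1)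
next
  case (insert b A)
  have ins: "oprod t (insert b A) = t b * oprod t A"
    by (rule oprod_insert_less) (use insert in auto)
  consider "v < b" | "v = b" | "b < v" by fastforce
  then show ?case
  proof cases
    case 1
    then have "v < a" if "a \<in> insert b A" for a using that insert by (auto dest: less_trans)
    then have "oprod t (insert v (insert b A)) = t v * oprod t (insert b A)" "v \<notin> insert b A"
        "shuffle_sign {v} (insert b A) = (1 :: 'k)"
      using insert(1) by (blast intro: oprod_insert_less shuffle_sign_below)+
    then show ?thesis by (simp only: if_False gscalar_1 mult_1)
  next
    case 2
    have "t v * (t b * oprod t A) = (t b * t b) * oprod t A" by (simp add: 2 mult.assoc)
    then show ?thesis using odd_square_zero[OF odd, of b] by (simp add: ins 2)
  next
    case 3
    have "t v * t b = - (t b * t v)"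
      using supercommute[OF odd[of v], of "t b"] by (simp add: ginv_ghom[OF odd])
    then have "t v * oprod t (insert b A) = - (t b * (t v * oprod t A))"
      unfolding ins by (simp add: mult.assoc[symmetric])
    also have "\<dots> = (if v \<in> A then 0 else - (gscalar (shuffle_sign {v} A) * (t b * oprod t (insert v A))))"
      unfolding insert(3)
      by (simp add: mult.assoc[symmetric] gscalar_commute[symmetric])
    also have "\<dots> = (if v \<in> A then 0 else - (gscalar (shuffle_sign {v} A) * oprod t (insert b (insert v A))))"
      using insert 3 by (subst oprod_insert_less) auto
    finally have eq: "t v * oprod t (insert b A) = \<dots>" .
    have "shuffle_sign {v} ({b} \<union> A) = (shuffle_sign {v} {b} * shuffle_sign {v} A :: 'k)"
      by (rule shuffle_sign_Un_right) (use insert in auto)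
    then have "shuffle_sign {v} (insert b A) = (- shuffle_sign {v} A :: 'k)"
      using 3 by (simp add: shuffle_sign_above)
    then show ?thesis using 3 unfolding eq by (auto simp: insert_commute gscalar_minus)
  qed
qed

text \<open>The elements \<open>t v\<close> satisfy the relations of the odd generators, so their
  ordered products multiply with the structure constants of the Grassmann algebra. This is what
  makes \<open>geval\<close> multiplicative.\<close>

lemma oprod_mult:
  fixes t :: "'v::linorder \<Rightarrow> ('w::linorder, 'k::{comm_ring_1, ring_char_0, semiring_no_zero_divisors}) grassmann"
  assumes odd: "\<And>v. ghom True (t v)" and "finite S" and T: "finite T"
  shows "oprod t S * oprod t T =
    (if S \<inter> T = {} then gscalar (shuffle_sign S T) * oprod t (S \<union> T) else 0)"
  using \<open>finite S\<close>
proof (induction S rule: finite_linorder_min_induct)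
  case empty
  show ?case by (simp add: gscalar_1)
next
  case (insert b A)
  have b: "b \<notin> A" using insert by auto
  have ins: "oprod t (insert b A) = t b * oprod t A"
    by (rule oprod_insert_less) (use insert in auto)
  have "oprod t (insert b A) * oprod t T =
      (if A \<inter> T = {} then gscalar (shuffle_sign A T) * (t b * oprod t (A \<union> T)) else 0)"
    unfolding ins mult.assoc insert(3)
    by (simp add: mult.assoc[symmetric] gscalar_commute[symmetric])
  also have "\<dots> = (if insert b A \<inter> T = {}
      then gscalar (shuffle_sign A T * shuffle_sign {b} (A \<union> T)) * oprod t (insert b A \<union> T) else 0)"
    using insert(1) T b by (auto simp: oprod_mult_single[of t, OF odd] gscalar_mult mult.assoc)
  also have "\<dots> = (if insert b A \<inter> T = {}
      then gscalar (shuffle_sign (insert b A) T) * oprod t (insert b A \<union> T) else 0)"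
  proof (rule if_cong[OF refl _ refl])
    assume disj: "insert b A \<inter> T = {}"
    have "shuffle_sign {b} (A \<union> T) = (shuffle_sign {b} A * shuffle_sign {b} T :: 'k)"
      by (rule shuffle_sign_Un_right) (use insert T disj in auto)
    moreover have "shuffle_sign ({b} \<union> A) T = (shuffle_sign {b} T * shuffle_sign A T :: 'k)"
      by (rule shuffle_sign_Un_left) (use insert T b in auto)
    moreover have "shuffle_sign {b} A = (1 :: 'k)" by (rule shuffle_sign_below) (use insert in auto)
    ultimately show "gscalar (shuffle_sign A T * shuffle_sign {b} (A \<union> T)) * oprod t (insert b A \<union> T) =
        gscalar (shuffle_sign (insert b A) T) * oprod t (insert b A \<union> T)"
      by (simp add: mult.commute)
  qed
  finally show ?case .
qed

text \<open>The homomorphism that is \<open>e\<close> on even polynomials and \<open>t\<close> on odd generators. It is defined on the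
  elements with coefficients whose denominators are mapped to units by \<open>e\<close>.\<close>

definition geval ::
  "('p::idom \<Rightarrow> ('w::linorder, 'l::comm_ring_1) geven) \<Rightarrow> ('v::linorder \<Rightarrow> ('w, 'l) grassmann) \<Rightarrow>
    ('v, 'p fract) grassmann \<Rightarrow> ('w, 'l) grassmann" where
  "geval e t f = (\<Sum>S | gcoeff f S \<noteq> 0. of_even (feval e (gcoeff f S)) * oprod t S)"

definition gdom ::
  "('p::idom \<Rightarrow> ('w::linorder, 'l::comm_ring_1) geven) \<Rightarrow> ('v::linorder, 'p fract) grassmann set" where
  "gdom e = {f. \<forall>S. gcoeff f S \<in> fdom e}"

lemma even_left_commute: "ghom False f \<Longrightarrow> x * (f * y) = f * (x * y)"
  by (simp only: mult.assoc[symmetric] even_commute[of f x])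

lemma shuffle_sign_cases: "shuffle_sign S T = (1 :: 'k::comm_ring_1) \<or> shuffle_sign S T = (- 1 :: 'k)"
  by (cases "even (card {(a, b). a \<in> S \<and> b \<in> T \<and> b < a})") (auto simp: shuffle_sign_def)

lemma of_even_shuffle_sign: "of_even (shuffle_sign S T) = gscalar (shuffle_sign S T)"
  by (cases "even (card {(a, b). a \<in> S \<and> b \<in> T \<and> b < a})")
     (auto simp: shuffle_sign_def gscalar_minus gscalar_1)

context
  fixes e :: "'p::idom \<Rightarrow> ('w::linorder, 'l::{comm_ring_1, ring_char_0, semiring_no_zero_divisors}) geven"
    and t :: "'v::linorder \<Rightarrow> ('w, 'l) grassmann"
  assumes e: "comm_ring_hom e" and odd: "\<And>v. ghom True (t v)"
begin

interpretation comm_ring_hom e by (rule e)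

lemma feval_0 [simp]: "feval e 0 = 0" and fdom_0 [simp]: "0 \<in> fdom e"
  using feval_poly[OF e, of 0] fdom_poly[OF e, of 0] by (simp_all add: Zero_fract_def)

lemma feval_1 [simp]: "feval e 1 = 1" and fdom_1 [simp]: "1 \<in> fdom e"
  using feval_poly[OF e, of 1] fdom_poly[OF e, of 1] by (simp_all add: One_fract_def)

lemma feval_minus_1 [simp]: "feval e (- 1) = - 1" and fdom_minus_1 [simp]: "- 1 \<in> fdom e"
  using feval_poly[OF e, of "- 1"] fdom_poly[OF e, of "- 1"]
  by (simp_all add: One_fract_def hom_uminus)

lemma fdom_sum:
  "(\<And>a. a \<in> A \<Longrightarrow> f a \<in> fdom e) \<Longrightarrow>
    sum f A \<in> fdom e \<and> feval e (sum f A) = (\<Sum>a\<in>A. feval e (f a))"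
  by (induction A rule: infinite_finite_induct) (auto simp: fdom_add[OF e])

lemma fdom_prod:
  "(\<And>a. a \<in> A \<Longrightarrow> f a \<in> fdom e) \<Longrightarrow>
    prod f A \<in> fdom e \<and> feval e (prod f A) = (\<Prod>a\<in>A. feval e (f a))"
  by (induction A rule: infinite_finite_induct) (auto simp: fdom_mult[OF e])

lemma fdom_shuffle_sign: "shuffle_sign S T \<in> fdom e \<and> feval e (shuffle_sign S T) = shuffle_sign S T"
  by (cases "even (card {(a, b). a \<in> S \<and> b \<in> T \<and> b < a})") (auto simp: shuffle_sign_def)

lemma geval_superset:
  assumes "finite A" "{S. gcoeff f S \<noteq> 0} \<subseteq> A"
  shows "geval e t f = (\<Sum>S\<in>A. of_even (feval e (gcoeff f S)) * oprod t S)"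
  unfolding geval_def by (rule sum.mono_neutral_left) (use assms in auto)

lemma gdom_add: "f \<in> gdom e \<Longrightarrow> g \<in> gdom e \<Longrightarrow> f + g \<in> gdom e"
  by (auto simp: gdom_def fdom_add[OF e])

lemma gdom_mult: "f \<in> gdom e \<Longrightarrow> g \<in> gdom e \<Longrightarrow> f * g \<in> gdom e"
  unfolding gdom_def mem_Collect_eq gcoeff_mult
  by (auto intro!: fdom_sum[THEN conjunct1] fdom_mult[OF e, THEN conjunct1]
      fdom_shuffle_sign[THEN conjunct1])

lemma geval_add:
  assumes "f \<in> gdom e" "g \<in> gdom e"
  shows "geval e t (f + g) = geval e t f + geval e t g"
proof -
  let ?A = "{S. gcoeff f S \<noteq> 0} \<union> {S. gcoeff g S \<noteq> 0}"
  have fin: "finite ?A" by (simp add: finite_gsupp)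
  have "geval e t (f + g) = (\<Sum>S\<in>?A. of_even (feval e (gcoeff (f + g) S)) * oprod t S)"
    by (rule geval_superset[OF fin]) auto
  moreover have "feval e (gcoeff (f + g) S) = feval e (gcoeff f S) + feval e (gcoeff g S)" for S
    using assms fdom_add[OF e] by (auto simp: gdom_def)
  ultimately show ?thesis
    using geval_superset[OF fin, of f] geval_superset[OF fin, of g]
    by (simp add: distrib_right sum.distrib)
qed

lemma geval_mult:
  assumes f: "f \<in> gdom e" and g: "g \<in> gdom e"
  shows "geval e t (f * g) = geval e t f * geval e t g"
proof -
  define V where "V = \<Union> {S. gcoeff f S \<noteq> 0} \<union> \<Union> {S. gcoeff g S \<noteq> 0}"
  have V: "finite V" unfolding V_def using finite_gsupp gcoeff_finite by blast
  then have finP: "finite (Pow V)" by simp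
  have sf: "{S. gcoeff f S \<noteq> 0} \<subseteq> Pow V" and sg: "{S. gcoeff g S \<noteq> 0} \<subseteq> Pow V"
    unfolding V_def by auto
  have sfg: "{S. gcoeff (f * g) S \<noteq> 0} \<subseteq> Pow V"
  proof
    fix U assume "U \<in> {S. gcoeff (f * g) S \<noteq> 0}"
    then obtain S where "S \<subseteq> U" "gcoeff f S \<noteq> 0" "gcoeff g (U - S) \<noteq> 0"
      using gcoeff_mult_nonzero[of f g U] by blast
    then show "U \<in> Pow V" using sf sg by blast
  qed
  let ?F = "\<lambda>S. of_even (feval e (gcoeff f S))" and ?G = "\<lambda>S. of_even (feval e (gcoeff g S))"
  let ?s = "\<lambda>S T. gscalar (shuffle_sign S T) :: ('w, 'l) grassmann"
  have summand: "shuffle_sign S T * gcoeff f S * gcoeff g T \<in> fdom e \<and>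
      feval e (shuffle_sign S T * gcoeff f S * gcoeff g T) =
        shuffle_sign S T * feval e (gcoeff f S) * feval e (gcoeff g T)" for S T
    using f g fdom_shuffle_sign[of S T] by (simp add: gdom_def fdom_mult[OF e])
  have coeff: "of_even (feval e (gcoeff (f * g) U)) = (\<Sum>S\<in>Pow U. ?s S (U - S) * ?F S * ?G (U - S))" for U
    unfolding gcoeff_mult
    by (subst fdom_sum[THEN conjunct2]) (simp_all add: summand of_even_shuffle_sign)
  have "geval e t (f * g) = (\<Sum>U\<in>Pow V. \<Sum>S\<in>Pow U. ?s S (U - S) * ?F S * ?G (U - S) * oprod t U)"
    by (simp add: geval_superset[OF finP sfg] coeff sum_distrib_right)
  also have "\<dots> = (\<Sum>(U, S)\<in>Sigma (Pow V) Pow. ?s S (U - S) * ?F S * ?G (U - S) * oprod t U)"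
    by (rule sum.Sigma) (use V finite_subset in auto)
  \<comment> \<open>A subset S of U is the same as a disjoint pair (S, U - S) with union U.\<close>
  also have "\<dots> = (\<Sum>(S, T)\<in>{(S, T). (S, T) \<in> Pow V \<times> Pow V \<and> S \<inter> T = {}}.
      ?s S T * ?F S * ?G T * oprod t (S \<union> T))"
    by (rule sum.reindex_bij_witness
          [where i = "\<lambda>(S, T). (S \<union> T, S)" and j = "\<lambda>(U, S). (S, U - S)"])
       (auto simp: Un_absorb1)
  \<comment> \<open>Pairs with a common element may be added, since their terms vanish by
    \<open>oprod_mult\<close>.\<close>
  also have "\<dots> = (\<Sum>(S, T)\<in>Pow V \<times> Pow V. ?F S * oprod t S * (?G T * oprod t T))"
  proof (rule sum.mono_neutral_cong_left)
    show "finite (Pow V \<times> Pow V)" using V by simp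
    have *: "?F S * oprod t S * (?G T * oprod t T) =
        (if S \<inter> T = {} then ?s S T * ?F S * ?G T * oprod t (S \<union> T) else 0)"
      if "S \<in> Pow V" "T \<in> Pow V" for S T
    proof -
      have fin: "finite S" "finite T" using that V finite_subset by auto
      have "?F S * oprod t S * (?G T * oprod t T) = ?F S * ?G T * (oprod t S * oprod t T)"
        by (simp only: mult.assoc even_left_commute[OF ghom_of_even, of "oprod t S"])
      moreover have "?F S * ?G T * (?s S T * oprod t (S \<union> T)) = ?s S T * ?F S * ?G T * oprod t (S \<union> T)"
        by (simp only: mult.assoc even_left_commute[OF ghom_gscalar, of "?F S"]
            even_left_commute[OF ghom_gscalar, of "?G T"])
      ultimately show ?thesis unfolding oprod_mult[of t, OF odd fin] by (simp split: if_splits)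
    qed
    show "\<forall>x\<in>Pow V \<times> Pow V - {(S, T). (S, T) \<in> Pow V \<times> Pow V \<and> S \<inter> T = {}}.
        (case x of (S, T) \<Rightarrow> ?F S * oprod t S * (?G T * oprod t T)) = 0"
    proof
      fix x assume x: "x \<in> Pow V \<times> Pow V - {(S, T). (S, T) \<in> Pow V \<times> Pow V \<and> S \<inter> T = {}}"
      then obtain S T where ST: "x = (S, T)" "S \<in> Pow V" "T \<in> Pow V" "S \<inter> T \<noteq> {}" by auto
      then show "(case x of (S, T) \<Rightarrow> ?F S * oprod t S * (?G T * oprod t T)) = 0"
        using *[of S T] by simp
    qed
    show "(case x of (S, T) \<Rightarrow> ?s S T * ?F S * ?G T * oprod t (S \<union> T)) =
        (case x of (S, T) \<Rightarrow> ?F S * oprod t S * (?G T * oprod t T))"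
      if "x \<in> {(S, T). (S, T) \<in> Pow V \<times> Pow V \<and> S \<inter> T = {}}" for x
      using that * by auto
  qed auto
  also have "\<dots> = (\<Sum>S\<in>Pow V. \<Sum>T\<in>Pow V. ?F S * oprod t S * (?G T * oprod t T))"
    by (rule sum.cartesian_product[symmetric])
  also have "\<dots> = geval e t f * geval e t g"
    by (simp add: geval_superset[OF finP sf] geval_superset[OF finP sg] sum_product)
  finally show ?thesis .
qed

lemma gdom_gscalar: "x \<in> fdom e \<Longrightarrow> gscalar x \<in> gdom e"
  by (simp add: gdom_def)

lemma geval_gscalar: "geval e t (gscalar x) = of_even (feval e x)"
  by (subst geval_superset[of "{{}}"]) (auto split: if_splits)

lemma gdom_ggen: "ggen v \<in> gdom e"
  by (simp add: gdom_def)

lemma geval_ggen: "geval e t (ggen v) = t v"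
proof -
  have "oprod t {v} = t v" using oprod_insert_less[of "{}" v t] by simp
  then show ?thesis by (subst geval_superset[of "{{v}}"]) (auto split: if_splits)
qed

end

text \<open>Makes \<open>odd_square_zero\<close> applicable over the field of rational
  functions.\<close>

instance fract :: ("{idom, ring_char_0}") ring_char_0
proof
  show "inj (of_nat :: nat \<Rightarrow> 'a fract)"
    by (rule injI) (simp add: of_nat_fract eq_fract)
qed

section \<open>Substitution for the entries of generic matrices\<close>

definition even_var :: "nat \<Rightarrow> var \<Rightarrow> bool" where
  "even_var m = (\<lambda>(t, i, j). (i \<le> m) = (j \<le> m))"

text \<open>The polynomial ring has a commuting variable for every index triple. Those at odd
  positions do not occur in \<open>mat_alg\<close>; the value 0 keeps the image in the even part. In
  the same way \<open>odd_subst\<close> sends the odd generators at even positions to 0.\<close>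

definition poly_subst :: "nat \<Rightarrow> (var \<Rightarrow> 'a::field sfun) \<Rightarrow>
    ((var \<Rightarrow>\<^sub>0 nat) \<Rightarrow>\<^sub>0 'a) \<Rightarrow> (var, 'a rat_fun) geven" where
  "poly_subst m \<sigma> =
    peval (\<lambda>a. Abs_even (sconst a)) (\<lambda>v. if even_var m v then Abs_even (\<sigma> v) else 0)"

definition odd_subst :: "nat \<Rightarrow> (var \<Rightarrow> 'a::field sfun) \<Rightarrow> var \<Rightarrow> 'a sfun" where
  "odd_subst m \<sigma> v = (if even_var m v then 0 else \<sigma> v)"

definition ssubst :: "nat \<Rightarrow> (var \<Rightarrow> 'a::field sfun) \<Rightarrow> 'a sfun \<Rightarrow> 'a sfun" where
  "ssubst m \<sigma> = geval (poly_subst m \<sigma>) (odd_subst m \<sigma>)"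

abbreviation sdom :: "nat \<Rightarrow> (var \<Rightarrow> 'a::field sfun) \<Rightarrow> 'a sfun set" where
  "sdom m \<sigma> \<equiv> gdom (poly_subst m \<sigma>)"

definition parity_subst :: "nat \<Rightarrow> (var \<Rightarrow> 'a::field sfun) \<Rightarrow> bool" where
  "parity_subst m \<sigma> \<longleftrightarrow> (\<forall>v. ghom (\<not> even_var m v) (\<sigma> v))"

lemma ghom_sconst [simp]: "ghom False (sconst a)"
  by (simp add: sconst_def)

lemma sconst_0 [simp]: "sconst 0 = 0"
  by (simp add: sconst_def rat_const_def Zero_fract_def[symmetric])

lemma sconst_hom: "comm_ring_hom (\<lambda>a. Abs_even (sconst a))"
proof
  fix a b :: 'a
  show "Abs_even (sconst (a + b)) = Abs_even (sconst a) + (Abs_even (sconst b) :: (var, 'a rat_fun) geven)"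
    and "Abs_even (sconst (a * b)) = Abs_even (sconst a) * (Abs_even (sconst b) :: (var, 'a rat_fun) geven)"
    by (simp_all add: of_even_inject[symmetric] of_even_Abs sconst_add sconst_mult ghom_add ghom_mult_even)
qed (simp_all add: of_even_inject[symmetric] of_even_Abs sconst_1)

lemma poly_subst_hom: "comm_ring_hom (poly_subst m \<sigma>)"
  unfolding poly_subst_def by (rule peval_hom[OF sconst_hom])

lemma entry_alt: "entry m t i j =
    (if even_var m (t, i, j) then gscalar (rat_var (t, i, j)) else ggen (t, i, j))"
  by (simp add: entry_def even_var_def)

lemma ghom_entry: "ghom (\<not> even_var m (t, i, j)) (entry m t i j)"
  by (simp add: entry_alt)

context
  fixes m :: nat and \<sigma> :: "var \<Rightarrow> 'a::field_char_0 sfun"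
  assumes parity: "parity_subst m \<sigma>"
begin

lemma ghom_odd_subst: "ghom True (odd_subst m \<sigma> v)"
proof (cases "even_var m v")
  case False
  then show ?thesis using spec[OF parity[unfolded parity_subst_def], of v] by (simp add: odd_subst_def)
qed (simp add: odd_subst_def)

lemma ssubst_add: "f \<in> sdom m \<sigma> \<Longrightarrow> g \<in> sdom m \<sigma> \<Longrightarrow> ssubst m \<sigma> (f + g) = ssubst m \<sigma> f + ssubst m \<sigma> g"
  unfolding ssubst_def by (rule geval_add[where t = "odd_subst m \<sigma>", OF poly_subst_hom ghom_odd_subst])

lemma ssubst_mult: "f \<in> sdom m \<sigma> \<Longrightarrow> g \<in> sdom m \<sigma> \<Longrightarrow> ssubst m \<sigma> (f * g) = ssubst m \<sigma> f * ssubst m \<sigma> g"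
  unfolding ssubst_def by (rule geval_mult[where t = "odd_subst m \<sigma>", OF poly_subst_hom ghom_odd_subst])

lemma sdom_add: "f \<in> sdom m \<sigma> \<Longrightarrow> g \<in> sdom m \<sigma> \<Longrightarrow> f + g \<in> sdom m \<sigma>"
  by (rule gdom_add[where t = "odd_subst m \<sigma>", OF poly_subst_hom ghom_odd_subst])

lemma sdom_mult: "f \<in> sdom m \<sigma> \<Longrightarrow> g \<in> sdom m \<sigma> \<Longrightarrow> f * g \<in> sdom m \<sigma>"
  by (rule gdom_mult[where t = "odd_subst m \<sigma>", OF poly_subst_hom ghom_odd_subst])

lemma ssubst_gscalar: "ssubst m \<sigma> (gscalar x) = of_even (feval (poly_subst m \<sigma>) x)"
  unfolding ssubst_def by (rule geval_gscalar[where t = "odd_subst m \<sigma>", OF poly_subst_hom ghom_odd_subst])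

lemma sdom_gscalar: "x \<in> fdom (poly_subst m \<sigma>) \<Longrightarrow> gscalar x \<in> sdom m \<sigma>"
  by (rule gdom_gscalar[where t = "odd_subst m \<sigma>", OF poly_subst_hom ghom_odd_subst])

lemma sdom_const: "sconst a \<in> sdom m \<sigma>"
  unfolding sconst_def rat_const_def
  by (rule sdom_gscalar) (rule fdom_poly[OF poly_subst_hom])

lemma ssubst_const: "ssubst m \<sigma> (sconst a) = sconst a"
proof -
  have "ssubst m \<sigma> (sconst a) = of_even (poly_subst m \<sigma> (Poly_Mapping.single 0 a))"
    unfolding sconst_def rat_const_def ssubst_gscalar feval_poly[OF poly_subst_hom] ..
  also have "\<dots> = sconst a"
    by (simp add: poly_subst_def peval_single[OF sconst_hom] of_even_Abs)
  finally show ?thesis .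
qed

lemma feval_rat_var:
  "even_var m v \<Longrightarrow> rat_var v \<in> fdom (poly_subst m \<sigma>) \<and> of_even (feval (poly_subst m \<sigma>) (rat_var v)) = \<sigma> v"
proof -
  assume v: "even_var m v"
  then have "ghom False (\<sigma> v)" using parity by (metis parity_subst_def)
  moreover have "monom_eval w (Poly_Mapping.single v (Suc 0)) = w v" for w :: "var \<Rightarrow> (var, 'a rat_fun) geven"
    using monom_eval_single[of w v] by simp
  ultimately show ?thesis
    unfolding rat_var_def using v
    by (simp add: fdom_poly[OF poly_subst_hom] feval_poly[OF poly_subst_hom])
       (simp add: poly_subst_def peval_single[OF sconst_hom] of_even_Abs sconst_1)
qed

lemma sdom_entry: "entry m t i j \<in> sdom m \<sigma>"
proof (cases "even_var m (t, i, j)")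
  case True
  then show ?thesis by (simp add: entry_alt sdom_gscalar feval_rat_var)
next
  case False
  have "ggen (t, i, j) \<in> sdom m \<sigma>"
    by (rule gdom_ggen[where t = "odd_subst m \<sigma>", OF poly_subst_hom ghom_odd_subst])
  with False show ?thesis by (simp add: entry_alt)
qed

lemma ssubst_entry: "ssubst m \<sigma> (entry m t i j) = \<sigma> (t, i, j)"
proof (cases "even_var m (t, i, j)")
  case True
  then show ?thesis by (simp add: entry_alt ssubst_gscalar feval_rat_var)
next
  case False
  have "ssubst m \<sigma> (ggen (t, i, j)) = odd_subst m \<sigma> (t, i, j)"
    unfolding ssubst_def
    by (rule geval_ggen[where t = "odd_subst m \<sigma>", OF poly_subst_hom ghom_odd_subst])
  with False show ?thesis by (simp add: entry_alt odd_subst_def)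
qed

lemma mat_alg_sdom: "f \<in> mat_alg m n T \<Longrightarrow> f \<in> sdom m \<sigma>"
  by (induction rule: mat_alg.induct) (auto intro: sdom_const sdom_entry sdom_add sdom_mult)

end

section \<open>The block determinants and the localization\<close>

lemma Fract_one_hom: "comm_ring_hom (\<lambda>p :: 'p::idom. Fract p 1)"
  by unfold_locales (auto simp: Zero_fract_def One_fract_def)

text \<open>The numerator of \<open>det_blocks\<close>. It lives in the polynomial ring, where the
  substitution is an everywhere defined ring homomorphism and commutes with determinants.\<close>

definition generic_det :: "nat \<Rightarrow> nat \<Rightarrow> nat \<Rightarrow> ((var \<Rightarrow>\<^sub>0 nat) \<Rightarrow>\<^sub>0 'a::field)" where
  "generic_det m n t =
    det (mat m m (\<lambda>(i, j). Poly_Mapping.single (Poly_Mapping.single (t, i + 1, j + 1) 1) 1)) *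
    det (mat n n (\<lambda>(i, j). Poly_Mapping.single (Poly_Mapping.single (t, m + i + 1, m + j + 1) 1) 1))"

lemma map_mat_prod: "map_mat h (mat k l (\<lambda>(i, j). g i j)) = mat k l (\<lambda>(i, j). h (g i j))"
  by (rule eq_matI) auto

lemma det_blocks_Fract: "det_blocks m n t = Fract (generic_det m n t) 1"
proof -
  interpret comm_ring_hom "\<lambda>p. Fract p 1 :: 'a rat_fun" by (rule Fract_one_hom)
  show ?thesis
    unfolding det_blocks_def generic_det_def hom_mult hom_det[symmetric] map_mat_prod rat_var_def
    by (rule refl)
qed

text \<open>Substitution and reduction modulo the odd generators are both ring homomorphisms and
  commute with determinants. By \<open>body_unit\<close>, a substitution extends to the localization
  as soon as this determinant of bodies is nonzero.\<close>

lemma det_blocks_subst: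
  fixes \<sigma> :: "var \<Rightarrow> 'a::field_char_0 sfun"
  assumes "parity_subst m \<sigma>"
  shows "det_blocks m n t \<in> fdom (poly_subst m \<sigma>)"
    and "body (feval (poly_subst m \<sigma>) (det_blocks m n t)) =
      det (mat m m (\<lambda>(i, j). gcoeff (\<sigma> (t, i + 1, j + 1)) {})) *
      det (mat n n (\<lambda>(i, j). gcoeff (\<sigma> (t, m + i + 1, m + j + 1)) {}))"
proof -
  interpret P: comm_ring_hom "poly_subst m \<sigma>" by (rule poly_subst_hom)
  interpret B: comm_ring_hom "body :: (var, 'a rat_fun) geven \<Rightarrow> 'a rat_fun" by (rule body_hom)
  show "det_blocks m n t \<in> fdom (poly_subst m \<sigma>)"
    unfolding det_blocks_Fract by (rule fdom_poly[OF poly_subst_hom])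
  have v: "body (poly_subst m \<sigma> (Poly_Mapping.single (Poly_Mapping.single v 1) 1)) = gcoeff (\<sigma> v) {}"
    if "even_var m v" for v
    using feval_rat_var[OF assms that] unfolding rat_var_def feval_poly[OF poly_subst_hom] by simp
  have "body (feval (poly_subst m \<sigma>) (det_blocks m n t)) =
     det (mat m m (\<lambda>(i, j). body (poly_subst m \<sigma> (Poly_Mapping.single (Poly_Mapping.single (t, i + 1, j + 1) 1) 1)))) *
     det (mat n n (\<lambda>(i, j). body (poly_subst m \<sigma> (Poly_Mapping.single (Poly_Mapping.single (t, m + i + 1, m + j + 1) 1) 1))))"
    unfolding det_blocks_Fract feval_poly[OF poly_subst_hom] generic_det_def
      P.hom_mult B.hom_mult P.hom_det[symmetric] B.hom_det[symmetric] map_mat_prod ..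
  also have "mat m m (\<lambda>(i, j). body (poly_subst m \<sigma> (Poly_Mapping.single (Poly_Mapping.single (t, i + 1, j + 1) 1) 1))) =
      mat m m (\<lambda>(i, j). gcoeff (\<sigma> (t, i + 1, j + 1)) {})"
    by (rule eq_matI) (auto intro!: v simp: even_var_def simp del: One_nat_def)
  also have "mat n n (\<lambda>(i, j). body (poly_subst m \<sigma> (Poly_Mapping.single (Poly_Mapping.single (t, m + i + 1, m + j + 1) 1) 1))) =
      mat n n (\<lambda>(i, j). gcoeff (\<sigma> (t, m + i + 1, m + j + 1)) {})"
    by (rule eq_matI) (auto intro!: v simp: even_var_def simp del: One_nat_def)
  finally show "body (feval (poly_subst m \<sigma>) (det_blocks m n t)) =
      det (mat m m (\<lambda>(i, j). gcoeff (\<sigma> (t, i + 1, j + 1)) {})) *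
      det (mat n n (\<lambda>(i, j). gcoeff (\<sigma> (t, m + i + 1, m + j + 1)) {}))" .
qed

text \<open>Substituting the identity matrix gives a determinant with body 1, whereas 0 would be
  mapped to 0.\<close>

lemma det_blocks_nonzero: "(det_blocks m n t :: 'a::field_char_0 rat_fun) \<noteq> 0"
proof
  define \<sigma> :: "var \<Rightarrow> 'a sfun" where "\<sigma> = (\<lambda>(t, i, j). if i = j then 1 else 0)"
  have par: "parity_subst m \<sigma>"
    by (auto simp: parity_subst_def \<sigma>_def even_var_def)
  have id: "mat k k (\<lambda>(i, j). gcoeff (\<sigma> (t, c + i + 1, c + j + 1)) {}) = 1\<^sub>m k" for c k
    by (rule eq_matI) (auto simp: \<sigma>_def)
  assume "(det_blocks m n t :: 'a rat_fun) = 0"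
  moreover have "feval (poly_subst m \<sigma>) 0 = 0"
  proof -
    interpret comm_ring_hom "poly_subst m \<sigma>" by (rule poly_subst_hom)
    show ?thesis using feval_poly[OF poly_subst_hom, of m \<sigma> 0] by (simp add: Zero_fract_def)
  qed
  ultimately show False
    using det_blocks_subst(2)[OF par, of n t] id[of m 0] id[of n m] by simp
qed

definition det_prod :: "nat \<Rightarrow> nat \<Rightarrow> nat set \<Rightarrow> 'a::field sfun" where
  "det_prod m n T = gscalar (\<Prod>t\<in>T. det_blocks m n t)"

lemma loc_alg_iff: "f \<in> loc_alg m n T \<longleftrightarrow> (\<exists>k. det_prod m n T ^ k * f \<in> mat_alg m n T)"
  by (simp add: loc_alg_def det_prod_def gscalar_power)

lemma mat_alg_0: "0 \<in> mat_alg m n T" and mat_alg_1: "1 \<in> mat_alg m n T"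
  using mat_alg.const[of 0] mat_alg.const[of 1] by (simp_all add: sconst_1)

lemma mat_alg_minus: "f \<in> mat_alg m n T \<Longrightarrow> - f \<in> mat_alg m n T"
  using mat_alg.mult[OF mat_alg.const[of "- 1"]] sconst_add[of 1 "- 1"]
  by (metis add.right_inverse minus_unique mult_minus1 sconst_0 sconst_1)

lemma mat_alg_sum: "(\<And>a. a \<in> A \<Longrightarrow> f a \<in> mat_alg m n T) \<Longrightarrow> sum f A \<in> mat_alg m n T"
  by (induction A rule: infinite_finite_induct) (auto intro: mat_alg_0 mat_alg.add)

lemma mat_alg_power: "f \<in> mat_alg m n T \<Longrightarrow> f ^ k \<in> mat_alg m n T"
  by (induction k) (auto intro: mat_alg_1 mat_alg.mult)

lemma mat_alg_gscalar_prod: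
  "(\<And>a. a \<in> A \<Longrightarrow> gscalar (f a) \<in> mat_alg m n T) \<Longrightarrow> gscalar (prod f A) \<in> mat_alg m n T"
  by (induction A rule: infinite_finite_induct)
     (auto intro: mat_alg_1 mat_alg.mult simp: gscalar_1 gscalar_mult)

lemma mat_alg_mono: "f \<in> mat_alg m n T \<Longrightarrow> T \<subseteq> T' \<Longrightarrow> f \<in> mat_alg m n T'"
  by (induction rule: mat_alg.induct) (auto intro: mat_alg.intros)

lemma mat_alg_det:
  fixes A :: "'a::field rat_fun mat"
  assumes "A \<in> carrier_mat k k" "\<And>i j. i < k \<Longrightarrow> j < k \<Longrightarrow> gscalar (A $$ (i, j)) \<in> mat_alg m n T"
  shows "gscalar (det A) \<in> mat_alg m n T"
proof -
  have "gscalar (signof p * (\<Prod>i = 0..<k. A $$ (i, p i))) \<in> mat_alg m n T"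
    if p: "p permutes {0..<k}" for p
  proof -
    have "gscalar (\<Prod>i = 0..<k. A $$ (i, p i)) \<in> mat_alg m n T"
      by (rule mat_alg_gscalar_prod) (use p assms(2) permutes_in_image[OF p] in auto)
    then show ?thesis
      by (cases rule: sign_cases[of p]) (auto simp: gscalar_minus mat_alg_minus)
  qed
  then show ?thesis
    unfolding det_def'[OF assms(1)] gscalar_sum by (intro mat_alg_sum) auto
qed

lemma det_prod_mat_alg: "T' \<subseteq> T \<Longrightarrow> det_prod m n T' \<in> mat_alg m n T"
proof -
  assume T: "T' \<subseteq> T"
  have ent: "gscalar (rat_var (t, i, j)) \<in> mat_alg m n T"
    if "t \<in> T" "i \<in> {1..m + n}" "j \<in> {1..m + n}" "even_var m (t, i, j)" for t i j
    using mat_alg.entry[OF that(1-3)] that(4) by (simp add: entry_alt)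
  show ?thesis
    unfolding det_prod_def det_blocks_def
  proof (intro mat_alg_gscalar_prod, unfold gscalar_mult, intro mat_alg.mult)
    fix t assume t: "t \<in> T'"
    show "gscalar (det (mat m m (\<lambda>(i, j). rat_var (t, i + 1, j + 1)))) \<in> mat_alg m n T"
      by (rule mat_alg_det[of _ m]) (use t T in \<open>auto intro!: ent simp: even_var_def\<close>)
    show "gscalar (det (mat n n (\<lambda>(i, j). rat_var (t, m + i + 1, m + j + 1)))) \<in> mat_alg m n T"
      by (rule mat_alg_det[of _ n]) (use t T in \<open>auto intro!: ent simp: even_var_def\<close>)
  qed
qed

lemma det_prod_power: "det_prod m n T ^ k = gscalar ((\<Prod>t\<in>T. det_blocks m n t) ^ k)"
  by (simp add: det_prod_def gscalar_power)

lemma ghom_det_prod_power: "ghom False (det_prod m n T ^ k)"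
  by (simp add: det_prod_power)

lemma det_prod_cancel:
  fixes f :: "'a::field_char_0 sfun"
  assumes "finite T"
  shows "det_prod m n T ^ k * f = det_prod m n T ^ k * g \<longleftrightarrow> f = g"
  unfolding det_prod_power
  by (rule gscalar_mult_left_cancel) (use assms det_blocks_nonzero in auto)

definition det_prod_inv :: "nat \<Rightarrow> nat \<Rightarrow> nat set \<Rightarrow> nat \<Rightarrow> 'a::field sfun" where
  "det_prod_inv m n T k = gscalar (inverse ((\<Prod>t\<in>T. det_blocks m n t) ^ k))"

lemma det_prod_inv:
  fixes T :: "nat set"
  assumes "finite T"
  shows "det_prod m n T ^ k * det_prod_inv m n T k = (1 :: 'a::field_char_0 sfun)"
    and "det_prod_inv m n T k * det_prod m n T ^ k = (1 :: 'a::field_char_0 sfun)"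
proof -
  have "(\<Prod>t\<in>T. det_blocks m n t :: 'a rat_fun) ^ k \<noteq> 0"
    using assms det_blocks_nonzero by auto
  then show "det_prod m n T ^ k * det_prod_inv m n T k = (1 :: 'a sfun)"
    and "det_prod_inv m n T k * det_prod m n T ^ k = (1 :: 'a sfun)"
    by (simp_all add: det_prod_power det_prod_inv_def gscalar_1 flip: gscalar_mult)
qed

lemma det_prod_inv_loc:
  "finite T \<Longrightarrow> (det_prod_inv m n T k :: 'a::field_char_0 sfun) \<in> loc_alg m n T"
  unfolding loc_alg_iff by (rule exI[of _ k]) (simp add: det_prod_inv mat_alg_1)

lemma mat_alg_loc: "f \<in> mat_alg m n T \<Longrightarrow> f \<in> loc_alg m n T"
  unfolding loc_alg_iff by (rule exI[of _ 0]) simp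

lemma loc_alg_add:
  assumes "f \<in> loc_alg m n T" "g \<in> loc_alg m n T"
  shows "f + g \<in> loc_alg m n T"
proof -
  let ?D = "det_prod m n T"
  obtain k l where kl: "?D ^ k * f \<in> mat_alg m n T" "?D ^ l * g \<in> mat_alg m n T"
    using assms by (auto simp: loc_alg_iff)
  have "?D ^ (k + l) * f = ?D ^ l * (?D ^ k * f)"
    by (simp only: mult.assoc[symmetric] power_add[symmetric] add.commute[of l k])
  moreover have "?D ^ (k + l) * g = ?D ^ k * (?D ^ l * g)"
    by (simp only: mult.assoc[symmetric] power_add[symmetric])
  ultimately have "?D ^ (k + l) * (f + g) = ?D ^ l * (?D ^ k * f) + ?D ^ k * (?D ^ l * g)"
    by (simp only: distrib_left)
  moreover have "\<dots> \<in> mat_alg m n T"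
    using mat_alg.mult[OF mat_alg_power[OF det_prod_mat_alg[OF order_refl]] kl(1), of l]
      mat_alg.mult[OF mat_alg_power[OF det_prod_mat_alg[OF order_refl]] kl(2), of k]
    by (rule mat_alg.add)
  ultimately have "?D ^ (k + l) * (f + g) \<in> mat_alg m n T" by simp
  then show ?thesis unfolding loc_alg_iff ..
qed

lemma loc_alg_mult:
  assumes "f \<in> loc_alg m n T" "g \<in> loc_alg m n T"
  shows "f * g \<in> loc_alg m n T"
proof -
  let ?D = "det_prod m n T"
  obtain k l where kl: "?D ^ k * f \<in> mat_alg m n T" "?D ^ l * g \<in> mat_alg m n T"
    using assms by (auto simp: loc_alg_iff)
  have "?D ^ (k + l) * (f * g) = (?D ^ k * f) * (?D ^ l * g)"
    by (simp only: mult.assoc power_add even_left_commute[OF ghom_det_prod_power, of f])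
  moreover have "\<dots> \<in> mat_alg m n T" by (rule mat_alg.mult[OF kl])
  ultimately have "?D ^ (k + l) * (f * g) \<in> mat_alg m n T" by simp
  then show ?thesis unfolding loc_alg_iff ..
qed

lemma loc_alg_mono:
  assumes "T \<subseteq> T'" "finite T'" "f \<in> loc_alg m n T"
  shows "f \<in> loc_alg m n T'"
proof -
  obtain k where k: "det_prod m n T ^ k * f \<in> mat_alg m n T"
    using assms by (auto simp: loc_alg_iff)
  have "(\<Prod>t\<in>T'. det_blocks m n t) = (\<Prod>t\<in>T' - T. det_blocks m n t) * (\<Prod>t\<in>T. det_blocks m n t :: 'a rat_fun)"
    using assms prod.subset_diff by blast
  then have "det_prod m n T' ^ k * f = det_prod m n (T' - T) ^ k * (det_prod m n T ^ k * f)"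
    by (simp add: det_prod_def gscalar_mult[symmetric] gscalar_power[symmetric]
        power_mult_distrib mult.assoc[symmetric])
  also have "\<dots> \<in> mat_alg m n T'"
    by (rule mat_alg.mult[OF mat_alg_power[OF det_prod_mat_alg] mat_alg_mono[OF k assms(1)]]) simp
  finally show ?thesis unfolding loc_alg_iff ..
qed

lemma loc_alg_divide:
  fixes f :: "'a::field_char_0 sfun"
  assumes "finite T" "f \<in> loc_alg m n T"
  obtains k g where "g \<in> mat_alg m n T" "f = det_prod_inv m n T k * g"
proof -
  obtain k where k: "det_prod m n T ^ k * f \<in> mat_alg m n T"
    using assms by (auto simp: loc_alg_iff)
  have "f = det_prod_inv m n T k * (det_prod m n T ^ k * f)"
    by (simp add: mult.assoc[symmetric] det_prod_inv(2)[OF assms(1)])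
  then show thesis using k that by blast
qed

lemma sscale_alt: "sscale a f = f * sconst a"
  by (simp add: sscale_def sconst_def gscalar_commute)

lemma mat_alg_scale: "f \<in> mat_alg m n T \<Longrightarrow> sscale a f \<in> mat_alg m n T"
  unfolding sscale_def by (intro mat_alg.mult mat_alg.const)

lemma loc_alg_scale: "f \<in> loc_alg m n T \<Longrightarrow> sscale a f \<in> loc_alg m n T"
  unfolding sscale_def by (rule loc_alg_mult[OF mat_alg_loc[OF mat_alg.const]])

section \<open>Algebra homomorphisms on the localization\<close>

lemma alg_hom_on_subset: "alg_hom_on R \<phi> \<Longrightarrow> R' \<subseteq> R \<Longrightarrow> alg_hom_on R' \<phi>"
  unfolding alg_hom_on_def by blast

lemma alg_hom_on_comp:
  "alg_hom_on R \<phi> \<Longrightarrow> alg_hom_on R' \<psi> \<Longrightarrow> \<phi> ` R \<subseteq> R' \<Longrightarrow> alg_hom_on R (\<lambda>f. \<psi> (\<phi> f))"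
  unfolding alg_hom_on_def by (auto simp: image_subset_iff)

lemma alg_hom_on_add: "alg_hom_on R \<phi> \<Longrightarrow> f \<in> R \<Longrightarrow> g \<in> R \<Longrightarrow> \<phi> (f + g) = \<phi> f + \<phi> g"
  unfolding alg_hom_on_def by blast

lemma alg_hom_on_mult: "alg_hom_on R \<phi> \<Longrightarrow> f \<in> R \<Longrightarrow> g \<in> R \<Longrightarrow> \<phi> (f * g) = \<phi> f * \<phi> g"
  unfolding alg_hom_on_def by blast

lemma alg_hom_on_scale: "alg_hom_on R \<phi> \<Longrightarrow> f \<in> R \<Longrightarrow> \<phi> (sscale a f) = sscale a (\<phi> f)"
  unfolding alg_hom_on_def by blast

lemma alg_hom_on_1: "alg_hom_on R \<phi> \<Longrightarrow> \<phi> 1 = 1"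
  unfolding alg_hom_on_def by blast

lemma alg_hom_on_const: "alg_hom_on R \<phi> \<Longrightarrow> 1 \<in> R \<Longrightarrow> \<phi> (sconst a) = sconst a"
  using alg_hom_on_scale[of R \<phi> 1 a] alg_hom_on_1[of R \<phi>] by (simp add: sscale_def)

lemma alg_hom_on_mat_alg_eq:
  assumes "f \<in> mat_alg m n T" "alg_hom_on (mat_alg m n T) \<phi>" "alg_hom_on (mat_alg m n T) \<psi>"
    and "\<And>t i j. t \<in> T \<Longrightarrow> i \<in> {1..m + n} \<Longrightarrow> j \<in> {1..m + n} \<Longrightarrow>
      \<phi> (entry m t i j) = \<psi> (entry m t i j)"
  shows "\<phi> f = \<psi> f"
  using assms(1)
  by induction
     (simp_all add: assms(4) alg_hom_on_const[OF assms(2) mat_alg_1] alg_hom_on_const[OF assms(3) mat_alg_1]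
       alg_hom_on_add[OF assms(2)] alg_hom_on_add[OF assms(3)]
       alg_hom_on_mult[OF assms(2)] alg_hom_on_mult[OF assms(3)])

lemma alg_hom_on_mat_alg_image:
  assumes "f \<in> mat_alg m n T" "alg_hom_on (mat_alg m n T) \<phi>"
    and "\<And>t i j. t \<in> T \<Longrightarrow> i \<in> {1..m + n} \<Longrightarrow> j \<in> {1..m + n} \<Longrightarrow> \<phi> (entry m t i j) \<in> R"
    and "\<And>a. sconst a \<in> R"
    and "\<And>f g. f \<in> R \<Longrightarrow> g \<in> R \<Longrightarrow> f + g \<in> R" "\<And>f g. f \<in> R \<Longrightarrow> g \<in> R \<Longrightarrow> f * g \<in> R"
  shows "\<phi> f \<in> R"
  using assms(1)
  by induction
     (simp_all add: assms(3-6) alg_hom_on_const[OF assms(2) mat_alg_1]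
       alg_hom_on_add[OF assms(2)] alg_hom_on_mult[OF assms(2)])

text \<open>On the inverse I of a power D of the determinant a homomorphism is determined by its
  value at D, because \<phi>(I) = \<phi>(I) \<psi>(D) \<psi>(I) and \<psi>(D) = \<phi>(D).\<close>

lemma alg_hom_on_loc_eq:
  fixes \<phi> \<psi> :: "'a::field_char_0 sfun \<Rightarrow> 'a sfun"
  assumes "finite T" "alg_hom_on (loc_alg m n T) \<phi>" "alg_hom_on (loc_alg m n T) \<psi>"
    and eq: "\<And>t i j. t \<in> T \<Longrightarrow> i \<in> {1..m + n} \<Longrightarrow> j \<in> {1..m + n} \<Longrightarrow>
      \<phi> (entry m t i j) = \<psi> (entry m t i j)"
    and f: "f \<in> loc_alg m n T"
  shows "\<phi> f = \<psi> f"
proof -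
  have sub: "mat_alg m n T \<subseteq> loc_alg m n T" using mat_alg_loc by blast
  note eq' = alg_hom_on_mat_alg_eq[OF _ alg_hom_on_subset[OF assms(2) sub]
      alg_hom_on_subset[OF assms(3) sub] eq]
  obtain k g where g: "g \<in> mat_alg m n T" "f = det_prod_inv m n T k * g"
    using loc_alg_divide[OF assms(1) f] .
  let ?D = "det_prod m n T ^ k :: 'a sfun" and ?I = "det_prod_inv m n T k :: 'a sfun"
  have D: "?D \<in> mat_alg m n T" by (rule mat_alg_power[OF det_prod_mat_alg[OF order_refl]])
  have I: "?I \<in> loc_alg m n T" by (rule det_prod_inv_loc[OF assms(1)])
  have "\<phi> ?I * \<phi> ?D = \<phi> (?I * ?D)" "\<psi> ?D * \<psi> ?I = \<psi> (?D * ?I)"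
    by (rule alg_hom_on_mult[symmetric, OF assms(2) I mat_alg_loc[OF D]],
        rule alg_hom_on_mult[symmetric, OF assms(3) mat_alg_loc[OF D] I])
  then have inv: "\<phi> ?I * \<phi> ?D = 1" "\<psi> ?D * \<psi> ?I = 1"
    by (simp_all add: det_prod_inv[OF assms(1)] alg_hom_on_1[OF assms(2)] alg_hom_on_1[OF assms(3)])
  have "\<phi> ?I = \<phi> ?I * (\<psi> ?D * \<psi> ?I)" using inv by simp
  also have "\<dots> = (\<phi> ?I * \<phi> ?D) * \<psi> ?I" using eq'[OF D] by (simp add: mult.assoc)
  also have "\<dots> = \<psi> ?I" using inv by simp
  finally show ?thesis
    using alg_hom_on_mult[OF assms(2) I mat_alg_loc[OF g(1)]]
      alg_hom_on_mult[OF assms(3) I mat_alg_loc[OF g(1)]] eq'[OF g(1)] g(2) by simp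
qed

lemma ssubst_alg_hom:
  fixes \<sigma> :: "var \<Rightarrow> 'a::field_char_0 sfun"
  assumes "parity_subst m \<sigma>"
  shows "alg_hom_on (sdom m \<sigma>) (ssubst m \<sigma>)"
proof -
  have "ssubst m \<sigma> 1 = 1"
    using ssubst_const[OF assms, of 1] by (simp add: sconst_1)
  then show ?thesis
    unfolding alg_hom_on_def sscale_def
    using ssubst_add[OF assms] ssubst_mult[OF assms] ssubst_const[OF assms] sdom_const[OF assms]
    by simp
qed

lemma loc_alg_sdom:
  fixes \<sigma> :: "var \<Rightarrow> 'a::field_char_0 sfun"
  assumes "parity_subst m \<sigma>" "finite T"
    and "\<And>t. t \<in> T \<Longrightarrow> body (feval (poly_subst m \<sigma>) (det_blocks m n t)) \<noteq> 0"
  shows "loc_alg m n T \<subseteq> sdom m \<sigma>"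
proof
  fix f :: "'a sfun" assume "f \<in> loc_alg m n T"
  then obtain k g where g: "g \<in> mat_alg m n T" "f = det_prod_inv m n T k * g"
    using loc_alg_divide[OF assms(2)] by blast
  let ?e = "poly_subst m \<sigma>"
  interpret B: comm_ring_hom "body :: (var, 'a rat_fun) geven \<Rightarrow> 'a rat_fun" by (rule body_hom)
  have P: "(\<Prod>t\<in>T. det_blocks m n t) \<in> fdom ?e \<and>
      feval ?e (\<Prod>t\<in>T. det_blocks m n t) = (\<Prod>t\<in>T. feval ?e (det_blocks m n t))"
    by (rule fdom_prod[OF poly_subst_hom ghom_odd_subst[OF assms(1)]]) (rule det_blocks_subst(1)[OF assms(1)])
  have Pk: "(\<Prod>t\<in>T. det_blocks m n t) ^ k \<in> fdom ?e \<and>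
      feval ?e ((\<Prod>t\<in>T. det_blocks m n t) ^ k) = (\<Prod>t\<in>T. feval ?e (det_blocks m n t)) ^ k"
    using fdom_prod[OF poly_subst_hom ghom_odd_subst[OF assms(1)], of "{..<k}" "\<lambda>_. \<Prod>t\<in>T. det_blocks m n t"] P
    by simp
  have "body (feval ?e ((\<Prod>t\<in>T. det_blocks m n t) ^ k)) \<noteq> 0"
    using assms(2,3) Pk by (simp add: B.hom_power B.hom_prod del: of_even_power)
  then have "det_prod_inv m n T k \<in> sdom m \<sigma>"
    unfolding det_prod_inv_def
    by (intro sdom_gscalar[OF assms(1)] fdom_inverse[OF poly_subst_hom, THEN conjunct1])
       (auto simp: Pk body_unit)
  then show "f \<in> sdom m \<sigma>"
    unfolding g(2) by (rule sdom_mult[OF assms(1) _ mat_alg_sdom[OF assms(1) g(1)]])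
qed

text \<open>Variables outside the chosen matrices and the index range get the value 0, which has
  both parities; thus \<open>parity_subst\<close> holds for all variables.\<close>

definition total_subst ::
  "nat \<Rightarrow> nat \<Rightarrow> nat set \<Rightarrow> (nat \<Rightarrow> nat \<Rightarrow> nat \<Rightarrow> 'a::field sfun) \<Rightarrow> var \<Rightarrow> 'a sfun" where
  "total_subst m n T \<sigma> = (\<lambda>(t, i, j).
    if t \<in> T \<and> i \<in> {1..m + n} \<and> j \<in> {1..m + n} then \<sigma> t i j else 0)"

definition body_det :: "nat \<Rightarrow> nat \<Rightarrow> (nat \<Rightarrow> nat \<Rightarrow> 'a::field sfun) \<Rightarrow> 'a rat_fun" where
  "body_det m n X = det (mat m m (\<lambda>(i, j). gcoeff (X (i + 1) (j + 1)) {})) *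
    det (mat n n (\<lambda>(i, j). gcoeff (X (m + i + 1) (m + j + 1)) {}))"

lemma total_subst_props:
  fixes \<sigma> :: "nat \<Rightarrow> nat \<Rightarrow> nat \<Rightarrow> 'a::field_char_0 sfun"
  assumes fin: "finite T"
    and par: "\<And>t i j. t \<in> T \<Longrightarrow> i \<in> {1..m + n} \<Longrightarrow> j \<in> {1..m + n} \<Longrightarrow>
      ghom ((i \<le> m) \<noteq> (j \<le> m)) (\<sigma> t i j)"
    and det: "\<And>t. t \<in> T \<Longrightarrow> body_det m n (\<sigma> t) \<noteq> 0"
  shows "parity_subst m (total_subst m n T \<sigma>)"
    and "loc_alg m n T \<subseteq> sdom m (total_subst m n T \<sigma>)"
proof -
  let ?\<sigma> = "total_subst m n T \<sigma>"
  show parity: "parity_subst m ?\<sigma>"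
    using par by (auto simp: parity_subst_def total_subst_def even_var_def)
  show "loc_alg m n T \<subseteq> sdom m ?\<sigma>"
  proof (rule loc_alg_sdom[OF parity fin])
    fix t assume t: "t \<in> T"
    have "mat m m (\<lambda>(i, j). gcoeff (?\<sigma> (t, i + 1, j + 1)) {}) = mat m m (\<lambda>(i, j). gcoeff (\<sigma> t (i + 1) (j + 1)) {})"
      by (rule eq_matI) (auto simp: total_subst_def t)
    moreover have "mat n n (\<lambda>(i, j). gcoeff (?\<sigma> (t, m + i + 1, m + j + 1)) {}) =
        mat n n (\<lambda>(i, j). gcoeff (\<sigma> t (m + i + 1) (m + j + 1)) {})"
      by (rule eq_matI) (auto simp: total_subst_def t)
    ultimately show "body (feval (poly_subst m ?\<sigma>) (det_blocks m n t)) \<noteq> 0"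
      using det[OF t] unfolding det_blocks_subst(2)[OF parity] body_det_def by simp
  qed
qed

text \<open>Justifies the definite description in \<open>subst_hom\<close>: \<open>ssubst\<close>
  restricted to the localization gives existence, and \<open>alg_hom_on_loc_eq\<close> uniqueness.
  All homomorphisms in the definitions are obtained from it by checking parities and a determinant
  of bodies.\<close>

theorem subst_hom_exists:
  fixes \<sigma> :: "nat \<Rightarrow> nat \<Rightarrow> nat \<Rightarrow> 'a::field_char_0 sfun"
  assumes fin: "finite T"
    and par: "\<And>t i j. t \<in> T \<Longrightarrow> i \<in> {1..m + n} \<Longrightarrow> j \<in> {1..m + n} \<Longrightarrow>
      ghom ((i \<le> m) \<noteq> (j \<le> m)) (\<sigma> t i j)"
    and det: "\<And>t. t \<in> T \<Longrightarrow> body_det m n (\<sigma> t) \<noteq> 0"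
  shows "alg_hom_on (loc_alg m n T) (subst_hom m n T \<sigma>)"
    and "\<And>t i j. t \<in> T \<Longrightarrow> i \<in> {1..m + n} \<Longrightarrow> j \<in> {1..m + n} \<Longrightarrow>
      subst_hom m n T \<sigma> (entry m t i j) = \<sigma> t i j"
proof -
  let ?\<sigma> = "total_subst m n T \<sigma>"
  let ?P = "\<lambda>\<phi>. alg_hom_on (loc_alg m n T) \<phi> \<and>
    (\<forall>t\<in>T. \<forall>i\<in>{1..m + n}. \<forall>j\<in>{1..m + n}. \<phi> (entry m t i j) = \<sigma> t i j) \<and>
    (\<forall>f. f \<notin> loc_alg m n T \<longrightarrow> \<phi> f = 0)"
  define \<Phi> where "\<Phi> f = (if f \<in> loc_alg m n T then ssubst m ?\<sigma> f else 0)" for f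
  have parity: "parity_subst m ?\<sigma>" and dom: "loc_alg m n T \<subseteq> sdom m ?\<sigma>"
    by (rule total_subst_props; use assms in blast)+
  have hom: "alg_hom_on (loc_alg m n T) (ssubst m ?\<sigma>)"
    by (rule alg_hom_on_subset[OF ssubst_alg_hom[OF parity] dom])
  have "alg_hom_on (loc_alg m n T) \<Phi>"
    unfolding alg_hom_on_def
  proof (intro conjI ballI allI)
    show "\<Phi> 1 = 1" using alg_hom_on_1[OF hom] mat_alg_loc[OF mat_alg_1] by (simp add: \<Phi>_def)
  qed (simp_all add: \<Phi>_def loc_alg_add loc_alg_mult loc_alg_scale alg_hom_on_add[OF hom]
      alg_hom_on_mult[OF hom] alg_hom_on_scale[OF hom])
  moreover have "\<Phi> (entry m t i j) = \<sigma> t i j"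
    if "t \<in> T" "i \<in> {1..m + n}" "j \<in> {1..m + n}" for t i j
  proof -
    have "ssubst m ?\<sigma> (entry m t i j) = ?\<sigma> (t, i, j)" by (rule ssubst_entry[OF parity])
    also have "\<dots> = \<sigma> t i j" using that by (simp add: total_subst_def)
    finally show ?thesis
      unfolding \<Phi>_def using mat_alg_loc[OF mat_alg.entry[OF that], where 'a = 'a] by (simp only: if_True)
  qed
  ultimately have P: "?P \<Phi>" by (simp add: \<Phi>_def)
  have "subst_hom m n T \<sigma> = \<Phi>"
    unfolding subst_hom_def
  proof (rule the_equality)
    fix \<phi> assume \<phi>: "?P \<phi>"
    show "\<phi> = \<Phi>"
    proof
      fix f
      show "\<phi> f = \<Phi> f"
      proof (cases "f \<in> loc_alg m n T")
        case True
        show ?thesis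
          by (rule alg_hom_on_loc_eq[OF fin _ _ _ True]) (use \<phi> P in auto)
      qed (use \<phi> P in auto)
    qed
  qed (use P in blast)
  then show "alg_hom_on (loc_alg m n T) (subst_hom m n T \<sigma>)"
    and "\<And>t i j. t \<in> T \<Longrightarrow> i \<in> {1..m + n} \<Longrightarrow> j \<in> {1..m + n} \<Longrightarrow>
      subst_hom m n T \<sigma> (entry m t i j) = \<sigma> t i j"
    using P by blast+
qed

section \<open>Comultiplication, restriction and one-parameter subgroups\<close>

lemma sum_blocks:
  fixes g :: "nat \<Rightarrow> 'b::comm_monoid_add"
  shows "(\<Sum>k = 1..m + n. g k) = (\<Sum>k<m. g (k + 1)) + (\<Sum>k<n. g (m + k + 1))"
  by (induction n) (simp_all add: sum.atLeast1_atMost_eq ac_simps)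

lemma rat_var_nonzero: "(rat_var v :: 'a::field rat_fun) \<noteq> 0"
  by (simp add: rat_var_def Zero_fract_def eq_fract) (metis lookup_single_eq lookup_zero zero_neq_one)

lemma body_entry: "gcoeff (entry m t i j) {} = (if (i \<le> m) = (j \<le> m) then rat_var (t, i, j) else 0)"
  by (simp add: entry_def)

lemma body_det_entry: "body_det m n (entry m t) = det_blocks m n t"
  unfolding body_det_def det_blocks_def
  by (rule arg_cong2[where f = "(*)"]; rule arg_cong[where f = det], rule eq_matI)
     (auto simp: body_entry)

text \<open>Modulo the odd generators both generic matrices are block diagonal, so the diagonal
  blocks of the product are the products of the diagonal blocks.\<close>

lemma body_det_mult:
  "body_det m n (\<lambda>i j. \<Sum>k = 1..m + n. entry m 1 i k * entry m 2 k j) =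
    (det_blocks m n 1 * det_blocks m n 2 :: 'a::field rat_fun)"
proof -
  let ?A = "\<lambda>t. mat m m (\<lambda>(i, j). rat_var (t, i + 1, j + 1)) :: 'a rat_fun mat"
  let ?B = "\<lambda>t. mat n n (\<lambda>(i, j). rat_var (t, m + i + 1, m + j + 1)) :: 'a rat_fun mat"
  let ?X = "\<lambda>i j. \<Sum>k = 1..m + n. entry m 1 i k * entry m 2 k j :: 'a sfun"
  have X: "gcoeff (?X a b) {} =
      (\<Sum>k<m. gcoeff (entry m 1 a (k + 1)) {} * gcoeff (entry m 2 (k + 1) b) {}) +
      (\<Sum>k<n. gcoeff (entry m 1 a (m + k + 1)) {} * gcoeff (entry m 2 (m + k + 1) b) {})" for a b
    by (simp only: gcoeff_sum gcoeff_add gcoeff_mult_empty sum_blocks)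
  have "mat m m (\<lambda>(i, j). gcoeff (?X (i + 1) (j + 1)) {}) = ?A 1 * ?A 2"
    unfolding X by (rule eq_matI) (auto simp: body_entry scalar_prod_def lessThan_atLeast0)
  moreover have "mat n n (\<lambda>(i, j). gcoeff (?X (m + i + 1) (m + j + 1)) {}) = ?B 1 * ?B 2"
    unfolding X by (rule eq_matI) (auto simp: body_entry scalar_prod_def lessThan_atLeast0)
  ultimately show ?thesis
    unfolding body_det_def det_blocks_def
    using det_mult[of "?A 1" m "?A 2"] det_mult[of "?B 1" n "?B 2"] by simp
qed

lemma det_lower_nonzero:
  fixes A :: "'b::idom mat"
  assumes "A \<in> carrier_mat k k" "\<And>i j. i < j \<Longrightarrow> j < k \<Longrightarrow> A $$ (i, j) = 0"
    and "\<And>i. i < k \<Longrightarrow> A $$ (i, i) \<noteq> 0"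
  shows "det A \<noteq> 0"
proof -
  have "det A = prod_list (diag_mat A)"
    by (rule det_lower_triangular[OF assms(2,1)])
  moreover have "0 \<notin> set (diag_mat A)"
    using assms(1,3) by (fastforce simp: diag_mat_def)
  ultimately show ?thesis by (simp add: prod_list_zero_iff)
qed

lemma body_det_lower:
  fixes X :: "nat \<Rightarrow> nat \<Rightarrow> 'a::field sfun"
  assumes "\<And>i j. i < j \<Longrightarrow> gcoeff (X i j) {} = 0"
    and "\<And>i. i \<in> {1..m + n} \<Longrightarrow> gcoeff (X i i) {} \<noteq> 0"
  shows "body_det m n X \<noteq> 0"
proof -
  have "det (mat m m (\<lambda>(i, j). gcoeff (X (i + 1) (j + 1)) {})) \<noteq> 0"
    by (rule det_lower_nonzero[of _ m]) (use assms in auto)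
  moreover have "det (mat n n (\<lambda>(i, j). gcoeff (X (m + i + 1) (m + j + 1)) {})) \<noteq> 0"
    by (rule det_lower_nonzero[of _ n]) (use assms in auto)
  ultimately show ?thesis by (simp add: body_det_def)
qed

lemma ghom_entry': "ghom ((i \<le> m) \<noteq> (j \<le> m)) (entry m t i j)"
  using ghom_entry[of m t i j] by (simp add: even_var_def)

text \<open>The parities of the positions (i, k) and (k, j) add up to that of (i, j) for every k;
  hence the entries of the product of two generic matrices are homogeneous.\<close>

lemma ghom_entry_mult:
  "ghom ((i \<le> m) \<noteq> (j \<le> m)) (entry m t i k * entry m u k j :: 'a::field sfun)"
proof -
  have "ghom (((i \<le> m) \<noteq> (k \<le> m)) \<noteq> ((k \<le> m) \<noteq> (j \<le> m))) (entry m t i k * entry m u k j :: 'a sfun)"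
    by (intro ghom_mult ghom_entry')
  then show ?thesis by (cases "k \<le> m") auto
qed

lemma comult_hom: "alg_hom_on (coord_alg m n) (comult m n :: 'a::field_char_0 sfun \<Rightarrow> 'a sfun)"
  and comult_entry: "i \<in> {1..m + n} \<Longrightarrow> j \<in> {1..m + n} \<Longrightarrow>
    comult m n (entry m 1 i j) = (\<Sum>k = 1..m + n. entry m 1 i k * entry m 2 k j :: 'a::field_char_0 sfun)"
proof -
  let ?X = "\<lambda>i j. \<Sum>k = 1..m + n. entry m 1 i k * entry m 2 k j :: 'a sfun"
  have det: "body_det m n ?X \<noteq> 0"
    unfolding body_det_mult by (simp add: det_blocks_nonzero)
  have par: "ghom ((i \<le> m) \<noteq> (j \<le> m)) (?X i j)" for i j
    by (intro ghom_sum ghom_entry_mult)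
  show "alg_hom_on (coord_alg m n) (comult m n :: 'a sfun \<Rightarrow> 'a sfun)"
    unfolding comult_def coord_alg_def by (rule subst_hom_exists(1)[OF _ par det]) auto
  show "i \<in> {1..m + n} \<Longrightarrow> j \<in> {1..m + n} \<Longrightarrow> comult m n (entry m 1 i j) = ?X i j"
    unfolding comult_def by (rule subst_hom_exists(2)[OF _ par det]) auto
qed

lemma right_factor_hom: "alg_hom_on (coord_alg m n) (right_factor m n :: 'a::field_char_0 sfun \<Rightarrow> 'a sfun)"
  and right_factor_entry: "i \<in> {1..m + n} \<Longrightarrow> j \<in> {1..m + n} \<Longrightarrow>
    right_factor m n (entry m 1 i j) = (entry m 2 i j :: 'a::field_char_0 sfun)"
proof -
  have det: "body_det m n (entry m 2 :: nat \<Rightarrow> nat \<Rightarrow> 'a sfun) \<noteq> 0"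
    unfolding body_det_entry by (rule det_blocks_nonzero)
  show "alg_hom_on (coord_alg m n) (right_factor m n :: 'a sfun \<Rightarrow> 'a sfun)"
    unfolding right_factor_def coord_alg_def by (rule subst_hom_exists(1)[OF _ ghom_entry' det]) auto
  show "i \<in> {1..m + n} \<Longrightarrow> j \<in> {1..m + n} \<Longrightarrow> right_factor m n (entry m 1 i j) = (entry m 2 i j :: 'a sfun)"
    unfolding right_factor_def by (rule subst_hom_exists(2)[OF _ ghom_entry' det]) auto
qed

text \<open>The first matrix becomes lower triangular with a nonzero diagonal, so the determinants
  of its blocks stay nonzero.\<close>

lemma borel_restrict_hom:
    "alg_hom_on (loc_alg m n {1, 2}) (borel_restrict m n :: 'a::field_char_0 sfun \<Rightarrow> 'a sfun)"
  and borel_restrict_entry: "t \<in> {1, 2} \<Longrightarrow> i \<in> {1..m + n} \<Longrightarrow> j \<in> {1..m + n} \<Longrightarrow>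
    borel_restrict m n (entry m t i j) = (if t = 1 \<and> i < j then 0 else entry m t i j :: 'a::field_char_0 sfun)"
proof -
  let ?\<sigma> = "\<lambda>t i j. if t = 1 \<and> i < j then 0 else entry m t i j :: 'a sfun"
  have 1: "body_det m n (?\<sigma> 1) \<noteq> 0"
    by (rule body_det_lower) (auto simp: body_entry rat_var_nonzero)
  have 2: "body_det m n (?\<sigma> 2) \<noteq> 0"
    using det_blocks_nonzero[of m n 2, where 'a = 'a] by (simp add: body_det_entry)
  have det: "body_det m n (?\<sigma> t) \<noteq> 0" if "t \<in> {1, 2}" for t
    using that 1 2 by (auto simp del: One_nat_def)
  have par: "ghom ((i \<le> m) \<noteq> (j \<le> m)) (?\<sigma> t i j)" for t i j
    by (simp add: ghom_entry'[simplified])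
  show "alg_hom_on (loc_alg m n {1, 2}) (borel_restrict m n :: 'a sfun \<Rightarrow> 'a sfun)"
    unfolding borel_restrict_def by (rule subst_hom_exists(1)[OF _ par det]) auto
  show "t \<in> {1, 2} \<Longrightarrow> i \<in> {1..m + n} \<Longrightarrow> j \<in> {1..m + n} \<Longrightarrow>
      borel_restrict m n (entry m t i j) = ?\<sigma> t i j"
    unfolding borel_restrict_def by (rule subst_hom_exists(2)[OF _ par det]) auto
qed

text \<open>An infinitesimal of parity \<open>b\<close>, made of odd generators \<open>(0, i, j)\<close> that belong to none of the
  generic matrices.\<close>

definition theta :: "bool \<Rightarrow> 'a::field sfun" where
  "theta b = (if b then ggen (0, 0, 0) else ggen (0, 0, 0) * ggen (0, 0, 1))"

lemma ghom_theta: "ghom b (theta b :: 'a::field sfun)"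
proof -
  have "ghom (True \<noteq> True) (ggen (0, 0, 0) * ggen (0, 0, 1) :: 'a sfun)"
    by (intro ghom_mult ghom_ggen)
  then show ?thesis by (simp add: theta_def)
qed

lemma theta_square: "theta b * f * theta b = (0 :: 'a::field_char_0 sfun)"
proof -
  have 0: "ggen v * ggen v = (0 :: 'a sfun)" for v by (rule odd_square_zero) simp
  have "theta b * theta b = (0 :: 'a sfun)"
  proof (cases b)
    case False
    let ?v = "ggen (0, 0, 0) :: 'a sfun" and ?w = "ggen (0, 0, 1) :: 'a sfun"
    have "?v * ?w * (?v * ?w) = ?v * (?w * ?v) * ?w" by (simp only: mult.assoc)
    also have "?w * ?v = - (?v * ?w)"
      using supercommute[OF ghom_ggen, of "(0, 0, 1)" ?v] by (simp add: ginv_ghom[OF ghom_ggen])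
    also have "?v * - (?v * ?w) * ?w = - ((?v * ?v) * ?w * ?w)" by (simp add: mult.assoc)
    finally show ?thesis using False by (simp add: theta_def 0)
  qed (simp add: theta_def 0)
  moreover have "theta b * f = ginv b f * theta b" by (rule supercommute[OF ghom_theta])
  ultimately show ?thesis by (simp add: mult.assoc)
qed

text \<open>The matrix 1 + \<theta> E_ij, with \<theta> of the parity of the position (i, j). If the
  indices lie outside the range, as for (0, 0), it is the identity matrix on the range.\<close>

definition unip :: "nat \<Rightarrow> nat \<Rightarrow> nat \<Rightarrow> nat \<Rightarrow> nat \<Rightarrow> 'a::field sfun" where
  "unip m i j k l = (if k = l then 1 else 0) +
    (if k = i \<and> l = j then theta ((i \<le> m) \<noteq> (j \<le> m)) else 0)"

lemma ghom_unip: "ghom ((k \<le> m) \<noteq> (l \<le> m)) (unip m i j k l)"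
  unfolding unip_def by (intro ghom_add) (auto simp: ghom_theta)

lemma body_theta: "gcoeff (theta b) {} = 0"
  by (simp add: theta_def)

lemma body_det_unip: "body_det m n (unip m i j :: nat \<Rightarrow> nat \<Rightarrow> 'a::field sfun) \<noteq> 0"
  by (rule body_det_lower) (auto simp: unip_def body_theta)

section \<open>Evaluation of the two generic matrices at points\<close>

definition point_eval ::
  "nat \<Rightarrow> nat \<Rightarrow> (nat \<Rightarrow> nat \<Rightarrow> 'a::field sfun) \<Rightarrow> (nat \<Rightarrow> nat \<Rightarrow> 'a sfun) \<Rightarrow> 'a sfun \<Rightarrow> 'a sfun" where
  "point_eval m n X Y = ssubst m (total_subst m n {1, 2} (\<lambda>t. if t = 1 then X else Y))"

text \<open>Larger than F[G] \<otimes> F[G]: it also has to contain the characters of the Borel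
  subsupergroup, whose negative powers of single diagonal entries do not in general lie in
  F[G].\<close>

definition point_dom ::
  "nat \<Rightarrow> nat \<Rightarrow> (nat \<Rightarrow> nat \<Rightarrow> 'a::field sfun) \<Rightarrow> (nat \<Rightarrow> nat \<Rightarrow> 'a sfun) \<Rightarrow> 'a sfun set" where
  "point_dom m n X Y = sdom m (total_subst m n {1, 2} (\<lambda>t. if t = 1 then X else Y))"

definition is_point :: "nat \<Rightarrow> nat \<Rightarrow> (nat \<Rightarrow> nat \<Rightarrow> 'a::field sfun) \<Rightarrow> bool" where
  "is_point m n X \<longleftrightarrow> body_det m n X \<noteq> 0 \<and> (\<forall>i j. ghom ((i \<le> m) \<noteq> (j \<le> m)) (X i j))"

lemma is_point_entry: "is_point m n (entry m t :: nat \<Rightarrow> nat \<Rightarrow> 'a::field_char_0 sfun)"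
  unfolding is_point_def body_det_entry by (intro conjI allI det_blocks_nonzero ghom_entry')

lemma is_point_unip: "is_point m n (unip m i j)"
  unfolding is_point_def by (intro conjI allI body_det_unip ghom_unip)

context
  fixes m n :: nat and X Y :: "nat \<Rightarrow> nat \<Rightarrow> 'a::field_char_0 sfun"
  assumes X: "is_point m n X" and Y: "is_point m n Y"
begin

lemma point_parity: "parity_subst m (total_subst m n {1, 2} (\<lambda>t. if t = 1 then X else Y))"
  and point_loc: "loc_alg m n {1, 2} \<subseteq> point_dom m n X Y"
  unfolding point_dom_def
  by (rule total_subst_props; use X Y in \<open>auto simp: is_point_def\<close>)+

lemma point_eval_hom_dom: "alg_hom_on (point_dom m n X Y) (point_eval m n X Y)"
  unfolding point_dom_def point_eval_def by (rule ssubst_alg_hom[OF point_parity])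

lemma point_eval_hom: "alg_hom_on (loc_alg m n {1, 2}) (point_eval m n X Y)"
  by (rule alg_hom_on_subset[OF point_eval_hom_dom point_loc])

lemma point_eval_entry:
  assumes "i \<in> {1..m + n}" "j \<in> {1..m + n}"
  shows "point_eval m n X Y (entry m 1 i j) = X i j" "point_eval m n X Y (entry m 2 i j) = Y i j"
  unfolding point_eval_def ssubst_entry[OF point_parity]
  using assms by (auto simp: total_subst_def)

end

lemma mat_alg_coord: "mat_alg m n {1} \<subseteq> coord_alg m n"
  using mat_alg_loc by (auto simp: coord_alg_def)

lemma right_factor_mat_alg:
  fixes f :: "'a::field_char_0 sfun"
  assumes "f \<in> mat_alg m n {1}"
  shows "right_factor m n f \<in> mat_alg m n {2}"
  by (rule alg_hom_on_mat_alg_image[OF assms alg_hom_on_subset[OF right_factor_hom mat_alg_coord]])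
     (auto simp: right_factor_entry[of _ m n, unfolded One_nat_def] intro: mat_alg.intros)

section \<open>Derivations\<close>

definition mderiv :: "'x \<Rightarrow> (('x \<Rightarrow>\<^sub>0 nat) \<Rightarrow>\<^sub>0 'a::comm_ring_1) \<Rightarrow> (('x \<Rightarrow>\<^sub>0 nat) \<Rightarrow>\<^sub>0 'a)" where
  "mderiv v p = (\<Sum>k\<in>Poly_Mapping.keys p. Poly_Mapping.single (k - Poly_Mapping.single v 1)
    (of_nat (Poly_Mapping.lookup k v) * Poly_Mapping.lookup p k))"

lemma mderiv_superset:
  assumes "finite K" "Poly_Mapping.keys p \<subseteq> K"
  shows "mderiv v p = (\<Sum>k\<in>K. Poly_Mapping.single (k - Poly_Mapping.single v 1)
    (of_nat (Poly_Mapping.lookup k v) * Poly_Mapping.lookup p k))"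
  unfolding mderiv_def
  by (rule sum.mono_neutral_left) (use assms in \<open>auto simp: in_keys_iff\<close>)

lemma mderiv_add: "mderiv v (p + q) = mderiv v p + mderiv v q"
proof -
  let ?K = "Poly_Mapping.keys p \<union> Poly_Mapping.keys q"
  have "Poly_Mapping.keys (p + q) \<subseteq> ?K" by (rule keys_add)
  then show ?thesis
    by (simp add: mderiv_superset[of ?K] lookup_add distrib_left single_add sum.distrib)
qed

lemma mderiv_0 [simp]: "mderiv v 0 = 0"
  by (simp add: mderiv_def)

lemma mderiv_sum: "mderiv v (sum p A) = (\<Sum>a\<in>A. mderiv v (p a))"
  by (induction A rule: infinite_finite_induct) (auto simp: mderiv_add)

lemma mderiv_single: "mderiv v (Poly_Mapping.single k a) =
    Poly_Mapping.single (k - Poly_Mapping.single v 1) (of_nat (Poly_Mapping.lookup k v) * a)"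
  by (cases "a = 0") (auto simp: mderiv_def)

lemma mderiv_single_mult:
  "mderiv v (Poly_Mapping.single k a * Poly_Mapping.single l b) =
    mderiv v (Poly_Mapping.single k a) * Poly_Mapping.single l b +
    Poly_Mapping.single k a * mderiv v (Poly_Mapping.single l b)"
proof -
  let ?v = "Poly_Mapping.single v (1::nat)"
  \<comment> \<open>Exponents are subtracted with truncation at 0, so this needs v to occur in k.
    Otherwise the coefficient \<open>Poly_Mapping.lookup k v\<close> is 0 and the exponent does not
    matter.\<close>
  have shift: "k + l - ?v = (k - ?v) + l" if "Poly_Mapping.lookup k v \<noteq> 0" for k l :: "'a \<Rightarrow>\<^sub>0 nat"
    by (rule poly_mapping_eqI) (use that in \<open>auto simp: lookup_add lookup_minus lookup_single when_def\<close>)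
  have 1: "Poly_Mapping.single (k + l - ?v) (of_nat (Poly_Mapping.lookup k v) * c) =
      Poly_Mapping.single ((k - ?v) + l) (of_nat (Poly_Mapping.lookup k v) * c)"
    for c :: 'b using shift[of k l] by (cases "Poly_Mapping.lookup k v = 0") auto
  have 2: "Poly_Mapping.single (k + l - ?v) (of_nat (Poly_Mapping.lookup l v) * c) =
      Poly_Mapping.single (k + (l - ?v)) (of_nat (Poly_Mapping.lookup l v) * c)"
    for c :: 'b using shift[of l k] by (cases "Poly_Mapping.lookup l v = 0") (auto simp: add.commute)
  have "mderiv v (Poly_Mapping.single k a * Poly_Mapping.single l b) =
      Poly_Mapping.single (k + l - ?v) (of_nat (Poly_Mapping.lookup k v) * (a * b)) +
      Poly_Mapping.single (k + l - ?v) (of_nat (Poly_Mapping.lookup l v) * (a * b))"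
    by (simp add: mult_single mderiv_single lookup_add distrib_right single_add)
  then show ?thesis
    unfolding 1 2 by (simp add: mult_single mderiv_single mult.assoc mult.left_commute[of a])
qed

lemma mderiv_mult: "mderiv v (p * q) = mderiv v p * q + p * mderiv v q"
proof -
  let ?s = "\<lambda>p k. Poly_Mapping.single k (Poly_Mapping.lookup p k)"
  have p: "p = (\<Sum>k\<in>Poly_Mapping.keys p. ?s p k)" and q: "q = (\<Sum>l\<in>Poly_Mapping.keys q. ?s q l)"
    by (rule poly_mapping_sum_singles)+
  have dp: "mderiv v p = (\<Sum>k\<in>Poly_Mapping.keys p. mderiv v (?s p k))"
    and dq: "mderiv v q = (\<Sum>k\<in>Poly_Mapping.keys q. mderiv v (?s q k))"
    by (subst p, rule mderiv_sum) (subst q, rule mderiv_sum)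
  have "mderiv v (p * q) = mderiv v ((\<Sum>k\<in>Poly_Mapping.keys p. ?s p k) * (\<Sum>l\<in>Poly_Mapping.keys q. ?s q l))"
    using p q by simp
  also have "\<dots> = (\<Sum>k\<in>Poly_Mapping.keys p. mderiv v (?s p k)) * (\<Sum>l\<in>Poly_Mapping.keys q. ?s q l) +
      (\<Sum>k\<in>Poly_Mapping.keys p. ?s p k) * (\<Sum>l\<in>Poly_Mapping.keys q. mderiv v (?s q l))"
    by (simp only: sum_product mderiv_sum mderiv_single_mult sum.distrib)
  finally show ?thesis using p q dp dq by simp
qed

lemma double_eq_zero: "x + x = x \<Longrightarrow> x = 0" for x :: "'b::ab_group_add"
  by simp

text \<open>The extension of a derivation to the fraction field by the quotient rule;
  \<open>fract_deriv_Fract\<close> shows that the value is the same for all representations.\<close>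

definition fract_deriv :: "('p::idom \<Rightarrow> 'p) \<Rightarrow> 'p fract \<Rightarrow> 'p fract" where
  "fract_deriv D x = (THE y. \<exists>p q. q \<noteq> 0 \<and> x = Fract p q \<and> y = Fract (D p * q - p * D q) (q * q))"

context
  fixes D :: "'p::idom \<Rightarrow> 'p"
  assumes add: "\<And>p q. D (p + q) = D p + D q" and mult: "\<And>p q. D (p * q) = D p * q + p * D q"
begin

lemma fract_deriv_Fract:
  assumes "q \<noteq> 0"
  shows "fract_deriv D (Fract p q) = Fract (D p * q - p * D q) (q * q)"
  unfolding fract_deriv_def
proof (rule the_equality)
  fix y assume "\<exists>p' q'. q' \<noteq> 0 \<and> Fract p q = Fract p' q' \<and> y = Fract (D p' * q' - p' * D q') (q' * q')"
  then obtain p' q' where *: "q' \<noteq> 0" "Fract p q = Fract p' q'" "y = Fract (D p' * q' - p' * D q') (q' * q')"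
    by blast
  then have eq: "p * q' = p' * q" using assms by (simp add: eq_fract)
  then have "D p * q' + p * D q' = D p' * q + p' * D q" using mult by metis
  then have D: "D p * q' = D p' * q + p' * D q - p * D q'" by (simp add: eq_diff_eq)
  have "(D p * q - p * D q) * (q' * q') = (D p * q') * (q * q') - (p * q') * (D q * q')"
    by (simp add: algebra_simps)
  also have "\<dots> = (D p' * q + p' * D q) * (q * q') - (p * q') * (q * D q' + D q * q')"
    unfolding D by (simp add: algebra_simps)
  also have "\<dots> = (D p' * q' - p' * D q') * (q * q)"
    unfolding eq by (simp add: algebra_simps)
  finally have "(D p' * q' - p' * D q') * (q * q) = (D p * q - p * D q) * (q' * q')" by simp
  then show "y = Fract (D p * q - p * D q) (q * q)" using assms * by (simp add: eq_fract)
qed (use assms in blast)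

lemma fract_deriv_add: "fract_deriv D (x + y) = fract_deriv D x + fract_deriv D y"
proof -
  obtain p q where x: "x = Fract p q" "q \<noteq> 0" by (cases x) auto
  obtain p' q' where y: "y = Fract p' q'" "q' \<noteq> 0" by (cases y) auto
  show ?thesis
    using x y by (simp add: fract_deriv_Fract eq_fract add mult) (simp add: algebra_simps)
qed

lemma fract_deriv_mult: "fract_deriv D (x * y) = fract_deriv D x * y + x * fract_deriv D y"
proof -
  obtain p q where x: "x = Fract p q" "q \<noteq> 0" by (cases x) auto
  obtain p' q' where y: "y = Fract p' q'" "q' \<noteq> 0" by (cases y) auto
  show ?thesis
    using x y by (simp add: fract_deriv_Fract eq_fract add mult) (simp add: algebra_simps)
qed

lemma fract_deriv_poly: "fract_deriv D (Fract p 1) = Fract (D p) 1"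
proof -
  have "D 1 = 0" by (rule double_eq_zero) (use mult[of 1 1] in simp)
  then show ?thesis by (simp add: fract_deriv_Fract)
qed

end

definition rderiv :: "var \<Rightarrow> 'a::field rat_fun \<Rightarrow> 'a rat_fun" where
  "rderiv v = fract_deriv (mderiv v)"

lemma rderiv_add: "rderiv v (x + y) = rderiv v x + rderiv v y"
  and rderiv_mult: "rderiv v (x * y) = rderiv v x * y + x * rderiv v y"
  and rderiv_poly: "rderiv v (Fract p 1) = Fract (mderiv v p) 1"
  unfolding rderiv_def
  by (rule fract_deriv_add[where D = "mderiv v", OF mderiv_add mderiv_mult]
      fract_deriv_mult[where D = "mderiv v", OF mderiv_add mderiv_mult]
      fract_deriv_poly[where D = "mderiv v", OF mderiv_add mderiv_mult])+

lemma rderiv_0 [simp]: "rderiv v 0 = 0"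
  by (rule double_eq_zero) (use rderiv_add[of v 0 0] in simp)

lemma rderiv_1 [simp]: "rderiv v 1 = 0"
  by (rule double_eq_zero) (use rderiv_mult[of v 1 1] in simp)

lemma rderiv_minus: "rderiv v (- x) = - rderiv v x"
  using rderiv_add[of v x "- x"] by (simp add: eq_neg_iff_add_eq_0 add.commute)

lemma rderiv_sum: "rderiv v (sum f A) = (\<Sum>a\<in>A. rderiv v (f a))"
  by (induction A rule: infinite_finite_induct) (auto simp: rderiv_add)

lemma rderiv_const: "rderiv v (rat_const a) = 0"
  by (simp add: rat_const_def rderiv_poly mderiv_single Zero_fract_def)

lemma rderiv_var: "rderiv v (rat_var w) = (if v = w then 1 else 0)"
  by (auto simp: rat_var_def rderiv_poly mderiv_single lookup_single Zero_fract_def One_fract_def)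

lemma rderiv_sign: "rderiv v (shuffle_sign S T * x) = shuffle_sign S T * rderiv v (x :: 'a::field rat_fun)"
  using shuffle_sign_cases[of S T, where 'k = "'a rat_fun"] by (auto simp: rderiv_minus)

lemma rderiv_sign_mult:
  "rderiv v (shuffle_sign S T * x * y) = shuffle_sign S T * rderiv v x * y + shuffle_sign S T * x * rderiv v y"
proof -
  have "rderiv v (shuffle_sign S T * (x * y)) = shuffle_sign S T * rderiv v (x * y)"
    by (rule rderiv_sign)
  then show ?thesis by (simp add: rderiv_mult mult.assoc distrib_left)
qed

lift_definition even_deriv :: "var \<Rightarrow> 'a::field sfun \<Rightarrow> 'a sfun" is "\<lambda>v f S. rderiv v (f S)"
proof (intro conjI allI impI)
  fix v and f :: "var set \<Rightarrow> 'a rat_fun"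
  assume f: "finite {S. f S \<noteq> 0} \<and> (\<forall>S. f S \<noteq> 0 \<longrightarrow> finite S)"
  show "finite {S. rderiv v (f S) \<noteq> 0}"
    by (rule finite_subset[of _ "{S. f S \<noteq> 0}"]) (use f in auto)
  show "finite S" if "rderiv v (f S) \<noteq> 0" for S
    using that f by (cases "f S = 0") auto
qed

lemma gcoeff_even_deriv: "gcoeff (even_deriv v f) S = rderiv v (gcoeff f S)"
  by (simp add: even_deriv.rep_eq)

lemma even_deriv_mult: "even_deriv v (f * g) = even_deriv v f * g + f * even_deriv v g"
  by (rule grassmann_eqI)
     (simp add: gcoeff_even_deriv gcoeff_mult rderiv_sum rderiv_sign_mult sum.distrib)

text \<open>The left derivative: \<xi>_v is moved to the front and deleted, so the coefficient at S
  is that of \<xi>_v \<xi>_S, for v not in S.\<close>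

lift_definition odd_deriv :: "'v::linorder \<Rightarrow> ('v, 'k::comm_ring_1) grassmann \<Rightarrow> ('v, 'k) grassmann"
  is "\<lambda>v f S. if v \<in> S then 0 else shuffle_sign {v} S * f (insert v S)"
proof (intro conjI allI impI)
  fix v and f :: "'v set \<Rightarrow> 'k"
  assume f: "finite {S. f S \<noteq> 0} \<and> (\<forall>S. f S \<noteq> 0 \<longrightarrow> finite S)"
  let ?g = "\<lambda>S. if v \<in> S then 0 else shuffle_sign {v} S * f (insert v S)"
  have "{S. ?g S \<noteq> 0} \<subseteq> (\<lambda>S. S - {v}) ` {S. f S \<noteq> 0}"
  proof
    fix S assume "S \<in> {S. ?g S \<noteq> 0}"
    then have "v \<notin> S" "f (insert v S) \<noteq> 0" by (auto split: if_splits)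
    then show "S \<in> (\<lambda>S. S - {v}) ` {S. f S \<noteq> 0}"
      by (intro image_eqI[of _ _ "insert v S"]) auto
  qed
  then show "finite {S. ?g S \<noteq> 0}" by (rule finite_subset) (use f in simp)
  show "finite S" if "?g S \<noteq> 0" for S
  proof -
    have "f (insert v S) \<noteq> 0" using that by (auto split: if_splits)
    then show ?thesis using f by (metis finite_insert)
  qed
qed

lemma gcoeff_odd_deriv: "gcoeff (odd_deriv v f) S =
    (if v \<in> S then 0 else shuffle_sign {v} S * gcoeff f (insert v S))"
  by (simp add: odd_deriv.rep_eq)

definition gfree :: "'v \<Rightarrow> ('v, 'k::zero) grassmann \<Rightarrow> bool" where
  "gfree v f \<longleftrightarrow> (\<forall>S. v \<in> S \<longrightarrow> gcoeff f S = 0)"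

lemma gfree_add: "gfree v f \<Longrightarrow> gfree v g \<Longrightarrow> gfree v (f + g)"
  by (simp add: gfree_def)

lemma gfree_diff: "gfree v f \<Longrightarrow> gfree v g \<Longrightarrow> gfree v (f - g)"
  by (simp add: gfree_def)

lemma gfree_sum: "(\<And>a. a \<in> A \<Longrightarrow> gfree v (f a)) \<Longrightarrow> gfree v (sum f A)"
  by (simp add: gfree_def)

lemma gfree_ginv: "gfree v f \<Longrightarrow> gfree v (ginv b f)"
  by (simp add: gfree_def gcoeff_ginv)

lemma gfree_gscalar: "gfree v (gscalar c)"
  by (auto simp: gfree_def)

lemma gfree_ggen: "v \<noteq> w \<Longrightarrow> gfree v (ggen w)"
  by (auto simp: gfree_def)

lemma gfree_mult:
  assumes "gfree v f" "gfree v g"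
  shows "gfree v (f * g)"
  unfolding gfree_def
proof (intro allI impI, rule ccontr)
  fix S assume "v \<in> S" "gcoeff (f * g) S \<noteq> 0"
  then obtain T where "gcoeff f T \<noteq> 0" "gcoeff g (S - T) \<noteq> 0"
    using gcoeff_mult_nonzero by blast
  then have "v \<notin> T" "v \<notin> S - T" using assms by (auto simp: gfree_def)
  then show False using \<open>v \<in> S\<close> by simp
qed

lemma shuffle_sign_square: "shuffle_sign S T * (shuffle_sign S T * x) = (x :: 'k::comm_ring_1)"
  using shuffle_sign_cases[of S T, where 'k = 'k] by auto

lemma odd_deriv_add: "odd_deriv v (f + g) = odd_deriv v f + odd_deriv v g"
  by (rule grassmann_eqI) (simp add: gcoeff_odd_deriv distrib_left)

lemma odd_deriv_free: "gfree v f \<Longrightarrow> odd_deriv v f = 0"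
  by (rule grassmann_eqI) (simp add: gcoeff_odd_deriv gfree_def)

lemma gfree_odd_deriv: "gfree v (odd_deriv v f)"
  by (simp add: gfree_def gcoeff_odd_deriv)

lemma odd_deriv_ggen_mult: "gfree v f \<Longrightarrow> odd_deriv v (ggen v * f) = f"
  by (rule grassmann_eqI)
     (auto simp: gcoeff_odd_deriv gcoeff_ggen_mult gfree_def shuffle_sign_square)

text \<open>Every element is written with \<xi>_v in front of the terms that contain it. The Leibniz
  rule is then obtained by multiplying two such expressions and reading off the factor of
  \<xi>_v.\<close>

lemma odd_deriv_decomp:
  obtains f0 where "f = f0 + ggen v * odd_deriv v f" "gfree v f0"
proof -
  have "gfree v (f - ggen v * odd_deriv v f)"
    by (simp add: gfree_def gcoeff_odd_deriv gcoeff_ggen_mult shuffle_sign_square insert_absorb)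
  then show thesis using that[of "f - ggen v * odd_deriv v f"] by simp
qed

lemma odd_deriv_mult:
  fixes f g :: "('v::linorder, 'k::{comm_ring_1, ring_char_0, semiring_no_zero_divisors}) grassmann"
  shows "odd_deriv v (f * g) = odd_deriv v f * g + ginv True f * odd_deriv v g"
proof -
  let ?x = "ggen v :: ('v, 'k) grassmann"
  define f1 where "f1 = odd_deriv v f"
  define g1 where "g1 = odd_deriv v g"
  obtain f0 where f: "f = f0 + ?x * f1" "gfree v f0" using odd_deriv_decomp[of f v] f1_def by metis
  obtain g0 where g: "g = g0 + ?x * g1" "gfree v g0" using odd_deriv_decomp[of g v] g1_def by metis
  have free: "gfree v f1" "gfree v g1" by (simp_all add: f1_def g1_def gfree_odd_deriv)
  have comm: "h * ?x = ?x * ginv True h" for h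
    using supercommute[OF ghom_ggen, of v "ginv True h"] by simp
  \<comment> \<open>The second \<xi>_v is moved next to the first one, where their product is
    0.\<close>
  have sq: "?x * (h * (?x * k)) = 0" for h k
  proof -
    have "?x * (h * (?x * k)) = ?x * ?x * (ginv True h * k)"
      by (simp only: mult.assoc[symmetric] comm[of h])
    then show ?thesis by (simp add: odd_square_zero)
  qed
  have "f * g = f0 * g0 + ?x * (f1 * g0 + ginv True f0 * g1)"
    unfolding f(1) g(1) distrib_left distrib_right
    by (simp add: mult.assoc sq) (simp add: mult.assoc[symmetric] comm)
  then have "odd_deriv v (f * g) = f1 * g0 + ginv True f0 * g1"
    using f(2) g(2) free
    by (simp add: odd_deriv_add odd_deriv_free odd_deriv_ggen_mult gfree_mult gfree_add gfree_ginv)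
  moreover have "f1 * g + ginv True f * g1 = f1 * g0 + ginv True f0 * g1"
    unfolding f(1) g(1)
    by (simp add: distrib_left distrib_right ginv_add ginv_mult ginv_ghom[OF ghom_ggen] mult.assoc[symmetric] comm
        left_diff_distrib)
  ultimately show ?thesis by (simp add: f1_def g1_def)
qed

definition ediff :: "nat \<Rightarrow> var \<Rightarrow> 'a::field sfun \<Rightarrow> 'a sfun" where
  "ediff m v = (if even_var m v then even_deriv v else odd_deriv v)"

lemma even_deriv_add: "even_deriv v (f + g) = even_deriv v f + even_deriv v g"
  by (rule grassmann_eqI) (simp add: gcoeff_even_deriv rderiv_add)

lemma even_deriv_gscalar: "even_deriv v (gscalar c) = gscalar (rderiv v c)"
  by (rule grassmann_eqI) (simp add: gcoeff_even_deriv)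

lemma even_deriv_ggen: "even_deriv v (ggen w) = 0"
proof (rule grassmann_eqI)
  fix S
  show "gcoeff (even_deriv v (ggen w)) S = gcoeff (0 :: 'a sfun) S"
    by (simp add: gcoeff_even_deriv)
qed

lemma gfree_1: "gfree v 1"
  using gfree_gscalar[of v 1] by (simp add: gscalar_1)

lemma odd_deriv_ggen:
  "odd_deriv v (ggen w) = (if v = w then 1 else 0 :: ('v::linorder, 'k::comm_ring_1) grassmann)"
proof (cases "v = w")
  case True
  have "odd_deriv v (ggen v * (1 :: ('v, 'k) grassmann)) = 1"
    by (rule odd_deriv_ggen_mult[OF gfree_1])
  then show ?thesis using True by simp
qed (simp add: odd_deriv_free gfree_ggen)

lemma ediff_add: "ediff m v (f + g) = ediff m v f + ediff m v g"
  by (simp add: ediff_def even_deriv_add odd_deriv_add)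

lemma ediff_mult:
  fixes f g :: "'a::field_char_0 sfun"
  shows "ediff m v (f * g) = ediff m v f * g + ginv (\<not> even_var m v) f * ediff m v g"
  by (simp add: ediff_def even_deriv_mult odd_deriv_mult)

lemma ediff_const: "ediff m v (sconst a) = 0"
  by (simp add: ediff_def sconst_def even_deriv_gscalar rderiv_const odd_deriv_free gfree_gscalar)

lemma ediff_entry:
  "ediff m v (entry m t i j) = (if v = (t, i, j) then 1 else 0)"
  by (auto simp: ediff_def entry_alt even_deriv_gscalar even_deriv_ggen rderiv_var
      odd_deriv_ggen odd_deriv_free gfree_gscalar gscalar_1)

lemma ediff_ginv: "ginv c (ediff m v f) =
    (if c \<and> \<not> even_var m v then - ediff m v (ginv c f) else ediff m v (ginv c f))"
proof (rule grassmann_eqI)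
  fix S
  show "gcoeff (ginv c (ediff m v f)) S =
    gcoeff (if c \<and> \<not> even_var m v then - ediff m v (ginv c f) else ediff m v (ginv c f)) S"
    by (cases "finite S")
       (auto simp: ediff_def gcoeff_ginv gcoeff_even_deriv gcoeff_odd_deriv rderiv_minus gcoeff_infinite)
qed

lemma gfree_ediff:
  fixes f :: "'a::field sfun"
  shows "gfree w f \<Longrightarrow> gfree w (ediff m v f)"
  by (auto simp: gfree_def ediff_def gcoeff_even_deriv gcoeff_odd_deriv)

section \<open>Vector fields on the space of supermatrices\<close>

definition vfield :: "nat \<Rightarrow> nat \<Rightarrow> (nat \<Rightarrow> nat \<Rightarrow> 'a::field sfun) \<Rightarrow> 'a sfun \<Rightarrow> 'a sfun" where
  "vfield m n u f = (\<Sum>k = 1..m + n. \<Sum>l = 1..m + n. u k l * ediff m (1, k, l) f)"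

text \<open>The condition on the coefficients under which \<open>vfield\<close> is a superderivation
  of parity b.\<close>

definition vparity :: "nat \<Rightarrow> bool \<Rightarrow> (nat \<Rightarrow> nat \<Rightarrow> 'a::field sfun) \<Rightarrow> bool" where
  "vparity m b u \<longleftrightarrow> (\<forall>k l. ghom (((k \<le> m) \<noteq> (l \<le> m)) \<noteq> b) (u k l))"

lemma vfield_add: "vfield m n u (f + g) = vfield m n u f + vfield m n u g"
  by (simp add: vfield_def ediff_add distrib_left sum.distrib)

lemma vfield_const: "vfield m n u (sconst a) = 0"
  by (simp add: vfield_def ediff_const)

lemma vfield_entry:
  assumes "i \<in> {1..m + n}" "j \<in> {1..m + n}"
  shows "vfield m n u (entry m 1 i j) = u i j"
proof -
  have "vfield m n u (entry m 1 i j) =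
      (\<Sum>k = 1..m + n. \<Sum>l = 1..m + n. if k = i then (if l = j then u i j else 0) else 0)"
    unfolding vfield_def by (intro sum.cong refl) (auto simp: ediff_entry)
  also have "\<dots> = (\<Sum>k = 1..m + n. if k = i then u i j else 0)"
    using assms by (intro sum.cong refl) auto
  also have "\<dots> = u i j" using assms by simp
  finally show ?thesis .
qed

text \<open>Each summand is moved past f in two stages, the partial derivative and the coefficient
  \<open>u k l\<close>; the signs of both stages combine to \<open>ginv b f\<close>.\<close>

lemma vfield_mult:
  fixes f g :: "'a::field_char_0 sfun"
  assumes "vparity m b u"
  shows "vfield m n u (f * g) = vfield m n u f * g + ginv b f * vfield m n u g"
proof -
  have "u k l * ediff m (1, k, l) (f * g) =
      u k l * ediff m (1, k, l) f * g + ginv b f * (u k l * ediff m (1, k, l) g)" for k l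
  proof -
    let ?b = "(k \<le> m) \<noteq> (l \<le> m)"
    have "ghom (?b \<noteq> b) (u k l)" using assms by (simp add: vparity_def)
    from supercommute[OF this, of "ginv ?b f"]
    have "u k l * ginv ?b f = ginv b f * u k l"
      by (cases ?b; cases b) simp_all
    then have "u k l * (ginv ?b f * h) = ginv b f * (u k l * h)" for h
      by (simp only: mult.assoc[symmetric])
    moreover have "(\<not> even_var m (1, k, l)) = ?b" by (auto simp: even_var_def)
    ultimately show ?thesis
      by (simp add: ediff_mult distrib_left mult.assoc)
  qed
  then show ?thesis
    by (simp add: vfield_def sum.distrib sum_distrib_left sum_distrib_right)
qed

lemma vfield_ginv:
  fixes f :: "'a::field sfun"
  assumes "vparity m b u"
  shows "ginv c (vfield m n u f) = (if c \<and> b then - vfield m n u (ginv c f) else vfield m n u (ginv c f))"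
proof -
  have "ginv c (u k l * ediff m (1, k, l) f) =
      (if c \<and> b then - (u k l * ediff m (1, k, l) (ginv c f)) else u k l * ediff m (1, k, l) (ginv c f))" for k l
  proof -
    have "ghom (((k \<le> m) \<noteq> (l \<le> m)) \<noteq> b) (u k l)" using assms by (simp add: vparity_def)
    from ginv_ghom[OF this, of c] show ?thesis
      by (auto simp: ginv_mult ediff_ginv even_var_def)
  qed
  then show ?thesis
    by (auto simp: vfield_def ginv_sum sum_negf)
qed

lemma gfree_vfield:
  fixes f :: "'a::field sfun"
  assumes "\<And>k l. k \<in> {1..m + n} \<Longrightarrow> l \<in> {1..m + n} \<Longrightarrow> gfree v (u k l)" "gfree v f"
  shows "gfree v (vfield m n u f)"
  unfolding vfield_def using assms by (intro gfree_sum gfree_mult gfree_ediff) auto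

section \<open>Polarization operators and the Casimir element\<close>

abbreviation par :: "nat \<Rightarrow> nat \<Rightarrow> nat \<Rightarrow> bool" where
  "par m i j \<equiv> (i \<le> m) \<noteq> (j \<le> m)"

text \<open>\<open>Mop\<close> is the derivation induced by left translations by \<open>1 + \<theta> E\<^sub>b\<^sub>a\<close>, with the indices
  exchanged so that \<open>Mop a b\<close> represents the matrix unit \<open>E\<^sub>a\<^sub>b\<close>; \<open>Rop i j\<close> is the right
  superderivation induced by right translations by \<open>1 + \<theta> E\<^sub>i\<^sub>j\<close>. With a derivation on one side
  and a right derivation on the other, neither involves signs on the generators.\<close>

definition Mop :: "nat \<Rightarrow> nat \<Rightarrow> nat \<Rightarrow> nat \<Rightarrow> 'a::field sfun \<Rightarrow> 'a sfun" where
  "Mop m n a b = vfield m n (\<lambda>k l. if k = b then entry m 1 a l else 0)"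

definition Rop :: "nat \<Rightarrow> nat \<Rightarrow> nat \<Rightarrow> nat \<Rightarrow> 'a::field sfun \<Rightarrow> 'a sfun" where
  "Rop m n i j f =
    (let D = vfield m n (\<lambda>k l. if l = j then if par m i j \<and> \<not> par m k l then - entry m 1 k i
       else entry m 1 k i else 0)
     in if par m i j then - D (ginv True f) else D f)"

lemma ghom_entry_iff: "(par m i j \<longleftrightarrow> b) \<Longrightarrow> ghom b (entry m t i j)"
  using ghom_entry'[of i m j t] by simp

lemma Mop_parity: "vparity m (par m a b) (\<lambda>k l. if k = b then entry m 1 a l else 0)"
  unfolding vparity_def by (auto intro!: ghom_entry_iff)

lemma Rop_parity: "vparity m (par m i j) (\<lambda>k l. if l = j then if par m i j \<and> \<not> par m k l
    then - entry m 1 k i else entry m 1 k i else 0)"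
  unfolding vparity_def by (auto intro!: ghom_entry_iff ghom_minus)

lemma Mop_add: "Mop m n a b (f + g) = Mop m n a b f + Mop m n a b g"
  and Mop_const: "Mop m n a b (sconst c) = 0"
  by (simp_all add: Mop_def vfield_add vfield_const)

lemma Mop_0 [simp]: "Mop m n a b 0 = 0"
  using Mop_const[of m n a b 0] by simp

lemma Mop_minus: "Mop m n a b (- f) = - Mop m n a b f"
  using Mop_add[of m n a b f "- f"] by (simp add: eq_neg_iff_add_eq_0 add.commute)

lemma Mop_diff: "Mop m n a b (f - g) = Mop m n a b f - Mop m n a b g"
  using Mop_add[of m n a b "f - g" g] by (simp add: algebra_simps)

lemma Mop_mult: "Mop m n a b (f * g) = Mop m n a b f * g + ginv (par m a b) f * Mop m n a b g"
  for f g :: "'a::field_char_0 sfun"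
  unfolding Mop_def by (rule vfield_mult[OF Mop_parity])

lemma Mop_entry: "x \<in> {1..m + n} \<Longrightarrow> y \<in> {1..m + n} \<Longrightarrow>
    Mop m n a b (entry m 1 x y) = (if x = b then entry m 1 a y else 0)"
  unfolding Mop_def by (simp only: vfield_entry)

lemma Mop_ginv: "ginv c (Mop m n a b f) =
    (if c \<and> par m a b then - Mop m n a b (ginv c f) else Mop m n a b (ginv c f))"
  unfolding Mop_def by (rule vfield_ginv[OF Mop_parity])

lemma vfield_minus: "vfield m n u (- f) = - vfield m n u f"
proof -
  have "vfield m n u 0 = 0" using vfield_const[of m n u 0] by simp
  then show ?thesis using vfield_add[of m n u f "- f"]
    by (simp add: eq_neg_iff_add_eq_0 add.commute)
qed

lemma Rop_add: "Rop m n i j (f + g) = Rop m n i j f + Rop m n i j g"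
  by (simp add: Rop_def Let_def vfield_add ginv_add)

lemma ginv_const [simp]: "ginv b (sconst c) = sconst c"
  by (simp add: sconst_def)

lemma Rop_const: "Rop m n i j (sconst c) = 0"
  by (simp add: Rop_def Let_def vfield_const)

lemma Rop_0 [simp]: "Rop m n i j 0 = 0"
  using Rop_const[of m n i j 0] by simp

lemma Rop_ginv: "ginv c (Rop m n i j f) =
    (if c \<and> par m i j then - Rop m n i j (ginv c f) else Rop m n i j (ginv c f))"
  by (cases "par m i j"; cases c)
     (simp_all add: Rop_def Let_def ginv_minus vfield_ginv[OF Rop_parity])

text \<open>Preceding an odd superderivation by the parity automorphism turns the left Leibniz rule
  into the right one, in which the sign falls on the second factor.\<close>

lemma Rop_mult: "Rop m n i j (f * g) = f * Rop m n i j g + Rop m n i j f * ginv (par m i j) g"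
  for f g :: "'a::field_char_0 sfun"
  by (cases "par m i j")
     (simp_all add: Rop_def Let_def ginv_mult vfield_mult[OF Rop_parity])

lemma ginv_entry: "ginv b (entry m t x y) = (if b \<and> par m x y then - entry m t x y else entry m t x y)"
  by (rule ginv_ghom) (rule ghom_entry')

text \<open>For odd (i, j) the leading minus sign of \<open>Rop\<close> cancels against
  \<open>ginv\<close> on odd entries and against the sign of the coefficient on even entries, so no
  sign remains.\<close>

lemma Rop_entry:
  assumes "x \<in> {1..m + n}" "y \<in> {1..m + n}"
  shows "Rop m n i j (entry m 1 x y) = (if y = j then entry m 1 x i else 0 :: 'a::field sfun)"
proof -
  have "vfield m n u (if P then - entry m 1 x y else entry m 1 x y) = (if P then - u x y else u x y)"
    for u :: "nat \<Rightarrow> nat \<Rightarrow> 'a sfun" and P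
    by (simp add: vfield_minus vfield_entry[OF assms] del: One_nat_def)
  then show ?thesis unfolding Rop_def Let_def ginv_entry vfield_entry[OF assms] by (simp del: One_nat_def)
qed

text \<open>For f in the localization choose a power d of the determinant with d f in A(m|n); then 0
  = D(d f) = d D(f), and d can be cancelled. Operator identities on F[G] are proved by this lemma:
  the difference of both sides obeys the Leibniz rule and only its values on entries have to be
  computed.\<close>

lemma derivation_zero:
  fixes D :: "'a::field_char_0 sfun \<Rightarrow> 'a sfun"
  assumes add: "\<And>f g. D (f + g) = D f + D g"
    and mult: "\<And>f g. D (f * g) = D f * g + ginv b f * D g"
    and const: "\<And>a. D (sconst a) = 0"
    and entry: "\<And>x y. x \<in> {1..m + n} \<Longrightarrow> y \<in> {1..m + n} \<Longrightarrow> D (entry m 1 x y) = 0"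
    and f: "f \<in> coord_alg m n"
  shows "D f = 0"
proof -
  have mat: "D g = 0" if "g \<in> mat_alg m n {1}" for g
    using that by induction (simp_all add: add mult const entry[unfolded One_nat_def])
  obtain k where k: "det_prod m n {1} ^ k * f \<in> mat_alg m n {1}"
    using f by (auto simp: coord_alg_def loc_alg_iff)
  have "D (det_prod m n {1} ^ k) = 0"
    by (rule mat) (rule mat_alg_power[OF det_prod_mat_alg[OF order_refl]])
  then have "det_prod m n {1} ^ k * D f = det_prod m n {1} ^ k * 0"
    using mat[OF k] by (simp add: mult) (simp add: det_prod_power)
  then show ?thesis using det_prod_cancel[of "{1}" m n k "D f" 0] by simp
qed

text \<open>The sign (-1)^|a| in the supertrace form, which defines the quadratic Casimir
  element.\<close>

definition sg :: "nat \<Rightarrow> nat \<Rightarrow> 'b::ring_1" where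
  "sg m a = (if a \<le> m then 1 else - 1)"

text \<open>The relations of gl(m|n). A supercommutator of superderivations is a superderivation, so
  it suffices to compare both sides on entries.\<close>

lemma Mop_commute:
  fixes f :: "'a::field_char_0 sfun"
  assumes r: "a \<in> {1..m + n}" "b \<in> {1..m + n}" "c \<in> {1..m + n}" "d \<in> {1..m + n}"
    and f: "f \<in> coord_alg m n"
  shows "Mop m n a b (Mop m n c d f) =
    (if par m a b \<and> par m c d then - 1 else 1) * Mop m n c d (Mop m n a b f) +
    (if b = c then Mop m n a d f else 0) -
    (if a = d then (if par m a b \<and> par m c d then - 1 else 1) * Mop m n c b f else 0)"
proof -
  let ?z = "(if par m a b \<and> par m c d then - 1 else 1) :: 'a sfun"
  define K where "K f = Mop m n a b (Mop m n c d f) - ?z * Mop m n c d (Mop m n a b f) -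
    (if b = c then Mop m n a d f else 0) + (if a = d then ?z * Mop m n c b f else 0)" for f
  have "K f = 0"
  proof (rule derivation_zero[OF _ _ _ _ f, of K "par m a b \<noteq> par m c d"])
    show "K (f + g) = K f + K g" for f g
      by (simp add: K_def Mop_add distrib_left)
    show "K (sconst c) = 0" for c by (simp add: K_def Mop_const)
    show "K (entry m 1 x y) = 0" if "x \<in> {1..m + n}" "y \<in> {1..m + n}" for x y
      using r that by (auto simp: K_def Mop_entry simp del: One_nat_def)
    show "K (f * g) = K f * g + ginv (par m a b \<noteq> par m c d) f * K g" for f g
      by (cases "a \<le> m"; cases "b \<le> m"; cases "c \<le> m"; cases "d \<le> m")
         (auto simp: K_def Mop_mult Mop_add Mop_ginv Mop_minus algebra_simps)
  qed
  then show ?thesis by (simp add: K_def algebra_simps)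
qed

section \<open>The quadratic Casimir operators of both actions\<close>

definition left_casimir :: "nat \<Rightarrow> nat \<Rightarrow> 'a::field sfun \<Rightarrow> 'a sfun" where
  "left_casimir m n f = (\<Sum>a = 1..m + n. \<Sum>b = 1..m + n. sg m b * Mop m n a b (Mop m n b a f))"

definition right_casimir :: "nat \<Rightarrow> nat \<Rightarrow> 'a::field sfun \<Rightarrow> 'a sfun" where
  "right_casimir m n f = (\<Sum>i = 1..m + n. \<Sum>j = 1..m + n. sg m j * Rop m n i j (Rop m n j i f))"

lemma sg_left_commute: "f * (sg m a * g) = sg m a * (f * g)" for f g :: "'b::ring_1"
  by (simp add: sg_def)

lemma sum_delta_1:
  fixes g :: "nat \<Rightarrow> nat \<Rightarrow> 'b::comm_monoid_add"
  shows "finite A \<Longrightarrow> x \<in> A \<Longrightarrow> (\<Sum>a\<in>A. \<Sum>b\<in>B. if a = x then g a b else 0) = (\<Sum>b\<in>B. g x b)"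
  by (subst sum.swap) simp

lemma sum_delta_2:
  fixes g :: "nat \<Rightarrow> nat \<Rightarrow> 'b::comm_monoid_add"
  shows "finite A \<Longrightarrow> x \<in> A \<Longrightarrow> (\<Sum>a\<in>B. \<Sum>b\<in>A. if b = x then g a b else 0) = (\<Sum>a\<in>B. g a x)"
  by simp

context
  fixes m n x y :: nat
  assumes xy: "x \<in> {1..m + n}" "y \<in> {1..m + n}"
begin

text \<open>The mixed terms of the quadratic operator on a product c_xy h: one operator acts on
  c_xy, the other on h. They arise twice, once for each order of the two operators, which explains
  the factor 2 below.\<close>

definition lcross :: "'a::field sfun \<Rightarrow> 'a sfun" where
  "lcross h = (\<Sum>a = 1..m + n. sg m a * (ginv (par m x a) (entry m 1 a y) * Mop m n x a h))"

definition rcross :: "'a::field sfun \<Rightarrow> 'a sfun" where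
  "rcross h = (\<Sum>i = 1..m + n. sg m y * (entry m 1 x i * ginv (par m i y) (Rop m n y i h)))"

text \<open>Both sides are superderivations in h of the parity of c_xy. On h = c_kl both are, up to
  sign, the product of c_ky and c_xl, and supercommutativity of these two entries reconciles the
  signs.\<close>

lemma lcross_eq_rcross:
  fixes h :: "'a::field_char_0 sfun"
  assumes h: "h \<in> coord_alg m n"
  shows "lcross h = rcross h"
proof -
  define K :: "'a sfun \<Rightarrow> 'a sfun" where "K h = lcross h - rcross h" for h
  have "K h = 0"
  proof (rule derivation_zero[OF _ _ _ _ h, of K "par m x y"])
    show "K (f + g) = K f + K g" for f g
      by (simp add: K_def lcross_def rcross_def Mop_add Rop_add ginv_add distrib_left sum.distrib)
    show "K (sconst c) = 0" for c
      by (simp add: K_def lcross_def rcross_def Mop_const Rop_const)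
    show "K (entry m 1 k l) = 0" if kl: "k \<in> {1..m + n}" "l \<in> {1..m + n}" for k l
    proof -
      have "lcross (entry m 1 k l :: 'a sfun) = (\<Sum>a = 1..m + n. if a = k
          then sg m k * (ginv (par m x k) (entry m 1 k y) * entry m 1 x l) else 0)"
        unfolding lcross_def by (rule sum.cong) (auto simp: Mop_entry[OF kl] simp del: One_nat_def)
      moreover have "rcross (entry m 1 k l :: 'a sfun) = (\<Sum>i = 1..m + n. if i = l
          then sg m y * (entry m 1 x l * ginv (par m l y) (entry m 1 k y)) else 0)"
        unfolding rcross_def by (rule sum.cong) (auto simp: Rop_entry[OF kl] simp del: One_nat_def)
      moreover have "entry m 1 x l * entry m 1 k y =
          (if par m x l \<and> par m k y then - (entry m 1 k y * entry m 1 x l) else entry m 1 k y * entry m 1 x l :: 'a sfun)"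
        using supercommute[OF ghom_entry'[of x m l 1], of "entry m 1 k y :: 'a sfun"]
        by (simp add: ginv_entry del: One_nat_def)
      ultimately show ?thesis
        using kl by (cases "x \<le> m"; cases "k \<le> m"; cases "l \<le> m"; cases "y \<le> m")
          (simp_all add: K_def ginv_entry sg_def del: One_nat_def)
    qed
    show "K (f * g) = K f * g + ginv (par m x y) f * K g" for f g
    proof -
      have l: "ginv (par m x a) (entry m 1 a y) * Mop m n x a (f * g) =
          ginv (par m x a) (entry m 1 a y) * Mop m n x a f * g +
          ginv (par m x y) f * (ginv (par m x a) (entry m 1 a y) * Mop m n x a g)" for a
      proof -
        have "ginv (par m x a) (entry m 1 a y) * ginv (par m x a) f =
            ginv (par m a y) (ginv (par m x a) f) * ginv (par m x a) (entry m 1 a y)"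
          by (rule supercommute[OF ghom_ginv[OF ghom_entry']])
        also have "ginv (par m a y) (ginv (par m x a) f) = ginv (par m x y) f"
          by (cases "x \<le> m"; cases "a \<le> m"; cases "y \<le> m") simp_all
        finally have "ginv (par m x a) (entry m 1 a y) * (ginv (par m x a) f * k) =
            ginv (par m x y) f * (ginv (par m x a) (entry m 1 a y) * k)" for k
          by (simp only: mult.assoc[symmetric])
        then show ?thesis by (simp only: Mop_mult distrib_left mult.assoc)
      qed
      have r: "entry m 1 x i * ginv (par m i y) (Rop m n y i (f * g)) =
          entry m 1 x i * ginv (par m i y) (Rop m n y i f) * g +
          ginv (par m x y) f * (entry m 1 x i * ginv (par m i y) (Rop m n y i g))" for i
      proof -
        have "entry m 1 x i * ginv (par m i y) f = ginv (par m x i) (ginv (par m i y) f) * entry m 1 x i"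
          by (rule supercommute[OF ghom_entry'])
        also have "ginv (par m x i) (ginv (par m i y) f) = ginv (par m x y) f"
          by (cases "x \<le> m"; cases "i \<le> m"; cases "y \<le> m") simp_all
        finally have "entry m 1 x i * (ginv (par m i y) f * k) = ginv (par m x y) f * (entry m 1 x i * k)" for k
          by (simp only: mult.assoc[symmetric])
        moreover have "ginv (par m i y) (ginv (par m y i) g) = g"
          by (cases "y \<le> m"; cases "i \<le> m") simp_all
        ultimately show ?thesis
          by (simp only: Rop_mult ginv_add ginv_mult distrib_left mult.assoc add.commute)
      qed
      have "lcross (f * g) = lcross f * g + ginv (par m x y) f * lcross g"
        unfolding lcross_def l by (simp add: distrib_left sum.distrib sum_distrib_left sum_distrib_right
            sg_left_commute mult.assoc)
      moreover have "rcross (f * g) = rcross f * g + ginv (par m x y) f * rcross g"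
        unfolding rcross_def r by (simp add: distrib_left sum.distrib sum_distrib_left sum_distrib_right
            sg_left_commute mult.assoc)
      ultimately show ?thesis by (simp add: K_def algebra_simps)
    qed
  qed
  then show ?thesis by (simp add: K_def)
qed

text \<open>The coefficient, m - n, is the eigenvalue on a single entry. The right action has the
  same coefficient, so by \<open>lcross_eq_rcross\<close> the difference of the two operators
  commutes with multiplication by entries.\<close>

lemma left_casimir_entry_mult:
  fixes h :: "'a::field_char_0 sfun"
  shows "left_casimir m n (entry m 1 x y * h) =
    (\<Sum>b = 1..m + n. sg m b) * (entry m 1 x y * h) + entry m 1 x y * left_casimir m n h + 2 * lcross h"
proof -
  let ?c = "\<lambda>x y. entry m 1 x y :: 'a sfun"
  \<comment> \<open>The four terms: both operators act on c_xy, only the inner one, only the outer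
    one, neither.\<close>
  have summand: "sg m b * Mop m n a b (Mop m n b a (?c x y * h)) =
      (if a = x then sg m b * (?c x y * h) else 0) +
      (if a = x then sg m b * (ginv (par m x b) (?c b y) * Mop m n x b h) else 0) +
      (if b = x then sg m a * (ginv (par m x a) (?c a y) * Mop m n x a h) else 0) +
      ?c x y * (sg m b * Mop m n a b (Mop m n b a h))"
    if "a \<in> {1..m + n}" "b \<in> {1..m + n}" for a b
    using that xy
    by (cases "x \<le> m"; cases "a \<le> m"; cases "b \<le> m"; cases "y \<le> m")
       (auto simp: Mop_mult Mop_add Mop_diff Mop_entry Mop_minus ginv_entry sg_def distrib_left simp del: One_nat_def)
  have "left_casimir m n (?c x y * h) = (\<Sum>a = 1..m + n. \<Sum>b = 1..m + n.
      (if a = x then sg m b * (?c x y * h) else 0) +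
      (if a = x then sg m b * (ginv (par m x b) (?c b y) * Mop m n x b h) else 0) +
      (if b = x then sg m a * (ginv (par m x a) (?c a y) * Mop m n x a h) else 0) +
      ?c x y * (sg m b * Mop m n a b (Mop m n b a h)))"
    unfolding left_casimir_def by (intro sum.cong refl summand)
  also have "\<dots> = (\<Sum>b = 1..m + n. sg m b * (?c x y * h)) + lcross h + lcross h + ?c x y * left_casimir m n h"
    unfolding sum.distrib sum_delta_1[OF finite_atLeastAtMost xy(1)] sum_delta_2[OF finite_atLeastAtMost xy(1)]
    by (simp only: lcross_def left_casimir_def sum_distrib_left)
  also have "\<dots> = (\<Sum>b = 1..m + n. sg m b) * (?c x y * h) + ?c x y * left_casimir m n h + 2 * lcross h"
    by (simp add: sum_distrib_right mult_2 add_ac)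
  finally show ?thesis .
qed

lemma right_casimir_entry_mult:
  fixes h :: "'a::field_char_0 sfun"
  shows "right_casimir m n (entry m 1 x y * h) =
    (\<Sum>b = 1..m + n. sg m b) * (entry m 1 x y * h) + entry m 1 x y * right_casimir m n h + 2 * rcross h"
proof -
  let ?c = "\<lambda>x y. entry m 1 x y :: 'a sfun"
  have summand: "sg m j * Rop m n i j (Rop m n j i (?c x y * h)) =
      ?c x y * (sg m j * Rop m n i j (Rop m n j i h)) +
      (if j = y then sg m y * (?c x i * ginv (par m i y) (Rop m n y i h)) else 0) +
      (if i = y then sg m y * (?c x j * ginv (par m j y) (Rop m n y j h)) else 0) +
      (if i = y then sg m j * (?c x y * h) else 0)"
    if "i \<in> {1..m + n}" "j \<in> {1..m + n}" for i j
    using that xy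
    by (cases "x \<le> m"; cases "i \<le> m"; cases "j \<le> m"; cases "y \<le> m")
       (auto simp: Rop_mult Rop_add Rop_entry Rop_ginv ginv_entry sg_def distrib_left simp del: One_nat_def)
  have "right_casimir m n (?c x y * h) = (\<Sum>i = 1..m + n. \<Sum>j = 1..m + n.
      ?c x y * (sg m j * Rop m n i j (Rop m n j i h)) +
      (if j = y then sg m y * (?c x i * ginv (par m i y) (Rop m n y i h)) else 0) +
      (if i = y then sg m y * (?c x j * ginv (par m j y) (Rop m n y j h)) else 0) +
      (if i = y then sg m j * (?c x y * h) else 0))"
    unfolding right_casimir_def by (intro sum.cong refl summand)
  also have "\<dots> = ?c x y * right_casimir m n h + rcross h + rcross h + (\<Sum>b = 1..m + n. sg m b * (?c x y * h))"
    unfolding sum.distrib sum_delta_1[OF finite_atLeastAtMost xy(2)] sum_delta_2[OF finite_atLeastAtMost xy(2)]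
    by (simp only: rcross_def right_casimir_def sum_distrib_left)
  also have "\<dots> = (\<Sum>b = 1..m + n. sg m b) * (?c x y * h) + ?c x y * right_casimir m n h + 2 * rcross h"
    by (simp add: sum_distrib_right mult_2 add_ac)
  finally show ?thesis .
qed

end

lemma casimir_add:
  "left_casimir m n (f + g) = left_casimir m n f + left_casimir m n g"
  "right_casimir m n (f + g) = right_casimir m n f + right_casimir m n g"
  by (simp_all add: left_casimir_def right_casimir_def Mop_add Rop_add distrib_left sum.distrib)

lemma casimir_const_mult:
  fixes f :: "'a::field_char_0 sfun"
  shows "left_casimir m n (sconst c * f) = sconst c * left_casimir m n f"
    and "right_casimir m n (sconst c * f) = sconst c * right_casimir m n f"
  by (simp_all add: left_casimir_def right_casimir_def Mop_mult Rop_mult Mop_const Rop_const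
      sg_left_commute sum_distrib_left)

lemma coord_alg_mult: "f \<in> coord_alg m n \<Longrightarrow> g \<in> coord_alg m n \<Longrightarrow> f * g \<in> coord_alg m n"
  unfolding coord_alg_def by (rule loc_alg_mult)

text \<open>The difference of the two Casimir operators is linear over \<open>F[G]\<close> and annihilates 1.\<close>

theorem left_casimir_eq_right_casimir:
  fixes f :: "'a::field_char_0 sfun"
  assumes f: "f \<in> coord_alg m n"
  shows "left_casimir m n f = right_casimir m n f"
proof -
  define X where "X f = left_casimir m n f - right_casimir m n f" for f :: "'a sfun"
  have add: "X (f + g) = X f + X g" for f g by (simp add: X_def casimir_add)
  have linear: "X (g * h) = g * X h" if "g \<in> mat_alg m n {1}" "h \<in> coord_alg m n" for g h
    using that
  proof (induction arbitrary: h rule: mat_alg.induct)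
    case (const a)
    then show ?case by (simp add: X_def casimir_const_mult right_diff_distrib)
  next
    case (entry t x y)
    then have "t = 1" by simp
    then show ?case
      using left_casimir_entry_mult[OF entry(2,3), of h] right_casimir_entry_mult[OF entry(2,3), of h]
        lcross_eq_rcross[OF entry(2,3,4)]
      by (simp add: X_def right_diff_distrib)
  next
    case (add f g)
    then show ?case by (simp add: distrib_right X_def casimir_add algebra_simps)
  next
    case (mult f g)
    have "g * h \<in> coord_alg m n" using coord_alg_mult mat_alg_coord mult by blast
    then show ?case using mult by (simp add: mult.assoc)
  qed
  have "1 \<in> coord_alg m n" using mat_alg_coord mat_alg_1 by blast
  moreover have "X 1 = 0"
  proof -
    have "Mop m n a b (1 :: 'a sfun) = 0" "Rop m n a b (1 :: 'a sfun) = 0" for a b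
      using Mop_const[of m n a b "1 :: 'a"] Rop_const[of m n a b "1 :: 'a"] by (simp_all add: sconst_1)
    then show ?thesis by (simp add: X_def left_casimir_def right_casimir_def)
  qed
  ultimately have mat: "X g = 0" if "g \<in> mat_alg m n {1}" for g
    using linear[OF that, of 1] by simp
  obtain k where k: "det_prod m n {1} ^ k * f \<in> mat_alg m n {1}"
    using f by (auto simp: coord_alg_def loc_alg_iff)
  have "det_prod m n {1} ^ k * X f = det_prod m n {1} ^ k * 0"
    using mat[OF k] linear[OF mat_alg_power[OF det_prod_mat_alg[OF order_refl]] f, of k] by simp
  then have "X f = 0" using det_prod_cancel[of "{1}" m n k "X f" 0] by simp
  then show ?thesis by (simp add: X_def)
qed

section \<open>Infinitesimal translations\<close>

text \<open>Excludes the generators that make up the infinitesimals; among such elements the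
  coefficients of an expansion in \<theta> are unique.\<close>

definition tfree :: "'a::field sfun \<Rightarrow> bool" where
  "tfree f \<longleftrightarrow> gfree (0, 0, 0) f \<and> gfree (0, 0, 1) f"

lemma tfree_add: "tfree f \<Longrightarrow> tfree g \<Longrightarrow> tfree (f + g)"
  and tfree_diff: "tfree f \<Longrightarrow> tfree g \<Longrightarrow> tfree (f - g)"
  and tfree_mult: "tfree f \<Longrightarrow> tfree g \<Longrightarrow> tfree (f * g)"
  and tfree_ginv: "tfree f \<Longrightarrow> tfree (ginv b f)"
  by (simp_all add: tfree_def gfree_add gfree_diff gfree_mult gfree_ginv)

lemma tfree_sconst: "tfree (sconst a)"
  by (simp add: tfree_def sconst_def gfree_gscalar)

lemma tfree_sum: "(\<And>a. a \<in> A \<Longrightarrow> tfree (f a)) \<Longrightarrow> tfree (sum f A)"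
  by (simp add: tfree_def gfree_sum)

lemma tfree_entry: "tfree (entry m 1 i j)"
  by (simp add: tfree_def entry_alt gfree_gscalar gfree_ggen)

lemma ggen_mult_eq_0:
  fixes f :: "('v::linorder, 'k::comm_ring_1) grassmann"
  assumes "gfree v f" "ggen v * f = 0"
  shows "f = 0"
proof -
  have "f = odd_deriv v (ggen v * f)" by (rule odd_deriv_ggen_mult[OF assms(1), symmetric])
  also have "\<dots> = 0" unfolding assms(2) by (rule odd_deriv_free) (simp add: gfree_def)
  finally show ?thesis .
qed

lemma theta_mult_eq_0:
  assumes f: "tfree f" and 0: "theta b * f = 0"
  shows "f = 0"
proof (cases b)
  case True
  then show ?thesis using f 0 ggen_mult_eq_0[of "(0, 0, 0)" f] by (simp add: tfree_def theta_def)
next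
  case False
  then have "ggen (0, 0, 0) * (ggen (0, 0, 1) * f) = 0" using 0 by (simp add: theta_def mult.assoc)
  moreover have "gfree (0, 0, 0) (ggen (0, 0, 1) * f)"
    using f by (intro gfree_mult gfree_ggen) (auto simp: tfree_def)
  ultimately have "ggen (0, 0, 1) * f = 0" using ggen_mult_eq_0 by blast
  then show ?thesis using f ggen_mult_eq_0 by (auto simp: tfree_def)
qed

text \<open>In either parity \<theta> starts with the generator \<open>(0, 0, 0)\<close>, so every
  term of \<theta> g contains it.\<close>

lemma tfree_eq_theta_mult:
  assumes "tfree f" "f = theta b * g"
  shows "f = 0"
proof (rule grassmann_eqI)
  fix S
  have eq: "f = ggen (0, 0, 0) * (if b then g else ggen (0, 0, 1) * g)"
    using assms(2) by (simp add: theta_def mult.assoc)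
  have "gcoeff f S = 0" if "(0, 0, 0) \<notin> S"
    by (subst eq) (simp only: gcoeff_ggen_mult that if_False)
  moreover have "gcoeff f S = 0" if "(0, 0, 0) \<in> S"
    using assms(1) that by (auto simp: tfree_def gfree_def)
  ultimately show "gcoeff f S = gcoeff 0 S" by auto
qed

lemma theta_decomp:
  assumes "tfree f" "tfree g" "tfree f'" "tfree g'" "f + theta b * g = f' + theta b * g'"
  shows "f = f' \<and> g = g'"
proof -
  have "f - f' = theta b * (g' - g)"
    using assms(5) by (simp add: algebra_simps)
  from tfree_eq_theta_mult[OF tfree_diff this] assms have "f - f' = 0" by blast
  then have "f = f'" by simp
  then have "theta b * (g' - g) = 0" using \<open>f - f' = theta b * (g' - g)\<close> by simp
  then have "g' - g = 0" using theta_mult_eq_0[OF tfree_diff] assms by blast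
  then show ?thesis using \<open>f = f'\<close> by simp
qed

lemma mult_theta: "f * theta b = theta b * ginv b (f :: 'a::field sfun)"
  using supercommute[OF ghom_theta, of b "ginv b f"] by simp

lemma theta_decomp_right:
  assumes "tfree f" "tfree g" "tfree f'" "tfree g'" "f + g * theta b = f' + g' * theta b"
  shows "f = f' \<and> g = g'"
proof -
  have "f = f' \<and> ginv b g = ginv b g'"
    using theta_decomp[of f "ginv b g" f' "ginv b g'" b] assms by (simp add: mult_theta tfree_ginv)
  moreover have "ginv b (ginv b g) = g" "ginv b (ginv b g') = g'" by simp_all
  ultimately show ?thesis by metis
qed

lemma det_prod_inv_free: "tfree (det_prod_inv m n T k)"
  by (simp add: tfree_def det_prod_inv_def gfree_gscalar)

lemma mat_alg_tfree: "f \<in> mat_alg m n {1} \<Longrightarrow> tfree f"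
  by (induction rule: mat_alg.induct) (auto intro: tfree_sconst tfree_add tfree_mult tfree_entry simp del: One_nat_def)

lemma coord_alg_tfree: "f \<in> coord_alg m n \<Longrightarrow> tfree f" for f :: "'a::field_char_0 sfun"
proof -
  assume "f \<in> coord_alg m n"
  then obtain k g where "g \<in> mat_alg m n {1}" "f = det_prod_inv m n {1} k * g"
    unfolding coord_alg_def using loc_alg_divide[of "{1}" f m n] by blast
  then show ?thesis by (simp add: tfree_mult det_prod_inv_free mat_alg_tfree del: One_nat_def)
qed

lemma tfree_vfield:
  assumes "\<And>k l. tfree (u k l)" "tfree f"
  shows "tfree (vfield m n u f)"
  using assms unfolding tfree_def by (blast intro: gfree_vfield)

lemma tfree_0: "tfree 0"
  using tfree_sconst[of 0] by simp

lemma tfree_minus: "tfree f \<Longrightarrow> tfree (- f)"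
  using tfree_diff[OF tfree_0] by fastforce

lemma tfree_Mop: "tfree f \<Longrightarrow> tfree (Mop m n a b f)"
  unfolding Mop_def by (rule tfree_vfield) (simp_all only: tfree_entry tfree_0 split: if_split, simp)

lemma tfree_Rop: "tfree f \<Longrightarrow> tfree (Rop m n i j f)"
proof -
  assume f: "tfree f"
  have "tfree (vfield m n (\<lambda>k l. if l = j then if par m i j \<and> \<not> par m k l then - entry m 1 k i
       else entry m 1 k i else 0) g)" if "tfree g" for g
    by (rule tfree_vfield[OF _ that]) (simp only: tfree_entry tfree_0 tfree_minus split: if_split, simp)
  from this[OF f] this[OF tfree_ginv[OF f, of True]] show ?thesis
    unfolding Rop_def Let_def by (simp only: tfree_minus split: if_split) simp
qed

section \<open>Infinitesimal translations as homomorphisms\<close>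

definition lhom :: "nat \<Rightarrow> nat \<Rightarrow> nat \<Rightarrow> nat \<Rightarrow> 'a::field sfun \<Rightarrow> 'a sfun" where
  "lhom m n a b f = f + theta (par m a b) * Mop m n a b f"

definition rhom :: "nat \<Rightarrow> nat \<Rightarrow> nat \<Rightarrow> nat \<Rightarrow> 'a::field sfun \<Rightarrow> 'a sfun" where
  "rhom m n i j f = f + Rop m n i j f * theta (par m i j)"

text \<open>The Leibniz rule says exactly that f + \<theta> D(f) is multiplicative in f: the second
  order term vanishes because of \<theta>^2 = 0, and moving \<theta> past f absorbs the
  sign.\<close>

lemma lhom_alg_hom: "alg_hom_on UNIV (lhom m n a b :: 'a::field_char_0 sfun \<Rightarrow> 'a sfun)"
proof -
  have mult: "lhom m n a b (f * g) = lhom m n a b f * lhom m n a b g" for f g :: "'a sfun"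
  proof -
    let ?t = "theta (par m a b) :: 'a sfun"
    have "?t * (ginv (par m a b) f * h) = f * (?t * h)" for h
      using mult_theta[of f "par m a b"] by (simp add: mult.assoc[symmetric])
    moreover have "?t * (h * (?t * k)) = 0" for h k
      using theta_square[of "par m a b" h] by (simp add: mult.assoc[symmetric])
    ultimately show ?thesis
      by (simp only: lhom_def Mop_mult distrib_left distrib_right mult.assoc add_ac add_0_right add_0_left mult_zero_right)
  qed
  have c: "lhom m n a b (sconst c) = sconst c" for c :: 'a by (simp add: lhom_def Mop_const)
  show ?thesis
    unfolding alg_hom_on_def sscale_def mult c
    using c[of 1] by (auto simp: lhom_def Mop_add distrib_left sconst_1)
qed

lemma rhom_alg_hom: "alg_hom_on UNIV (rhom m n i j :: 'a::field_char_0 sfun \<Rightarrow> 'a sfun)"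
proof -
  have mult: "rhom m n i j (f * g) = rhom m n i j f * rhom m n i j g" for f g :: "'a sfun"
  proof -
    let ?t = "theta (par m i j) :: 'a sfun"
    have "ginv (par m i j) g * ?t = ?t * g"
      using mult_theta[of "ginv (par m i j) g" "par m i j"] by simp
    moreover have "?t * (h * ?t) = 0" for h
      using theta_square[of "par m i j" h] by (simp add: mult.assoc[symmetric])
    ultimately show ?thesis
      by (simp only: rhom_def Rop_mult distrib_left distrib_right mult.assoc add_ac add_0_right add_0_left mult_zero_right)
  qed
  have c: "rhom m n i j (sconst c) = sconst c" for c :: 'a by (simp add: rhom_def Rop_const)
  show ?thesis
    unfolding alg_hom_on_def sscale_def mult c
    using c[of 1] by (auto simp: rhom_def Rop_add distrib_right sconst_1)
qed

lemma alg_hom_on_id: "alg_hom_on R (\<lambda>f. f)"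
  by (simp add: alg_hom_on_def)

lemma alg_hom_on_sum:
  assumes "alg_hom_on R \<phi>" "\<And>f g. f \<in> R \<Longrightarrow> g \<in> R \<Longrightarrow> f + g \<in> R" "0 \<in> R"
    and "\<And>a. a \<in> A \<Longrightarrow> f a \<in> R"
  shows "\<phi> (sum f A) = (\<Sum>a\<in>A. \<phi> (f a)) \<and> sum f A \<in> R"
proof -
  have "\<phi> (0 + 0) = \<phi> 0 + \<phi> 0" by (rule alg_hom_on_add[OF assms(1)]) (use assms in auto)
  then have "\<phi> 0 = 0" by simp
  then show ?thesis using assms(4)
    by (induction A rule: infinite_finite_induct)
       (auto simp: alg_hom_on_add[OF assms(1)] assms(2,3))
qed

lemma comult_mat_alg:
  fixes f :: "'a::field_char_0 sfun"
  assumes "f \<in> mat_alg m n {1}"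
  shows "comult m n f \<in> mat_alg m n {1, 2}"
proof (rule alg_hom_on_mat_alg_image[OF assms alg_hom_on_subset[OF comult_hom mat_alg_coord]])
  fix t i j assume t: "t \<in> {1::nat}" and ij: "i \<in> {1..m + n}" "j \<in> {1..m + n}"
  have "comult m n (entry m 1 i j :: 'a sfun) \<in> mat_alg m n {1, 2}"
    unfolding comult_entry[OF ij]
    by (intro mat_alg_sum mat_alg.mult mat_alg.entry) (use ij in auto)
  then show "comult m n (entry m t i j :: 'a sfun) \<in> mat_alg m n {1, 2}" using t by simp
qed (auto intro: mat_alg.intros)

text \<open>Since \<open>f\<close> is a quotient of an element of \<open>A(m|n)\<close> by an invertible one, it is not necessary to
  know that \<open>\<Delta>\<close> maps \<open>F[G]\<close> into \<open>F[G] \<otimes> F[G]\<close>.\<close>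

lemma comult_extend:
  fixes \<phi> \<psi> :: "'a::field_char_0 sfun \<Rightarrow> 'a sfun"
  assumes \<phi>: "alg_hom_on R \<phi>" and R: "mat_alg m n {1, 2} \<subseteq> R" and \<psi>: "alg_hom_on UNIV \<psi>"
    and entry: "\<And>i j. i \<in> {1..m + n} \<Longrightarrow> j \<in> {1..m + n} \<Longrightarrow>
      \<phi> (\<Sum>k = 1..m + n. entry m 1 i k * entry m 2 k j) = \<psi> (entry m 1 i j)"
    and f: "f \<in> coord_alg m n" "comult m n f \<in> R"
  shows "\<phi> (comult m n f) = \<psi> f"
proof -
  have comult_R: "comult m n g \<in> R" if "g \<in> mat_alg m n {1}" for g
    using comult_mat_alg[OF that] R by blast
  have "alg_hom_on (mat_alg m n {1}) (\<lambda>f. \<phi> (comult m n f))"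
    by (rule alg_hom_on_comp[OF alg_hom_on_subset[OF comult_hom mat_alg_coord] \<phi>])
       (use comult_R in auto)
  note eq = alg_hom_on_mat_alg_eq[OF _ this alg_hom_on_subset[OF \<psi> subset_UNIV]]
  have mat: "\<phi> (comult m n g) = \<psi> g" if "g \<in> mat_alg m n {1}" for g
    by (rule eq[OF that]) (simp_all add: entry comult_entry del: One_nat_def atLeastAtMost_iff)
  obtain k where k: "det_prod m n {1} ^ k * f \<in> mat_alg m n {1}"
    using f by (auto simp: coord_alg_def loc_alg_iff)
  let ?D = "det_prod m n {1} ^ k :: 'a sfun" and ?I = "det_prod_inv m n {1} k :: 'a sfun"
  have D: "?D \<in> mat_alg m n {1}" by (rule mat_alg_power[OF det_prod_mat_alg[OF order_refl]])
  have "\<phi> (comult m n ?D) * \<phi> (comult m n f) = \<phi> (comult m n ?D * comult m n f)"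
    by (rule alg_hom_on_mult[OF \<phi> comult_R[OF D] f(2), symmetric])
  also have "comult m n ?D * comult m n f = comult m n (?D * f)"
    using D mat_alg_coord by (intro alg_hom_on_mult[OF comult_hom _ f(1), symmetric]) blast
  also have "\<phi> \<dots> = \<psi> (?D * f)" by (rule mat[OF k])
  finally have "\<psi> ?D * \<phi> (comult m n f) = \<psi> ?D * \<psi> f"
    unfolding mat[OF D] by (simp add: alg_hom_on_mult[OF \<psi>])
  then have "(\<psi> ?I * \<psi> ?D) * \<phi> (comult m n f) = (\<psi> ?I * \<psi> ?D) * \<psi> f"
    by (simp only: mult.assoc)
  moreover have "\<psi> ?I * \<psi> ?D = \<psi> (?I * ?D)"
    by (rule alg_hom_on_mult[OF \<psi>, symmetric]) auto
  moreover have "?I * ?D = 1" by (rule det_prod_inv(2)) simp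
  ultimately show ?thesis by (simp add: alg_hom_on_1[OF \<psi>])
qed

text \<open>Since \<phi> is a homomorphism on \<open>mat_alg\<close> only, membership of all partial
  products is carried along while the determinant is expanded.\<close>

lemma alg_hom_on_det:
  fixes A B :: "'a::field rat_fun mat"
  assumes \<phi>: "alg_hom_on (mat_alg m n T) \<phi>" and A: "A \<in> carrier_mat k k" and B: "B \<in> carrier_mat k k"
    and AB: "\<And>i j. i < k \<Longrightarrow> j < k \<Longrightarrow> gscalar (A $$ (i, j)) \<in> mat_alg m n T \<and>
      \<phi> (gscalar (A $$ (i, j))) = gscalar (B $$ (i, j))"
  shows "\<phi> (gscalar (det A)) = gscalar (det B)"
proof -
  have prod: "gscalar (\<Prod>i\<in>I. A $$ (i, p i)) \<in> mat_alg m n T \<and>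
      \<phi> (gscalar (\<Prod>i\<in>I. A $$ (i, p i))) = gscalar (\<Prod>i\<in>I. B $$ (i, p i))"
    if "finite I" "\<And>i. i \<in> I \<Longrightarrow> i < k \<and> p i < k" for p and I :: "nat set"
    using that
    by (induction I rule: finite_induct)
       (auto simp: gscalar_1 gscalar_mult mat_alg_1 alg_hom_on_1[OF \<phi>] alg_hom_on_mult[OF \<phi>] AB
         intro: mat_alg.mult)
  have sign: "gscalar (signof p * (\<Prod>i = 0..<k. A $$ (i, p i))) \<in> mat_alg m n T \<and>
      \<phi> (gscalar (signof p * (\<Prod>i = 0..<k. A $$ (i, p i)))) =
        gscalar (signof p * (\<Prod>i = 0..<k. B $$ (i, p i)))"
    if p: "p permutes {0..<k}" for p
  proof -
    have P: "gscalar (\<Prod>i = 0..<k. A $$ (i, p i)) \<in> mat_alg m n T \<and>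
        \<phi> (gscalar (\<Prod>i = 0..<k. A $$ (i, p i))) = gscalar (\<Prod>i = 0..<k. B $$ (i, p i))"
      by (rule prod) (use permutes_in_image[OF p] in auto)
    have "\<phi> (- f) = - \<phi> f" if "f \<in> mat_alg m n T" for f
      using alg_hom_on_scale[OF \<phi> that, of "- 1"] by simp
    then show ?thesis
      using P by (cases rule: sign_cases[of p]) (auto simp: gscalar_minus mat_alg_minus)
  qed
  show ?thesis
    unfolding det_def'[OF A] det_def'[OF B] gscalar_sum
    by (subst alg_hom_on_sum[THEN conjunct1, OF \<phi> mat_alg.add mat_alg_0])
       (use sign in auto)
qed

lemma right_factor_det:
  "right_factor m n (det_prod m n {1} :: 'a::field_char_0 sfun) = det_prod m n {2}"
proof -
  have hom: "alg_hom_on (mat_alg m n {1}) (right_factor m n :: 'a sfun \<Rightarrow> 'a sfun)"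
    by (rule alg_hom_on_subset[OF right_factor_hom mat_alg_coord])
  have ent: "(gscalar (rat_var (1, i, j)) :: 'a sfun) \<in> mat_alg m n {1} \<and>
      right_factor m n (gscalar (rat_var (1, i, j))) = (gscalar (rat_var (2, i, j)) :: 'a sfun)"
    if "i \<in> {1..m + n}" "j \<in> {1..m + n}" "even_var m (1, i, j)" for i j
    using mat_alg.entry[of 1 "{1}" i m n j, where 'a = 'a] right_factor_entry[OF that(1,2), where 'a = 'a] that
    by (simp add: entry_def even_var_def)
  let ?A = "\<lambda>t. mat m m (\<lambda>(i, j). rat_var (t, i + 1, j + 1)) :: 'a rat_fun mat"
  let ?B = "\<lambda>t. mat n n (\<lambda>(i, j). rat_var (t, m + i + 1, m + j + 1)) :: 'a rat_fun mat"
  have A: "gscalar (det (?A 1)) \<in> mat_alg m n {1}" and B: "gscalar (det (?B 1)) \<in> mat_alg m n {1}"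
    by (rule mat_alg_det[of _ m], use ent in \<open>auto simp: even_var_def\<close>)
       (rule mat_alg_det[of _ n], use ent in \<open>auto simp: even_var_def\<close>)
  have "right_factor m n (gscalar (det (?A 1))) = gscalar (det (?A 2))"
    by (rule alg_hom_on_det[OF hom, of _ m]) (use ent in \<open>auto simp: even_var_def\<close>)
  moreover have "right_factor m n (gscalar (det (?B 1))) = gscalar (det (?B 2))"
    by (rule alg_hom_on_det[OF hom, of _ n]) (use ent in \<open>auto simp: even_var_def\<close>)
  ultimately show ?thesis
    unfolding det_prod_def by (simp add: det_blocks_def gscalar_mult alg_hom_on_mult[OF hom A B] del: One_nat_def)
qed

lemma right_factor_loc_alg:
  fixes f :: "'a::field_char_0 sfun"
  assumes "f \<in> coord_alg m n"
  shows "right_factor m n f \<in> loc_alg m n {2}"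
proof -
  have hom: "alg_hom_on (coord_alg m n) (right_factor m n :: 'a sfun \<Rightarrow> 'a sfun)"
    by (rule right_factor_hom)
  obtain k where k: "det_prod m n {1} ^ k * f \<in> mat_alg m n {1}"
    using assms by (auto simp: coord_alg_def loc_alg_iff)
  have D: "(det_prod m n {1} :: 'a sfun) ^ k \<in> coord_alg m n" for k
    using mat_alg_power[OF det_prod_mat_alg[OF order_refl]] mat_alg_coord by blast
  have "right_factor m n ((det_prod m n {1} :: 'a sfun) ^ k) = det_prod m n {2} ^ k" for k
    using alg_hom_on_mult[OF hom D[of 1] D] alg_hom_on_1[OF hom] right_factor_det[of m n, where 'a = 'a]
    by (induction k) simp_all
  then have "det_prod m n {2} ^ k * right_factor m n f \<in> mat_alg m n {2}"
    using right_factor_mat_alg[OF k] by (simp add: alg_hom_on_mult[OF hom D assms] del: One_nat_def)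
  then show ?thesis unfolding loc_alg_iff ..
qed

lemma coord_alg_le_loc: "f \<in> coord_alg m n \<Longrightarrow> f \<in> loc_alg m n {1, 2}"
  unfolding coord_alg_def by (rule loc_alg_mono[of "{1}"]) auto

lemma right_factor_loc_alg12:
  "f \<in> coord_alg m n \<Longrightarrow> right_factor m n f \<in> loc_alg m n {1, 2}" for f :: "'a::field_char_0 sfun"
  by (rule loc_alg_mono[OF _ _ right_factor_loc_alg]) auto

lemma coord_alg_subspace: "sfun.subspace (coord_alg m n)"
  unfolding sfun.subspace_def coord_alg_def
  using loc_alg_add loc_alg_scale mat_alg_loc[OF mat_alg_0] by blast

lemma loc_alg_subspace: "sfun.subspace (loc_alg m n T)"
  unfolding sfun.subspace_def
  using loc_alg_add loc_alg_scale mat_alg_loc[OF mat_alg_0] by blast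

lemma mat_alg_subspace: "sfun.subspace (mat_alg m n T)"
  unfolding sfun.subspace_def using mat_alg.add mat_alg_scale mat_alg_0 by blast

lemma tensor_space_loc_alg:
  fixes V W :: "'a::field_char_0 sfun set"
  assumes "V \<subseteq> coord_alg m n" "W \<subseteq> coord_alg m n"
  shows "tensor_space m n V W \<subseteq> loc_alg m n {1, 2}"
  unfolding tensor_space_def
proof (rule sfun.span_minimal[OF _ loc_alg_subspace])
  show "{tensor m n f g |f g. f \<in> V \<and> g \<in> W} \<subseteq> loc_alg m n {1, 2}"
  proof clarify
    fix f g assume "f \<in> V" "g \<in> W"
    then show "tensor m n f g \<in> loc_alg m n {1, 2}"
      unfolding tensor_def
      by (intro loc_alg_mult[OF coord_alg_le_loc right_factor_loc_alg12]) (use assms in auto)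
  qed
qed

lemma tensor_space_mono: "V \<subseteq> V' \<Longrightarrow> W \<subseteq> W' \<Longrightarrow> tensor_space m n V W \<subseteq> tensor_space m n V' W'"
  unfolding tensor_space_def by (rule sfun.span_mono) blast

text \<open>Scalars are absorbed into the first factor. This yields the sums without coefficients to
  which the condition in \<open>supermodule_hom\<close> applies.\<close>

lemma tensor_space_explicit:
  assumes V: "sfun.subspace V" and x: "x \<in> tensor_space m n V W"
  obtains r u a where "\<forall>k<r::nat. u k \<in> V \<and> a k \<in> W" "x = (\<Sum>k<r. tensor m n (u k) (a k))"
proof -
  have "\<exists>(r::nat) u a. (\<forall>k<r. u k \<in> V \<and> a k \<in> W) \<and> x = (\<Sum>k<r. tensor m n (u k) (a k))"
    using x unfolding tensor_space_def
  proof (induction rule: sfun.span_induct_alt)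
    case base
    show ?case by (rule exI[of _ 0]) simp
  next
    case (step c x y)
    then obtain f g where fg: "x = tensor m n f g" "f \<in> V" "g \<in> W" by blast
    obtain r :: nat and u a where ua: "\<forall>k<r. u k \<in> V \<and> a k \<in> W" "y = (\<Sum>k<r. tensor m n (u k) (a k))"
      using step by blast
    let ?u = "case_nat (sscale c f) u" and ?a = "case_nat g a"
    have "sscale c x = tensor m n (sscale c f) g"
      by (simp add: fg tensor_def sscale_def mult.assoc)
    then have "sscale c x + y = (\<Sum>k<Suc r. tensor m n (?u k) (?a k))"
      by (simp add: sum.lessThan_Suc_shift ua del: sum.lessThan_Suc)
    moreover have "\<forall>k<Suc r. ?u k \<in> V \<and> ?a k \<in> W"
      using ua fg sfun.subspace_scale[OF V] by (auto split: nat.split simp: less_Suc_eq_0_disj)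
    ultimately show ?case by blast
  qed
  then show thesis using that by blast
qed

text \<open>The algebra F[\<theta>]. Values of functions at 1 + \<theta> E have to be combinations
  of 1 and \<theta> with coefficients in F itself, since morphisms of supermodules are linear over F
  only.\<close>

definition dual_numbers :: "bool \<Rightarrow> 'a::field sfun set" where
  "dual_numbers b = {sconst x + sconst y * theta b | x y. True}"

lemma sconst_commute: "f * sconst a = sconst a * f"
  using even_commute[OF ghom_sconst, of a f] by simp

lemma sconst_left_commute: "f * (sconst a * g) = sconst a * (f * g)"
  by (rule even_left_commute) simp

lemma theta_square': "theta b * theta b = (0 :: 'a::field_char_0 sfun)"
  using theta_square[of b 1] by simp

lemma dual_numbers_const: "sconst a \<in> dual_numbers b"
proof -
  have "sconst a = sconst a + sconst 0 * theta b" by simp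
  then show ?thesis unfolding dual_numbers_def by blast
qed

lemma dual_numbers_add:
  assumes "f \<in> dual_numbers b" "g \<in> dual_numbers b"
  shows "f + g \<in> dual_numbers b"
proof -
  obtain x y x' y' where "f = sconst x + sconst y * theta b" "g = sconst x' + sconst y' * theta b"
    using assms by (auto simp: dual_numbers_def)
  then have "f + g = sconst (x + x') + sconst (y + y') * theta b"
    by (simp add: sconst_add distrib_right)
  then show ?thesis unfolding dual_numbers_def by blast
qed

lemma dual_mult:
  fixes x y x' y' :: "'a::field_char_0"
  shows "(sconst x + sconst y * theta b) * (sconst x' + sconst y' * theta b) =
    sconst (x * x') + sconst (x * y' + y * x') * theta b"
proof -
  have "sconst y * theta b * (sconst y' * theta b) = 0"
    by (simp add: mult.assoc sconst_left_commute theta_square')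
  then have "(sconst x + sconst y * theta b) * (sconst x' + sconst y' * theta b) =
     sconst x * sconst x' + (sconst x * (sconst y' * theta b) + sconst y * theta b * sconst x')"
    by (simp add: distrib_left distrib_right add_ac)
  moreover have "sconst x * (sconst y' * theta b) = sconst (x * y') * theta b"
    by (simp only: sconst_mult mult.assoc)
  moreover have "sconst y * theta b * sconst x' = sconst (y * x') * theta b"
    by (simp only: sconst_mult mult.assoc sconst_commute[of "theta b" x'])
  ultimately show ?thesis by (simp only: sconst_add sconst_mult distrib_right)
qed

lemma dual_numbers_mult:
  "f \<in> dual_numbers b \<Longrightarrow> g \<in> dual_numbers b \<Longrightarrow> f * g \<in> dual_numbers b" for f g :: "'a::field_char_0 sfun"
  unfolding dual_numbers_def using dual_mult by blast

lemma coord_alg_hom_dual_numbers: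
  fixes \<phi> :: "'a::field_char_0 sfun \<Rightarrow> 'a sfun"
  assumes \<phi>: "alg_hom_on (coord_alg m n) \<phi>"
    and entry: "\<And>k l. k \<in> {1..m + n} \<Longrightarrow> l \<in> {1..m + n} \<Longrightarrow> \<phi> (entry m 1 k l) \<in> dual_numbers b"
    and f: "f \<in> coord_alg m n"
  shows "\<phi> f \<in> dual_numbers b"
proof -
  have mat: "\<phi> g \<in> dual_numbers b" if "g \<in> mat_alg m n {1}" for g
    by (rule alg_hom_on_mat_alg_image[OF that alg_hom_on_subset[OF \<phi> mat_alg_coord]])
       (use entry in \<open>auto intro: dual_numbers_const dual_numbers_add dual_numbers_mult\<close>)
  obtain k g where g: "g \<in> mat_alg m n {1}" "f = det_prod_inv m n {1} k * g"
    using loc_alg_divide[of "{1}" f m n] f unfolding coord_alg_def by blast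
  let ?D = "det_prod m n {1} ^ k :: 'a sfun" and ?I = "det_prod_inv m n {1} k :: 'a sfun"
  have D: "?D \<in> mat_alg m n {1}" by (rule mat_alg_power[OF det_prod_mat_alg[OF order_refl]])
  have I: "?I \<in> coord_alg m n" unfolding coord_alg_def by (rule det_prod_inv_loc) simp
  have Dc: "?D \<in> coord_alg m n" and gc: "g \<in> coord_alg m n" using D g mat_alg_coord by blast+
  obtain x y where xy: "\<phi> ?D = sconst x + sconst y * theta b"
    using mat[OF D] by (auto simp: dual_numbers_def)
  have ID: "\<phi> ?I * \<phi> ?D = 1"
    unfolding alg_hom_on_mult[OF \<phi> I Dc, symmetric]
    by (subst det_prod_inv(2)) (simp_all add: alg_hom_on_1[OF \<phi>])
  \<comment> \<open>Otherwise the image of the determinant power would annihilate \<theta>, although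
    it has a left inverse.\<close>
  have "x \<noteq> 0"
  proof
    assume "x = 0"
    then have "\<phi> ?D * theta b = 0" unfolding xy by (simp add: mult.assoc theta_square')
    then have "(\<phi> ?I * \<phi> ?D) * theta b = 0" by (simp add: mult.assoc)
    then have "theta b * 1 = (0 :: 'a sfun)" unfolding ID by simp
    then show False using theta_mult_eq_0[of "1 :: 'a sfun" b] tfree_sconst[of "1 :: 'a"] by (simp add: sconst_1)
  qed
  \<comment> \<open>The expansion of 1 / (x + y \<theta>). It is a right inverse, hence equal to the
    left inverse \<open>\<phi> ?I\<close>.\<close>
  let ?z = "sconst (inverse x) + sconst (- y / x^2) * theta b :: 'a sfun"
  have Dz: "\<phi> ?D * ?z = 1"
    using \<open>x \<noteq> 0\<close> unfolding xy dual_mult by (simp add: sconst_1 power2_eq_square field_simps)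
  have "\<phi> ?I = \<phi> ?I * (\<phi> ?D * ?z)" unfolding Dz by simp
  also have "\<dots> = ?z" unfolding mult.assoc[symmetric] ID by simp
  finally have "\<phi> ?I \<in> dual_numbers b" unfolding dual_numbers_def by blast
  then show ?thesis
    unfolding g(2) alg_hom_on_mult[OF \<phi> I gc] using mat[OF g(1)] by (rule dual_numbers_mult)
qed

lemma unip_dual: "unip m i j k l \<in> dual_numbers (par m i j)"
proof -
  have "unip m i j k l = sconst (if k = l then 1 else 0) + sconst (if k = i \<and> l = j then 1 else 0) * theta (par m i j)"
    by (simp add: unip_def sconst_1)
  then show ?thesis unfolding dual_numbers_def by blast
qed

lemma point_eval_coord:
  fixes X Y :: "nat \<Rightarrow> nat \<Rightarrow> 'a::field_char_0 sfun"
  assumes "is_point m n X" "is_point m n Y"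
  shows "alg_hom_on (coord_alg m n) (point_eval m n X Y)"
    and "alg_hom_on (coord_alg m n) (\<lambda>f. point_eval m n X Y (right_factor m n f))"
  by (rule alg_hom_on_subset[OF point_eval_hom[OF assms]], use coord_alg_le_loc in blast)
     (rule alg_hom_on_comp[OF right_factor_hom point_eval_hom[OF assms]], use right_factor_loc_alg12 in blast)

lemma point_eval_id:
  fixes X :: "nat \<Rightarrow> nat \<Rightarrow> 'a::field_char_0 sfun"
  assumes X: "is_point m n X" and f: "f \<in> coord_alg m n"
  shows "point_eval m n (entry m 1) X f = f"
    and "point_eval m n X (entry m 1) (right_factor m n f) = f"
proof -
  have f': "f \<in> loc_alg m n {1}" using f by (simp add: coord_alg_def)
  show "point_eval m n (entry m 1) X f = f"
    by (rule alg_hom_on_loc_eq[OF _ point_eval_coord(1)[OF is_point_entry X, unfolded coord_alg_def]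
          alg_hom_on_id _ f'])
       (auto simp: point_eval_entry[OF is_point_entry X, unfolded One_nat_def])
  show "point_eval m n X (entry m 1) (right_factor m n f) = f"
    by (rule alg_hom_on_loc_eq[OF _ point_eval_coord(2)[OF X is_point_entry, unfolded coord_alg_def]
          alg_hom_on_id _ f'])
       (auto simp: point_eval_entry[OF X is_point_entry, unfolded One_nat_def]
         right_factor_entry[unfolded One_nat_def])
qed

lemma sum_unip_right:
  assumes "i \<in> {1..m + n}" "y \<in> {1..m + n}"
  shows "(\<Sum>k = 1..m + n. g k * unip m i j k y) =
    g y + (if y = j then g i * theta (par m i j) else 0 :: 'a::field sfun)"
proof -
  have "(\<Sum>k = 1..m + n. g k * unip m i j k y) =
      (\<Sum>k = 1..m + n. (if k = y then g k else 0) + (if k = i then if y = j then g k * theta (par m i j) else 0 else 0))"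
    by (rule sum.cong) (auto simp: unip_def distrib_left)
  then show ?thesis using assms by (simp add: sum.distrib del: One_nat_def)
qed

lemma sum_unip_left:
  assumes "x \<in> {1..m + n}" "j \<in> {1..m + n}"
  shows "(\<Sum>k = 1..m + n. unip m i j x k * g k) =
    g x + (if x = i then theta (par m i j) * g j else 0 :: 'a::field sfun)"
proof -
  have "(\<Sum>k = 1..m + n. unip m i j x k * g k) =
      (\<Sum>k = 1..m + n. (if k = x then g k else 0) + (if k = j then if x = i then theta (par m i j) * g k else 0 else 0))"
    by (rule sum.cong) (auto simp: unip_def distrib_right)
  then show ?thesis using assms by (simp add: sum.distrib del: One_nat_def)
qed

lemma point_eval_sum:
  fixes X Y :: "nat \<Rightarrow> nat \<Rightarrow> 'a::field_char_0 sfun"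
  assumes "is_point m n X" "is_point m n Y" "\<And>a. a \<in> A \<Longrightarrow> f a \<in> loc_alg m n {1, 2}"
  shows "point_eval m n X Y (sum f A) = (\<Sum>a\<in>A. point_eval m n X Y (f a))"
  by (rule alg_hom_on_sum[THEN conjunct1, OF point_eval_hom[OF assms(1,2)] loc_alg_add mat_alg_loc[OF mat_alg_0] assms(3)])

lemma point_eval_comult_entry:
  fixes X Y :: "nat \<Rightarrow> nat \<Rightarrow> 'a::field_char_0 sfun"
  assumes X: "is_point m n X" and Y: "is_point m n Y" and xy: "x \<in> {1..m + n}" "y \<in> {1..m + n}"
  shows "point_eval m n X Y (\<Sum>k = 1..m + n. entry m 1 x k * entry m 2 k y) =
    (\<Sum>k = 1..m + n. X x k * Y k y)"
proof -
  have e: "entry m t i j \<in> loc_alg m n {1, 2}" if "t \<in> {1, 2}" "i \<in> {1..m + n}" "j \<in> {1..m + n}" for t i j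
    using mat_alg_loc[OF mat_alg.entry[OF that]] .
  have "point_eval m n X Y (\<Sum>k = 1..m + n. entry m 1 x k * entry m 2 k y) =
      (\<Sum>k = 1..m + n. point_eval m n X Y (entry m 1 x k * entry m 2 k y))"
    by (rule point_eval_sum[OF X Y]) (use e xy in \<open>auto intro!: loc_alg_mult\<close>)
  also have "\<dots> = (\<Sum>k = 1..m + n. X x k * Y k y)"
  proof (rule sum.cong[OF refl])
    fix k assume k: "k \<in> {1..m + n}"
    have "point_eval m n X Y (entry m 1 x k * entry m 2 k y) =
        point_eval m n X Y (entry m 1 x k) * point_eval m n X Y (entry m 2 k y)"
      by (rule alg_hom_on_mult[OF point_eval_hom[OF X Y]]) (use e xy k in auto)
    then show "point_eval m n X Y (entry m 1 x k * entry m 2 k y) = X x k * Y k y"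
      unfolding point_eval_entry(1)[OF X Y xy(1) k] point_eval_entry(2)[OF X Y k xy(2)] .
  qed
  finally show ?thesis .
qed

lemma mat_alg_le_loc: "mat_alg m n T \<subseteq> loc_alg m n T"
  using mat_alg_loc by blast

text \<open>The right translate f(g (1 + \<theta> E_ij)). Both sides are homomorphisms in f, so this
  is the multiplication of the generic matrix by 1 + \<theta> E_ij, read off on entries.\<close>

lemma point_eval_comult_right:
  fixes f :: "'a::field_char_0 sfun"
  assumes ij: "i \<in> {1..m + n}" and f: "f \<in> coord_alg m n" "comult m n f \<in> loc_alg m n {1, 2}"
  shows "point_eval m n (entry m 1) (unip m i j) (comult m n f) = f + Rop m n i j f * theta (par m i j)"
proof -
  have "point_eval m n (entry m 1) (unip m i j) (comult m n f) = rhom m n i j f"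
  proof (rule comult_extend[OF point_eval_hom[OF is_point_entry is_point_unip] mat_alg_le_loc rhom_alg_hom _ f])
    fix x y assume xy: "x \<in> {1..m + n}" "y \<in> {1..m + n}"
    show "point_eval m n (entry m 1) (unip m i j) (\<Sum>k = 1..m + n. entry m 1 x k * entry m 2 k y) =
        rhom m n i j (entry m 1 x y :: 'a sfun)"
      unfolding point_eval_comult_entry[OF is_point_entry is_point_unip xy] sum_unip_right[OF ij xy(2)]
        rhom_def Rop_entry[OF xy] by simp
  qed
  then show ?thesis by (simp add: rhom_def)
qed

lemma sconst_sum: "sconst (sum f A) = (\<Sum>a\<in>A. sconst (f a))"
  by (induction A rule: infinite_finite_induct) (auto simp: sconst_add)

section \<open>Left translations by lower triangular elements\<close>

context
  fixes m n i j :: nat and S :: "var \<Rightarrow> 'a::field_char_0 sfun"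
  defines "S \<equiv> total_subst m n {1, 2} (\<lambda>t. if t = 1 then unip m i j else entry m 1)"
  assumes ij: "i \<in> {1..m + n}" "j \<in> {1..m + n}"
begin

private lemma S_parity: "parity_subst m S"
  unfolding S_def by (rule point_parity[OF is_point_unip is_point_entry])

text \<open>Under multiplication, inversion and integral powers of values 1 + a \<theta> the numbers
  a behave additively; this gives the values of characters at 1 + \<theta> E_ij. The even \<theta>
  suffices, since for i \<noteq> j the diagonal entries are 1.\<close>

private definition infinitesimal :: "'a rat_fun \<Rightarrow> 'a \<Rightarrow> bool" where
  "infinitesimal x a \<longleftrightarrow> x \<in> fdom (poly_subst m S) \<and>
    of_even (feval (poly_subst m S) x) = 1 + sconst a * theta False"

private lemma dual_mult_1:
  "(1 + sconst a * theta b) * (1 + sconst c * theta b) = (1 + sconst (a + c) * theta b :: 'a sfun)"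
  using dual_mult[of 1 a b 1 c] by (simp add: sconst_1 add.commute)

private lemma infinitesimal_mult: "infinitesimal x a \<Longrightarrow> infinitesimal y c \<Longrightarrow> infinitesimal (x * y) (a + c)"
  unfolding infinitesimal_def by (simp add: fdom_mult[OF poly_subst_hom] dual_mult_1)

private lemma infinitesimal_1: "infinitesimal 1 0"
  unfolding infinitesimal_def
  by (simp add: fdom_1[OF poly_subst_hom ghom_odd_subst[OF S_parity]]
      feval_1[OF poly_subst_hom ghom_odd_subst[OF S_parity]])

private lemma infinitesimal_inverse:
  assumes "infinitesimal x a"
  shows "infinitesimal (inverse x) (- a)"
proof -
  let ?e = "poly_subst m S"
  have x: "x \<in> fdom ?e" "of_even (feval ?e x) = 1 + sconst a * theta False"
    using assms by (auto simp: infinitesimal_def)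
  have "body (feval ?e x) \<noteq> 0" by (simp add: x(2) body_theta)
  then have inv: "inverse x \<in> fdom ?e" "feval ?e (inverse x) * feval ?e x = 1"
    using fdom_inverse[OF poly_subst_hom x(1)] by (auto simp: body_unit)
  let ?z = "of_even (feval ?e (inverse x))"
  have z: "?z * (1 + sconst a * theta False) = 1"
    using arg_cong[OF inv(2), of of_even] by (simp add: x(2))
  have "?z = ?z * ((1 + sconst a * theta False) * (1 + sconst (- a) * theta False))"
    unfolding dual_mult_1 by simp
  also have "\<dots> = 1 + sconst (- a) * theta False"
    unfolding mult.assoc[symmetric] z by simp
  finally show ?thesis using inv(1) by (simp add: infinitesimal_def)
qed

private lemma infinitesimal_power: "infinitesimal x a \<Longrightarrow> infinitesimal (x ^ k) (of_nat k * a)"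
  by (induction k) (auto simp: infinitesimal_1 distrib_right intro: infinitesimal_mult)

private lemma infinitesimal_powi:
  assumes "infinitesimal x a"
  shows "infinitesimal (x powi k) (of_int k * a)"
proof (cases "k \<ge> 0")
  case True
  then show ?thesis using infinitesimal_power[OF assms, of "nat k"] by (simp add: power_int_def)
next
  case False
  then show ?thesis using infinitesimal_power[OF infinitesimal_inverse[OF assms], of "nat (- k)"]
    by (simp add: power_int_def)
qed

private lemma infinitesimal_prod:
  "(\<And>s. s \<in> A \<Longrightarrow> infinitesimal (x s) (a s)) \<Longrightarrow> infinitesimal (prod x A) (sum a A)"
  by (induction A rule: infinite_finite_induct) (auto simp: infinitesimal_1 infinitesimal_mult)

private lemma infinitesimal_character:
  "infinitesimal (\<Prod>s = 1..m + n. rat_var (1, s, s) powi lam s) (if i = j then of_int (lam i) else 0)"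
proof -
  have "infinitesimal (rat_var (1, s, s)) (if s = i \<and> i = j then 1 else 0)" if "s \<in> {1..m + n}" for s
  proof -
    have v: "even_var m (1, s, s)" by (simp add: even_var_def)
    have "S (1, s, s) = unip m i j s s" using that by (simp add: S_def total_subst_def)
    also have "\<dots> = 1 + sconst (if s = i \<and> i = j then 1 else 0) * theta False"
      by (auto simp: unip_def sconst_1)
    finally show ?thesis
      using feval_rat_var[OF S_parity v] by (simp add: infinitesimal_def)
  qed
  then have "infinitesimal (\<Prod>s = 1..m + n. rat_var (1, s, s) powi lam s)
      (\<Sum>s = 1..m + n. of_int (lam s) * (if s = i \<and> i = j then 1 else 0))"
    by (intro infinitesimal_prod infinitesimal_powi)
  moreover have "(\<Sum>s = 1..m + n. of_int (lam s) * (if s = i \<and> i = j then 1 else 0 :: 'a)) =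
      (if i = j then of_int (lam i) else 0)"
  proof -
    have "(\<Sum>s = 1..m + n. of_int (lam s) * (if s = i \<and> i = j then 1 else 0 :: 'a)) =
      (\<Sum>s = 1..m + n. if s = i then (if i = j then of_int (lam i) else 0) else 0)"
      by (rule sum.cong) auto
    then show ?thesis using ij by simp
  qed
  ultimately show ?thesis by simp
qed

private lemma point_eval_character:
  "(borel_character m n lam :: 'a sfun) \<in> point_dom m n (unip m i j) (entry m 1)"
  "point_eval m n (unip m i j) (entry m 1) (borel_character m n lam) =
    (1 + (if i = j then sconst (of_int (lam i)) else 0) * theta False :: 'a sfun)"
  using infinitesimal_character[of lam]
  unfolding infinitesimal_def borel_character_def point_dom_def point_eval_def S_def[symmetric]
  by (auto simp: sdom_gscalar[OF S_parity] ssubst_gscalar[OF S_parity])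

private lemma borel_restrict_mat_alg:
  "f \<in> mat_alg m n {1, 2} \<Longrightarrow> borel_restrict m n (f :: 'a sfun) \<in> mat_alg m n {1, 2}"
  by (rule alg_hom_on_mat_alg_image[OF _ alg_hom_on_subset[OF borel_restrict_hom mat_alg_le_loc]])
     (auto simp: borel_restrict_entry simp del: One_nat_def intro: mat_alg.intros mat_alg_0)

text \<open>For j \<le> i the matrix 1 + \<theta> E_ij is lower triangular, so it vanishes where the
  restriction deletes entries. Multiplying C by it from the left adds \<theta> times row j to row i,
  which is \<open>lhom\<close> with the indices exchanged.\<close>

private lemma borel_eval_entry:
  assumes xy: "x \<in> {1..m + n}" "y \<in> {1..m + n}" and ji: "j \<le> i"
  shows "point_eval m n (unip m i j) (entry m 1)
      (borel_restrict m n (\<Sum>k = 1..m + n. entry m 1 x k * entry m 2 k y)) =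
    (lhom m n j i (entry m 1 x y) :: 'a sfun)"
proof -
  let ?X = "unip m i j :: nat \<Rightarrow> nat \<Rightarrow> 'a sfun" and ?Y = "entry m 1 :: nat \<Rightarrow> nat \<Rightarrow> 'a sfun"
  let ?b = "borel_restrict m n :: 'a sfun \<Rightarrow> 'a sfun" and ?p = "point_eval m n ?X ?Y"
  have e: "(entry m t a c :: 'a sfun) \<in> loc_alg m n {1, 2}" if "t \<in> {1, 2}" "a \<in> {1..m + n}" "c \<in> {1..m + n}" for t a c
    using mat_alg_loc[OF mat_alg.entry[OF that]] .
  have e0: "(if x < k then 0 else entry m 1 x k :: 'a sfun) \<in> loc_alg m n {1, 2}"
    if "k \<in> {1..m + n}" for k
    using e[of 1 x k] that xy mat_alg_loc[OF mat_alg_0] by (cases "x < k") simp_all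
  have mem: "(if x < k then 0 else entry m 1 x k :: 'a sfun) * entry m 2 k y \<in> loc_alg m n {1, 2}"
    if "k \<in> {1..m + n}" for k
    by (rule loc_alg_mult[OF e0[OF that] e[OF _ that xy(2)]]) simp
  have b: "?b (entry m 1 x k * entry m 2 k y) = (if x < k then 0 else entry m 1 x k) * entry m 2 k y"
    if k: "k \<in> {1..m + n}" for k
  proof -
    have "?b (entry m 1 x k * entry m 2 k y) = ?b (entry m 1 x k) * ?b (entry m 2 k y)"
      by (rule alg_hom_on_mult[OF borel_restrict_hom]) (use e xy k in auto)
    then show ?thesis
      using borel_restrict_entry[of 1 x m n k, where 'a = 'a] borel_restrict_entry[of 2 k m n y, where 'a = 'a] xy k
      by simp
  qed
  have p_sum: "?p (\<Sum>k = 1..m + n. F k) = (\<Sum>k = 1..m + n. ?p (F k))"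
    if "\<And>k. k \<in> {1..m + n} \<Longrightarrow> F k \<in> loc_alg m n {1, 2}" for F
    by (rule point_eval_sum[OF is_point_unip is_point_entry]) (rule that)
  have "?b (\<Sum>k = 1..m + n. entry m 1 x k * entry m 2 k y) =
      (\<Sum>k = 1..m + n. ?b (entry m 1 x k * entry m 2 k y))"
    by (rule alg_hom_on_sum[THEN conjunct1, OF borel_restrict_hom loc_alg_add mat_alg_loc[OF mat_alg_0]])
       (use e xy in \<open>simp_all add: loc_alg_mult del: One_nat_def\<close>)
  also have "\<dots> = (\<Sum>k = 1..m + n. (if x < k then 0 else entry m 1 x k) * entry m 2 k y)"
    by (rule sum.cong[OF refl b])
  finally have "?p (?b (\<Sum>k = 1..m + n. entry m 1 x k * entry m 2 k y)) =
      ?p (\<Sum>k = 1..m + n. (if x < k then 0 else entry m 1 x k) * entry m 2 k y)"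
    by (rule arg_cong)
  also have "\<dots> = (\<Sum>k = 1..m + n. ?p ((if x < k then 0 else entry m 1 x k) * entry m 2 k y))"
    by (rule p_sum) (rule mem)
  also have "\<dots> = (\<Sum>k = 1..m + n. ?X x k * entry m 1 k y)"
  proof (rule sum.cong[OF refl])
    fix k assume k: "k \<in> {1..m + n}"
    show "?p ((if x < k then 0 else entry m 1 x k) * entry m 2 k y) = ?X x k * entry m 1 k y"
    proof (cases "x < k")
      \<comment> \<open>From x < k it follows that (x, k) is neither on the diagonal nor equal to
        (i, j).\<close>
      case True
      then have "?X x k = 0" using ji by (auto simp: unip_def)
      moreover have "?p 0 = 0"
        using point_eval_sum[OF is_point_unip is_point_entry, of "{}"] by simp
      ultimately show ?thesis using True by simp
    next
      case False
      have "?p (entry m 1 x k * entry m 2 k y) = ?p (entry m 1 x k) * ?p (entry m 2 k y)"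
        by (rule alg_hom_on_mult[OF point_eval_hom[OF is_point_unip is_point_entry]]) (use e xy k in auto)
      moreover have "?p (entry m 1 x k) = ?X x k"
        by (rule point_eval_entry(1)[OF is_point_unip is_point_entry xy(1) k])
      moreover have "?p (entry m 2 k y) = entry m 1 k y"
        by (rule point_eval_entry(2)[OF is_point_unip is_point_entry k xy(2)])
      ultimately show ?thesis using False by (simp only: if_False)
    qed
  qed
  also have "\<dots> = entry m 1 x y + (if x = i then theta (par m i j) * entry m 1 j y else 0)"
    by (rule sum_unip_left[OF xy(1) ij(2)])
  also have "\<dots> = lhom m n j i (entry m 1 x y)"
  proof -
    have "par m i j = par m j i" by auto
    then show ?thesis unfolding lhom_def Mop_entry[OF xy] by auto
  qed
  finally show ?thesis .
qed

text \<open>The equation f(b g) = \<lambda>(b) f(g) at b = 1 + \<theta> E_ij.\<close>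

lemma induced_lhom:
  fixes f :: "'a sfun"
  assumes f: "f \<in> induced m n lam" "comult m n f \<in> loc_alg m n {1, 2}" and ji: "j \<le> i"
  shows "lhom m n j i f = (1 + (if i = j then sconst (of_int (lam i)) else 0) * theta False) * f"
proof -
  let ?X = "unip m i j :: nat \<Rightarrow> nat \<Rightarrow> 'a sfun" and ?Y = "entry m 1 :: nat \<Rightarrow> nat \<Rightarrow> 'a sfun"
  let ?b = "borel_restrict m n :: 'a sfun \<Rightarrow> 'a sfun" and ?p = "point_eval m n ?X ?Y"
  note pt = is_point_unip[of m n i j, where 'a = 'a] is_point_entry[of m n 1, where 'a = 'a]
  \<comment> \<open>The restriction of \<Delta>(f) contains the character and need not lie in F[G]
    \<otimes> F[G]. The set R consists of elements for which restriction can be followed by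
    evaluation.\<close>
  let ?R = "{g \<in> loc_alg m n {1, 2}. ?b g \<in> point_dom m n ?X ?Y}"
  have hom: "alg_hom_on ?R (\<lambda>g. ?p (?b g))"
    by (rule alg_hom_on_comp[OF alg_hom_on_subset[OF borel_restrict_hom] point_eval_hom_dom[OF pt]]) auto
  have loc: "loc_alg m n {1, 2} \<subseteq> point_dom m n ?X ?Y" by (rule point_loc[OF pt])
  have mat: "mat_alg m n {1, 2} \<subseteq> ?R"
    using borel_restrict_mat_alg mat_alg_le_loc loc by blast
  have fc: "f \<in> coord_alg m n" and bf: "?b (comult m n f) = borel_character m n lam * right_factor m n f"
    using f(1) by (auto simp: induced_def tensor_def)
  have rf: "right_factor m n f \<in> point_dom m n ?X ?Y"
    using right_factor_loc_alg12[OF fc] loc by blast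
  have "?b (comult m n f) \<in> point_dom m n ?X ?Y"
    unfolding bf using point_eval_character(1) rf sdom_mult[OF S_parity]
    unfolding point_dom_def S_def by blast
  then have R: "comult m n f \<in> ?R" using f(2) by blast
  have "?p (?b (comult m n f)) = lhom m n j i f"
    by (rule comult_extend[OF hom mat lhom_alg_hom borel_eval_entry[OF _ _ ji] fc R])
  moreover have "?p (?b (comult m n f)) = ?p (borel_character m n lam) * ?p (right_factor m n f)"
    unfolding bf by (rule alg_hom_on_mult[OF point_eval_hom_dom[OF pt] point_eval_character(1) rf])
  ultimately show ?thesis
    unfolding point_eval_character(2) point_eval_id(2)[OF pt(1) fc] by simp
qed

end

text \<open>Obtained by comparing coefficients of \<theta>. The operators \<open>Mop m n j i\<close>
  with j < i are the raising operators, so elements of H^0(\<lambda>) are highest weight vectors of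
  weight \<lambda>.\<close>

lemma induced_Mop:
  fixes f :: "'a::field_char_0 sfun"
  assumes f: "f \<in> induced m n lam" "comult m n f \<in> loc_alg m n {1, 2}"
    and ij: "i \<in> {1..m + n}" "j \<in> {1..m + n}"
  shows "j < i \<Longrightarrow> Mop m n j i f = 0" and "Mop m n i i f = sconst (of_int (lam i)) * f"
proof -
  have fc: "f \<in> coord_alg m n" using f(1) by (simp add: induced_def)
  note free = coord_alg_tfree[OF fc]
  show "Mop m n j i f = 0" if "j < i"
  proof -
    have "f + theta (par m j i) * Mop m n j i f = f + theta (par m j i) * 0"
      using induced_lhom[OF ij f] that by (simp add: lhom_def)
    then show ?thesis
      using theta_decomp[OF free tfree_Mop[OF free] free tfree_0] by blast
  qed
  have "f + theta False * Mop m n i i f = f + theta False * (sconst (of_int (lam i)) * f)"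
    using induced_lhom[OF ij(1) ij(1) f]
    by (simp add: lhom_def distrib_right mult.assoc sconst_left_commute)
  then show "Mop m n i i f = sconst (of_int (lam i)) * f"
    using theta_decomp[OF free tfree_Mop[OF free] free tfree_mult[OF tfree_sconst free]] by blast
qed

section \<open>Supermodules\<close>

lemma subsupermoduleD:
  assumes "subsupermodule m n W"
  shows "W \<subseteq> coord_alg m n" "sfun.subspace W"
    "\<And>f. f \<in> W \<Longrightarrow> comult m n f \<in> tensor_space m n W (coord_alg m n)"
  using assms by (auto simp: subsupermodule_def)

lemma subsupermodule_comult:
  fixes W :: "'a::field_char_0 sfun set"
  assumes "subsupermodule m n W" "f \<in> W"
  shows "comult m n f \<in> loc_alg m n {1, 2}"
  using tensor_space_loc_alg[OF subsupermoduleD(1)[OF assms(1)] order_refl] subsupermoduleD(3)[OF assms]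
  by (rule subsetD)

lemma subspace_sum_scale:
  assumes V: "sfun.subspace V" and u: "\<And>k. k < r \<Longrightarrow> u k \<in> V"
  shows "(\<Sum>k<(r::nat). sscale (y k) (u k)) \<in> V"
  using u by (intro sfun.subspace_sum[OF V] sfun.subspace_scale[OF V]) auto

text \<open>The scalars \<open>y k\<close> are determined by the second tensor factors alone, so
  they do not change when a morphism is applied to the first ones. This is why morphisms commute
  with \<open>Rop\<close>.\<close>

lemma tensor_sum_Rop:
  fixes f :: "'a::field_char_0 sfun"
  assumes ij: "i \<in> {1..m + n}" and f: "f \<in> coord_alg m n" "comult m n f \<in> loc_alg m n {1, 2}"
    and u: "\<And>k. k < (r::nat) \<Longrightarrow> u k \<in> coord_alg m n \<and> a k \<in> coord_alg m n"
    and sum: "comult m n f = (\<Sum>k<r. tensor m n (u k) (a k))"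
    and xy: "\<And>k. k < r \<Longrightarrow> point_eval m n (entry m 1) (unip m i j) (right_factor m n (a k)) =
      sconst (x k) + sconst (y k) * theta (par m i j)"
  shows "Rop m n i j f = (\<Sum>k<r. sscale (y k) (u k))"
proof -
  let ?p = "point_eval m n (entry m 1) (unip m i j) :: 'a sfun \<Rightarrow> 'a sfun"
  let ?t = "theta (par m i j) :: 'a sfun"
  note pt = is_point_entry[of m n 1, where 'a = 'a] is_point_unip[of m n i j, where 'a = 'a]
  have tens: "?p (tensor m n (u k) (a k)) = sscale (x k) (u k) + sscale (y k) (u k) * ?t" if k: "k < r" for k
  proof -
    have uk: "u k \<in> coord_alg m n" "a k \<in> coord_alg m n" using u[OF k] by auto
    have "?p (tensor m n (u k) (a k)) = ?p (u k) * ?p (right_factor m n (a k))"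
      unfolding tensor_def
      by (rule alg_hom_on_mult[OF point_eval_hom[OF pt] coord_alg_le_loc[OF uk(1)] right_factor_loc_alg12[OF uk(2)]])
    also have "\<dots> = u k * (sconst (x k) + sconst (y k) * ?t)"
      unfolding point_eval_id(1)[OF pt(2) uk(1)] xy[OF k] ..
    also have "\<dots> = sscale (x k) (u k) + sscale (y k) (u k) * ?t"
      by (simp only: distrib_left mult.assoc[symmetric] sscale_alt)
    finally show ?thesis .
  qed
  have loc: "tensor m n (u k) (a k) \<in> loc_alg m n {1, 2}" if "k < r" for k
    using u[OF that] unfolding tensor_def
    by (intro loc_alg_mult[OF coord_alg_le_loc right_factor_loc_alg12]) auto
  have "?p (comult m n f) = (\<Sum>k<r. ?p (tensor m n (u k) (a k)))"
    unfolding sum by (rule point_eval_sum[OF pt]) (use loc in auto)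
  also have "\<dots> = (\<Sum>k<r. sscale (x k) (u k) + sscale (y k) (u k) * ?t)"
    by (rule sum.cong) (use tens in auto)
  also have "\<dots> = (\<Sum>k<r. sscale (x k) (u k)) + (\<Sum>k<r. sscale (y k) (u k)) * ?t"
    by (simp only: sum.distrib sum_distrib_right)
  finally have eq: "f + Rop m n i j f * ?t = (\<Sum>k<r. sscale (x k) (u k)) + (\<Sum>k<r. sscale (y k) (u k)) * ?t"
    unfolding point_eval_comult_right[OF ij f] .
  have free: "tfree (\<Sum>k<r. sscale (z k) (u k))" for z
    unfolding sscale_def using u coord_alg_tfree by (intro tfree_sum tfree_mult tfree_sconst) auto
  show ?thesis
    using theta_decomp_right[OF coord_alg_tfree[OF f(1)] tfree_Rop[OF coord_alg_tfree[OF f(1)]] free free eq]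
    by blast
qed

lemma right_eval_dual:
  fixes a :: "'a::field_char_0 sfun"
  assumes "a \<in> coord_alg m n"
  shows "\<exists>x y. point_eval m n (entry m 1) (unip m i j) (right_factor m n a) =
    sconst x + sconst y * theta (par m i j)"
proof -
  note pt = is_point_entry[of m n 1, where 'a = 'a] is_point_unip[of m n i j, where 'a = 'a]
  have "point_eval m n (entry m 1) (unip m i j) (right_factor m n a) \<in> dual_numbers (par m i j)"
  proof (rule coord_alg_hom_dual_numbers[OF point_eval_coord(2)[OF pt] _ assms])
    fix k l assume kl: "k \<in> {1..m + n}" "l \<in> {1..m + n}"
    show "point_eval m n (entry m 1) (unip m i j) (right_factor m n (entry m 1 k l :: 'a sfun))
        \<in> dual_numbers (par m i j)"
      unfolding right_factor_entry[OF kl] point_eval_entry(2)[OF pt kl] by (rule unip_dual)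
  qed
  then show ?thesis unfolding dual_numbers_def by blast
qed

text \<open>An expansion of \<Delta>(f) with all \<open>u k\<close> in V exhibits
  \<open>Rop m n i j f\<close> as a combination of the \<open>u k\<close>; applying \<phi> to them
  gives an expansion of \<Delta>(\<phi>(f)). An odd \<phi> produces no sign, because only the second
  tensor factor is evaluated.\<close>

lemma supermodule_hom_Rop:
  fixes V L :: "'a::field_char_0 sfun set"
  assumes V: "subsupermodule m n V" and L: "subsupermodule m n L"
    and \<phi>: "supermodule_hom m n V L \<phi>" and f: "f \<in> V" and i: "i \<in> {1..m + n}"
  shows "Rop m n i j f \<in> V" "\<phi> (Rop m n i j f) = Rop m n i j (\<phi> f)"
proof -
  note Vs = subsupermoduleD[OF V] and Ls = subsupermoduleD[OF L]
  have map: "\<phi> f \<in> L" if "f \<in> V" for f using \<phi> that by (auto simp: supermodule_hom_def)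
  have add: "\<phi> (f + g) = \<phi> f + \<phi> g" if "f \<in> V" "g \<in> V" for f g
    using \<phi> that by (auto simp: supermodule_hom_def)
  have scale: "\<phi> (sscale c f) = sscale c (\<phi> f)" if "f \<in> V" for c f
    using \<phi> that by (auto simp: supermodule_hom_def)
  obtain r u a where ua': "\<forall>k<r::nat. u k \<in> V \<and> a k \<in> coord_alg m n"
    "comult m n f = (\<Sum>k<r. tensor m n (u k) (a k))"
    by (rule tensor_space_explicit[OF Vs(2) Vs(3)[OF f]])
  note ua = ua'(1)[rule_format] ua'(2)
  have "\<forall>k. \<exists>x y. k < r \<longrightarrow> point_eval m n (entry m 1) (unip m i j) (right_factor m n (a k)) =
      sconst x + sconst y * theta (par m i j)"
    using right_eval_dual ua(1) by blast
  from choice[OF this] obtain x where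
    "\<forall>k. \<exists>y. k < r \<longrightarrow> point_eval m n (entry m 1) (unip m i j) (right_factor m n (a k)) =
      sconst (x k) + sconst y * theta (par m i j)" by (elim exE)
  from choice[OF this] obtain y where
    "\<forall>k. k < r \<longrightarrow> point_eval m n (entry m 1) (unip m i j) (right_factor m n (a k)) =
      sconst (x k) + sconst (y k) * theta (par m i j)" by (elim exE)
  note xy = this[rule_format]
  have fc: "f \<in> coord_alg m n" "\<phi> f \<in> coord_alg m n"
    using f map[OF f] Vs(1) Ls(1) by blast+
  have uc: "u k \<in> coord_alg m n \<and> a k \<in> coord_alg m n" if "k < r" for k
    using ua(1)[OF that] Vs(1) by blast
  have uc': "\<phi> (u k) \<in> coord_alg m n \<and> a k \<in> coord_alg m n" if "k < r" for k
    using ua(1)[OF that] map Ls(1) by blast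
  have R: "Rop m n i j f = (\<Sum>k<r. sscale (y k) (u k))"
    by (rule tensor_sum_Rop[OF i fc(1) subsupermodule_comult[OF V f] uc ua(2) xy])
  show "Rop m n i j f \<in> V"
    unfolding R by (rule subspace_sum_scale[OF Vs(2)]) (use ua(1) in blast)
  have hom: "comult m n (\<phi> f) = (\<Sum>k<r. tensor m n (\<phi> (u k)) (a k))"
    using \<phi> f ua unfolding supermodule_hom_def by blast
  have R': "Rop m n i j (\<phi> f) = (\<Sum>k<r. sscale (y k) (\<phi> (u k)))"
    by (rule tensor_sum_Rop[OF i fc(2) subsupermodule_comult[OF L map[OF f]] uc' hom xy])
  have "\<phi> (\<Sum>k<r'. sscale (y k) (u k)) = (\<Sum>k<r'. sscale (y k) (\<phi> (u k)))" if "r' \<le> r" for r'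
    using that
  proof (induction r')
    case 0
    have "\<phi> (sscale 0 f) = sscale 0 (\<phi> f)" by (rule scale[OF f])
    then show ?case by simp
  next
    case (Suc r')
    have "(\<Sum>k<r'. sscale (y k) (u k)) \<in> V"
      by (rule subspace_sum_scale[OF Vs(2)]) (use ua(1) Suc.prems in auto)
    moreover have "u r' \<in> V" using ua(1)[of r'] Suc.prems by auto
    ultimately show ?case
      using Suc by (simp add: add scale sfun.subspace_scale[OF Vs(2)])
  qed
  then show "\<phi> (Rop m n i j f) = Rop m n i j (\<phi> f)" unfolding R R' by blast
qed

lemma supermodule_hom_casimir:
  fixes V L :: "'a::field_char_0 sfun set"
  assumes V: "subsupermodule m n V" and L: "subsupermodule m n L"
    and \<phi>: "supermodule_hom m n V L \<phi>" and f: "f \<in> V"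
  shows "\<phi> (right_casimir m n f) = right_casimir m n (\<phi> f)"
proof -
  note Vs = subsupermoduleD[OF V]
  have scale: "\<phi> (sscale c f) = sscale c (\<phi> f)" if "f \<in> V" for c f
    using \<phi> that by (auto simp: supermodule_hom_def)
  have add: "\<phi> (f + g) = \<phi> f + \<phi> g" if "f \<in> V" "g \<in> V" for f g
    using \<phi> that by (auto simp: supermodule_hom_def)
  have 0: "\<phi> 0 = 0" using scale[OF f, of 0] by simp
  have sum: "\<phi> (sum g A) = (\<Sum>a\<in>A. \<phi> (g a)) \<and> sum g A \<in> V" if "\<And>a. a \<in> A \<Longrightarrow> g a \<in> V" for g and A :: "nat set"
    using that by (induction A rule: infinite_finite_induct)
      (auto simp: 0 add sfun.subspace_0[OF Vs(2)] sfun.subspace_add[OF Vs(2)])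
  have sg: "\<phi> (sg m j * g) = sg m j * \<phi> g \<and> sg m j * g \<in> V" if "g \<in> V" for j g
    using scale[OF that, of "- 1"] that sfun.subspace_neg[OF Vs(2)] by (auto simp: sg_def)
  have summand: "\<phi> (sg m j * Rop m n i j (Rop m n j i f)) = sg m j * Rop m n i j (Rop m n j i (\<phi> f)) \<and>
      sg m j * Rop m n i j (Rop m n j i f) \<in> V"
    if "i \<in> {1..m + n}" "j \<in> {1..m + n}" for i j
    using supermodule_hom_Rop[OF V L \<phi> f that(2), of i]
      supermodule_hom_Rop[OF V L \<phi> supermodule_hom_Rop(1)[OF V L \<phi> f that(2)] that(1), of j i] sg
    by simp
  have inner: "\<phi> (\<Sum>j = 1..m + n. sg m j * Rop m n i j (Rop m n j i f)) =
      (\<Sum>j = 1..m + n. sg m j * Rop m n i j (Rop m n j i (\<phi> f))) \<and>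
      (\<Sum>j = 1..m + n. sg m j * Rop m n i j (Rop m n j i f)) \<in> V"
    if i: "i \<in> {1..m + n}" for i
    using sum[of "{1..m + n}" "\<lambda>j. sg m j * Rop m n i j (Rop m n j i f)"] summand[OF i]
      sum.cong[OF refl summand[OF i, THEN conjunct1], of "{1..m + n}"]
    by (simp only: simp_thms)
  have "\<phi> (right_casimir m n f) = (\<Sum>i = 1..m + n. \<phi> (\<Sum>j = 1..m + n. sg m j * Rop m n i j (Rop m n j i f)))"
    unfolding right_casimir_def by (rule sum[THEN conjunct1]) (rule inner[THEN conjunct2])
  also have "\<dots> = right_casimir m n (\<phi> f)"
    unfolding right_casimir_def by (rule sum.cong[OF refl inner[THEN conjunct1]])
  finally show ?thesis .
qed

section \<open>The largest polynomial subsupermodule\<close>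

lemma gpart_add: "gpart q (f + g) = gpart q f + gpart q g"
  by (rule grassmann_eqI) (simp add: gpart.rep_eq)

lemma gpart_scale: "gpart q (sscale c f) = sscale c (gpart q f)"
  by (rule grassmann_eqI) (simp add: gpart.rep_eq sscale_def sconst_def)

lemma gpart_0: "gpart q 0 = 0"
  by (rule grassmann_eqI) (simp add: gpart.rep_eq)

text \<open>Points are inserted into \<Delta>(f), which therefore has to lie in F[G] \<otimes> F[G].
  For elements of subsupermodules this follows from the coaction condition, and it passes to
  spans.\<close>

definition regular_induced :: "nat \<Rightarrow> nat \<Rightarrow> weight \<Rightarrow> 'a::field sfun set" where
  "regular_induced m n lam = {f \<in> induced m n lam. comult m n f \<in> loc_alg m n {1, 2}}"

lemma regular_induced_subspace:
  "sfun.subspace (regular_induced m n lam :: 'a::field_char_0 sfun set)"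
proof -
  note C = comult_hom[of m n, where 'a = 'a] and B = borel_restrict_hom[of m n, where 'a = 'a]
    and F = right_factor_hom[of m n, where 'a = 'a]
  note Cs = coord_alg_subspace[of m n, where 'a = 'a] and Ls = loc_alg_subspace[of m n "{1, 2}", where 'a = 'a]
  have 0: "\<phi> 0 = 0" if "alg_hom_on R \<phi>" "1 \<in> R" for \<phi> :: "'a sfun \<Rightarrow> 'a sfun" and R
    using alg_hom_on_const[OF that, of 0] by simp
  have one: "1 \<in> (coord_alg m n :: 'a sfun set)" "1 \<in> (loc_alg m n {1, 2} :: 'a sfun set)"
    using mat_alg_coord mat_alg_1 mat_alg_le_loc by blast+
  show ?thesis
    unfolding sfun.subspace_def
  proof (intro conjI ballI allI)
    show "0 \<in> (regular_induced m n lam :: 'a sfun set)"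
      using 0[OF C one(1)] 0[OF B one(2)] 0[OF F one(1)] sfun.subspace_0[OF Cs] sfun.subspace_0[OF Ls]
      by (simp add: regular_induced_def induced_def tensor_def del: One_nat_def)
  next
    fix f g :: "'a sfun" assume "f \<in> regular_induced m n lam" "g \<in> regular_induced m n lam"
    then show "f + g \<in> regular_induced m n lam"
      using sfun.subspace_add[OF Cs, of f g] sfun.subspace_add[OF Ls, of "comult m n f" "comult m n g"]
      by (simp add: regular_induced_def induced_def tensor_def alg_hom_on_add[OF C] alg_hom_on_add[OF B]
          alg_hom_on_add[OF F] distrib_left del: One_nat_def)
  next
    fix c and f :: "'a sfun" assume "f \<in> regular_induced m n lam"
    then show "sscale c f \<in> regular_induced m n lam"
      using sfun.subspace_scale[OF Cs, of f c] sfun.subspace_scale[OF Ls, of "comult m n f" c]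
      by (simp add: regular_induced_def induced_def tensor_def alg_hom_on_scale[OF C] alg_hom_on_scale[OF B]
          alg_hom_on_scale[OF F] del: One_nat_def) (simp add: sscale_def sconst_left_commute)
  qed
qed

lemma subsupermodule_regular:
  fixes W :: "'a::field_char_0 sfun set"
  shows "subsupermodule m n W \<Longrightarrow> W \<subseteq> induced m n lam \<Longrightarrow> W \<subseteq> regular_induced m n lam"
  using subsupermodule_comult unfolding regular_induced_def by blast

text \<open>The span of all polynomial subsupermodules of H^0(\<lambda>) is again one of them; hence
  the \<open>GREATEST\<close> in \<open>nabla\<close> is attained by this span.\<close>

lemma nabla_props:
  "polynomial_supermodule m n (nabla m n lam :: 'a::field_char_0 sfun set)"
  "(nabla m n lam :: 'a sfun set) \<subseteq> regular_induced m n lam"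
proof -
  let ?P = "\<lambda>W :: 'a sfun set. polynomial_supermodule m n W \<and> W \<subseteq> induced m n lam"
  let ?U = "\<Union> {W. ?P W}"
  define N where "N = sfun.span ?U"
  note C = comult_hom[of m n, where 'a = 'a]
  have N: "sfun.subspace N" unfolding N_def by (rule sfun.subspace_span)
  have WN: "W \<subseteq> N" if "?P W" for W
  proof -
    have "W \<subseteq> ?U" by (rule Union_upper) (use that in simp)
    also have "?U \<subseteq> N" unfolding N_def by (rule sfun.span_superset)
    finally show ?thesis .
  qed
  have reg: "N \<subseteq> regular_induced m n lam"
    unfolding N_def
  proof (rule sfun.span_minimal[OF _ regular_induced_subspace])
    show "?U \<subseteq> regular_induced m n lam"
      using subsupermodule_regular unfolding polynomial_supermodule_def by blast
  qed
  have coord: "N \<subseteq> coord_alg m n" using reg by (auto simp: regular_induced_def induced_def)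
  have gp: "gpart q f \<in> N" if "f \<in> N" for q f
    using that unfolding N_def
  proof (induction rule: sfun.span_induct_alt)
    case base
    show ?case by (simp add: gpart_0 sfun.span_zero)
  next
    case (step c x y)
    then obtain W where W: "?P W" "x \<in> W" by blast
    then have "gpart q x \<in> W"
      unfolding polynomial_supermodule_def subsupermodule_def by (cases q) auto
    then have "gpart q x \<in> sfun.span ?U" using WN[OF W(1)] unfolding N_def by blast
    then show ?case
      using step by (simp add: gpart_add gpart_scale sfun.span_add sfun.span_scale)
  qed
  have com: "comult m n f \<in> tensor_space m n N (mat_alg m n {1})" if "f \<in> N" for f
  proof -
    \<comment> \<open>Membership in N is carried along because linearity of \<open>comult\<close> is
      available on F[G] only.\<close>
    have "comult m n f \<in> tensor_space m n N (mat_alg m n {1}) \<and> f \<in> N"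
      using that[unfolded N_def]
    proof (induction rule: sfun.span_induct_alt)
      case base
      have "(1 :: 'a sfun) \<in> coord_alg m n" using mat_alg_coord mat_alg_1 by blast
      then have "comult m n (0 :: 'a sfun) = 0" using alg_hom_on_const[OF C, of 0] by simp
      then show ?case by (simp add: tensor_space_def sfun.span_zero sfun.subspace_0[OF N])
    next
      case (step c x y)
      then obtain W where W: "?P W" "x \<in> W" by blast
      then have "comult m n x \<in> tensor_space m n W (mat_alg m n {1})"
        unfolding polynomial_supermodule_def by blast
      then have cx: "comult m n x \<in> tensor_space m n N (mat_alg m n {1})"
        using tensor_space_mono[OF WN[OF W(1)] order_refl] by blast
      have x: "x \<in> N" using W WN by blast
      have xc: "x \<in> coord_alg m n" "sscale c x \<in> coord_alg m n" "y \<in> coord_alg m n"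
        using coord x sfun.subspace_scale[OF N x] step by blast+
      have "comult m n (sscale c x + y) = sscale c (comult m n x) + comult m n y"
        unfolding alg_hom_on_add[OF C xc(2,3)] alg_hom_on_scale[OF C xc(1)] ..
      then show ?case
        using cx x step sfun.subspace_add[OF N] sfun.subspace_scale[OF N]
        by (simp add: tensor_space_def sfun.span_add sfun.span_scale)
    qed
    then show ?thesis ..
  qed
  have "polynomial_supermodule m n N"
    unfolding polynomial_supermodule_def subsupermodule_def
    using coord N gp com tensor_space_mono[OF order_refl mat_alg_coord, of m n N] by blast
  moreover have "N \<subseteq> induced m n lam" using reg by (auto simp: regular_induced_def)
  ultimately have "nabla m n lam = N"
    unfolding nabla_def by (intro Greatest_equality) (use WN in auto)
  then show "polynomial_supermodule m n (nabla m n lam :: 'a sfun set)"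
    "(nabla m n lam :: 'a sfun set) \<subseteq> regular_induced m n lam"
    using \<open>polynomial_supermodule m n N\<close> reg by simp_all
qed

lemma simple_module_regular:
  "(simple_module m n lam :: 'a::field_char_0 sfun set) \<subseteq> regular_induced m n lam"
  unfolding simple_module_def socle_def
proof (rule sfun.span_minimal[OF _ regular_induced_subspace])
  show "\<Union> {U. simple_supermodule m n U \<and> U \<subseteq> induced m n lam} \<subseteq> (regular_induced m n lam :: 'a sfun set)"
    using subsupermodule_regular unfolding simple_supermodule_def by blast
qed

text \<open>The counit axiom: setting the first matrix equal to the identity in \<Delta>(f) = \<Sum>
  u_k \<otimes> a_k expresses f as a combination of the a_k, which lie in A(m|n).\<close>

lemma polynomial_supermodule_mat_alg:
  fixes W :: "'a::field_char_0 sfun set"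
  assumes W: "polynomial_supermodule m n W"
  shows "W \<subseteq> mat_alg m n {1}"
proof
  fix f assume f: "f \<in> W"
  have sub: "subsupermodule m n W" using W by (simp add: polynomial_supermodule_def)
  note Ws = subsupermoduleD[OF sub]
  have fc: "f \<in> coord_alg m n" using f Ws(1) by blast
  have "comult m n f \<in> tensor_space m n W (mat_alg m n {1})"
    using W f by (auto simp: polynomial_supermodule_def)
  from tensor_space_explicit[OF Ws(2) this] obtain r u a where
    ua: "\<forall>k<r::nat. u k \<in> W \<and> a k \<in> mat_alg m n {1}" "comult m n f = (\<Sum>k<r. tensor m n (u k) (a k))" .
  \<comment> \<open>The position (0, 0) is outside the range, so this evaluates the first matrix at
    the identity. The lemmas on \<open>unip\<close> give values in F[\<theta>]; their \<theta>-parts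
    are removed by comparing coefficients.\<close>
  let ?p = "point_eval m n (unip m 0 0) (entry m 1) :: 'a sfun \<Rightarrow> 'a sfun"
  let ?t = "theta False :: 'a sfun"
  note pt = is_point_unip[of m n 0 0, where 'a = 'a] is_point_entry[of m n 1, where 'a = 'a]
  have "?p (comult m n f) = f"
  proof (rule comult_extend[OF point_eval_hom[OF pt] mat_alg_le_loc alg_hom_on_id _ fc subsupermodule_comult[OF sub f]])
    fix x y assume xy: "x \<in> {1..m + n}" "y \<in> {1..m + n}"
    have "(\<Sum>k = 1..m + n. unip m 0 0 x k * entry m 1 k y) =
        (\<Sum>k = 1..m + n. if k = x then entry m 1 x y else (0 :: 'a sfun))"
      by (rule sum.cong) (use xy in \<open>auto simp: unip_def\<close>)
    then show "?p (\<Sum>k = 1..m + n. entry m 1 x k * entry m 2 k y) = entry m 1 x y"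
      unfolding point_eval_comult_entry[OF pt xy] using xy by simp
  qed
  have mem: "u k \<in> coord_alg m n" "a k \<in> coord_alg m n" "a k \<in> mat_alg m n {1}" if "k < r" for k
    using ua(1) that Ws(1) mat_alg_coord by blast+
  have "\<exists>x y. ?p (u k) = sconst x + sconst y * ?t" if "k < r" for k
  proof -
    have "?p (u k) \<in> dual_numbers (par m 0 0)"
    proof (rule coord_alg_hom_dual_numbers[OF point_eval_coord(1)[OF pt] _ mem(1)[OF that]])
      fix i j assume ij: "i \<in> {1..m + n}" "j \<in> {1..m + n}"
      show "?p (entry m 1 i j) \<in> dual_numbers (par m 0 0)"
        unfolding point_eval_entry(1)[OF pt ij] by (rule unip_dual)
    qed
    then show ?thesis by (auto simp: dual_numbers_def)
  qed
  then have "\<forall>k. \<exists>x y. k < r \<longrightarrow> ?p (u k) = sconst x + sconst y * ?t" by blast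
  from choice[OF this] obtain x where
    "\<forall>k. \<exists>y. k < r \<longrightarrow> ?p (u k) = sconst (x k) + sconst y * ?t" by (elim exE)
  from choice[OF this] obtain y where
    "\<forall>k. k < r \<longrightarrow> ?p (u k) = sconst (x k) + sconst (y k) * ?t" by (elim exE)
  note xy = this[rule_format]
  have tens: "?p (tensor m n (u k) (a k)) = sscale (x k) (a k) + ?t * sscale (y k) (a k)" if k: "k < r" for k
  proof -
    have "?p (tensor m n (u k) (a k)) = ?p (u k) * ?p (right_factor m n (a k))"
      unfolding tensor_def
      by (rule alg_hom_on_mult[OF point_eval_hom[OF pt] coord_alg_le_loc[OF mem(1)[OF k]]
            right_factor_loc_alg12[OF mem(2)[OF k]]])
    also have "\<dots> = (sconst (x k) + sconst (y k) * ?t) * a k"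
      unfolding point_eval_id(2)[OF pt(1) mem(2)[OF k]] xy[OF k] ..
    also have "\<dots> = sscale (x k) (a k) + ?t * sscale (y k) (a k)"
      by (simp only: distrib_right mult.assoc sscale_def sconst_left_commute)
    finally show ?thesis .
  qed
  have loc: "tensor m n (u k) (a k) \<in> loc_alg m n {1, 2}" if "k < r" for k
    unfolding tensor_def by (rule loc_alg_mult[OF coord_alg_le_loc[OF mem(1)[OF that]]
          right_factor_loc_alg12[OF mem(2)[OF that]]])
  have "?p (comult m n f) = (\<Sum>k<r. ?p (tensor m n (u k) (a k)))"
    unfolding ua(2) by (rule point_eval_sum[OF pt]) (use loc in auto)
  also have "\<dots> = (\<Sum>k<r. sscale (x k) (a k) + ?t * sscale (y k) (a k))"
    by (rule sum.cong) (use tens in auto)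
  also have "\<dots> = (\<Sum>k<r. sscale (x k) (a k)) + ?t * (\<Sum>k<r. sscale (y k) (a k))"
    by (simp only: sum.distrib sum_distrib_left)
  finally have eq: "f + ?t * 0 = (\<Sum>k<r. sscale (x k) (a k)) + ?t * (\<Sum>k<r. sscale (y k) (a k))"
    using \<open>?p (comult m n f) = f\<close> by simp
  have mat: "(\<Sum>k<r. sscale (z k) (a k)) \<in> mat_alg m n {1}" for z
    by (rule subspace_sum_scale[OF mat_alg_subspace mem(3)])
  have "f = (\<Sum>k<r. sscale (x k) (a k))"
    using theta_decomp[OF coord_alg_tfree[OF fc] tfree_0 mat_alg_tfree[OF mat] mat_alg_tfree[OF mat] eq] by blast
  then show "f \<in> mat_alg m n {1}" using mat[of x] by simp
qed

section \<open>Weights of polynomial supermodules\<close>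

lemma Mop_const_mult: "Mop m n a b (sconst c * f) = sconst c * Mop m n a b f" for f :: "'a::field_char_0 sfun"
  by (simp add: Mop_mult Mop_const)

lemma sconst_mult_eq_0: "sconst c * f = 0 \<longleftrightarrow> c = 0 \<or> f = 0" for f :: "'a::field_char_0 sfun"
proof
  assume "sconst c * f = 0"
  moreover have "sconst (inverse c) * (sconst c * f) = f" if "c \<noteq> 0"
    using that by (simp add: mult.assoc[symmetric] sconst_mult[symmetric] sconst_1)
  ultimately show "c = 0 \<or> f = 0" by fastforce
qed auto

lemma sconst_diff: "sconst (a - b) = sconst a - sconst b"
  using sconst_add[of "a - b" b] by (simp add: eq_diff_eq)

lemma ginv_mat_alg:
  fixes f :: "'a::field sfun"
  assumes "f \<in> mat_alg m n {1}"
  shows "ginv b f \<in> mat_alg m n {1}"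
  using assms
proof induction
  case (entry t i j)
  have e: "(entry m t i j :: 'a sfun) \<in> mat_alg m n {1}" by (rule mat_alg.entry[OF entry])
  show ?case unfolding ginv_entry using e mat_alg_minus[OF e] by simp
qed (simp_all add: ginv_add ginv_mult mat_alg.intros)

lemma Mop_mat_alg:
  fixes f :: "'a::field_char_0 sfun"
  assumes a: "a \<in> {1..m + n}" and f: "f \<in> mat_alg m n {1}"
  shows "Mop m n a b f \<in> mat_alg m n {1}"
  using f
proof induction
  case (entry t i j)
  then show ?case using a mat_alg.entry[of 1 "{1}" a m n j]
    by (auto simp: Mop_entry mat_alg_0 simp del: One_nat_def)
qed (auto simp: Mop_const Mop_add Mop_mult mat_alg_0 simp del: One_nat_def
    intro!: mat_alg.add mat_alg.mult ginv_mat_alg)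

section \<open>Weights in A(m|n) are natural numbers\<close>

definition eigenvectors :: "nat \<Rightarrow> nat \<Rightarrow> nat \<Rightarrow> 'a::field sfun set" where
  "eigenvectors m n a = {f. \<exists>k::nat. Mop m n a a f = sconst (of_nat k) * f}"

lemma eigenvectors_mult:
  fixes f g :: "'a::field_char_0 sfun"
  assumes "f \<in> eigenvectors m n a" "g \<in> eigenvectors m n a"
  shows "f * g \<in> eigenvectors m n a"
proof -
  obtain k l where "Mop m n a a f = sconst (of_nat k) * f" "Mop m n a a g = sconst (of_nat l) * g"
    using assms by (auto simp: eigenvectors_def)
  then have "Mop m n a a (f * g) = sconst (of_nat (k + l)) * (f * g)"
    by (simp add: Mop_mult sconst_add distrib_right mult.assoc sconst_left_commute)
  then show ?thesis unfolding eigenvectors_def by blast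
qed

lemma span_eigenvectors_mult:
  fixes f g :: "'a::field_char_0 sfun"
  assumes f: "f \<in> sfun.span (eigenvectors m n a)" and g: "g \<in> sfun.span (eigenvectors m n a)"
  shows "f * g \<in> sfun.span (eigenvectors m n a)"
  using f
proof (induction rule: sfun.span_induct_alt)
  case base
  show ?case by (simp add: sfun.span_zero)
next
  case (step c x y)
  have "x * g \<in> sfun.span (eigenvectors m n a)"
    using g
  proof (induction rule: sfun.span_induct_alt)
    case base
    show ?case by (simp add: sfun.span_zero)
  next
    case (step d z w)
    have "x * (sscale d z + w) = sscale d (x * z) + x * w"
      by (simp add: distrib_left sscale_def sconst_left_commute)
    moreover have "x * z \<in> sfun.span (eigenvectors m n a)"
      using eigenvectors_mult[OF \<open>x \<in> eigenvectors m n a\<close> step(1)] by (rule sfun.span_base)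
    ultimately show ?case using step(2) by (simp add: sfun.span_add sfun.span_scale)
  qed
  moreover have "(sscale c x + y) * g = sscale c (x * g) + y * g"
    by (simp add: distrib_right sscale_def mult.assoc)
  ultimately show ?case using step(2) by (simp add: sfun.span_add sfun.span_scale)
qed

lemma mat_alg_span_eigenvectors:
  fixes f :: "'a::field_char_0 sfun"
  assumes "f \<in> mat_alg m n {1}"
  shows "f \<in> sfun.span (eigenvectors m n a)"
  using assms
proof induction
  case (const c)
  have "Mop m n a a (sconst c) = sconst (of_nat 0) * sconst c" by (simp add: Mop_const)
  then show ?case unfolding eigenvectors_def by (intro sfun.span_base) blast
next
  case (entry t i j)
  then have t: "t = 1" by simp
  have "Mop m n a a (entry m 1 i j) = sconst (of_nat (if i = a then 1 else 0)) * (entry m 1 i j :: 'a sfun)"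
    unfolding Mop_entry[OF entry(2,3)] by (simp add: sconst_1)
  then show ?case unfolding t eigenvectors_def by (intro sfun.span_base) blast
qed (auto intro: sfun.span_add span_eigenvectors_mult)

text \<open>The falling factorial E (E - 1) ... (E - N + 1) of the operator E =
  \<open>Mop m n a a\<close>.\<close>

primrec falling :: "nat \<Rightarrow> nat \<Rightarrow> nat \<Rightarrow> nat \<Rightarrow> 'a::field sfun \<Rightarrow> 'a sfun" where
  "falling m n a 0 f = f"
| "falling m n a (Suc N) f = Mop m n a a (falling m n a N f) - sconst (of_nat N) * falling m n a N f"

lemma falling_linear:
  fixes f g :: "'a::field_char_0 sfun"
  shows "falling m n a N (sscale c f + g) = sscale c (falling m n a N f) + falling m n a N g"
proof (induction N)
  case (Suc N)
  show ?case
    unfolding falling.simps Suc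
    unfolding Mop_add sscale_def Mop_const_mult distrib_left right_diff_distrib
      sconst_left_commute[of "sconst (of_nat N)" c]
    by (rule add_diff_add)
qed simp

lemma falling_eigen:
  fixes f :: "'a::field_char_0 sfun"
  assumes "Mop m n a a f = sconst w * f"
  shows "falling m n a N f = sconst (\<Prod>k<N. w - of_nat k) * f"
proof (induction N)
  case (Suc N)
  let ?p = "\<Prod>k<N. w - of_nat k"
  have "falling m n a (Suc N) f = sconst (?p * w) * f - sconst (of_nat N * ?p) * f"
    by (simp add: Suc Mop_const_mult assms sconst_mult mult.assoc)
  also have "\<dots> = sconst (?p * w - of_nat N * ?p) * f"
    by (simp only: sconst_diff left_diff_distrib)
  also have "?p * w - of_nat N * ?p = (\<Prod>k<Suc N. w - of_nat k)" by (simp add: algebra_simps)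
  finally show ?case .
qed (simp add: sconst_1)

text \<open>A(m|n) is spanned by eigenvectors of E = \<open>Mop m n a a\<close> with eigenvalues in
  the natural numbers, so a sufficiently long falling factorial of E kills f. On the eigenvector f
  it acts by w (w - 1) ... (w - N + 1), and one of these factors must be 0.\<close>

lemma weight_of_nat:
  fixes f :: "'a::field_char_0 sfun"
  assumes f: "f \<in> mat_alg m n {1}" "f \<noteq> 0" and w: "Mop m n a a f = sconst w * f"
  shows "\<exists>k. w = of_nat k"
proof -
  have "\<exists>N0. \<forall>N\<ge>N0. falling m n a N f = 0"
    using mat_alg_span_eigenvectors[OF f(1), of a]
  proof (induction rule: sfun.span_induct_alt)
    case base
    have "falling m n a N (0 :: 'a sfun) = 0" for N by (induction N) simp_all
    then show ?case by blast
  next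
    case (step c x y)
    then obtain k :: nat where k: "Mop m n a a x = sconst (of_nat k) * x" by (auto simp: eigenvectors_def)
    obtain N0 where N0: "\<forall>N\<ge>N0. falling m n a N y = 0" using step by blast
    have "falling m n a N x = 0" if "N \<ge> Suc k" for N
    proof -
      have "(\<Prod>i<N. of_nat k - of_nat i :: 'a) = 0" using that by (intro prod_zero) auto
      then show ?thesis by (simp only: falling_eigen[OF k] sconst_0 mult_zero_left)
    qed
    then have "\<forall>N\<ge>max N0 (Suc k). falling m n a N (sscale c x + y) = 0"
      using N0 by (simp add: falling_linear)
    then show ?case by blast
  qed
  then obtain N where "falling m n a N f = 0" by blast
  then have "(\<Prod>k<N. w - of_nat k) = 0" using f(2) by (simp add: falling_eigen[OF w] sconst_mult_eq_0)
  then show ?thesis by auto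
qed

lemma weight_nonneg:
  fixes f :: "'a::field_char_0 sfun"
  assumes "f \<in> mat_alg m n {1}" "f \<noteq> 0" "Mop m n a a f = sconst (of_int w) * f"
  shows "w \<ge> 0"
proof -
  obtain k where "(of_int w :: 'a) = of_nat k" using weight_of_nat[OF assms] by blast
  then have "(of_int w :: 'a) = of_int (int k)" by simp
  then have "w = int k" by (simp only: of_int_eq_iff)
  then show ?thesis by simp
qed

section \<open>Hook condition and Casimir eigenvalues\<close>

lemma regular_inducedD:
  fixes f :: "'a::field_char_0 sfun"
  assumes "f \<in> regular_induced m n lam"
  shows "f \<in> coord_alg m n" "comult m n f \<in> loc_alg m n {1, 2}"
    and "\<And>i j. i \<in> {1..m + n} \<Longrightarrow> j \<in> {1..m + n} \<Longrightarrow> j < i \<Longrightarrow> Mop m n j i f = 0"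
    and "\<And>i. i \<in> {1..m + n} \<Longrightarrow> Mop m n i i f = sconst (of_int (lam i)) * f"
  using assms induced_Mop[of f m n lam] by (auto simp: regular_induced_def induced_def)

primrec lower :: "nat \<Rightarrow> nat \<Rightarrow> 'a::field sfun \<Rightarrow> nat \<Rightarrow> 'a sfun" where
  "lower m n f 0 = f"
| "lower m n f (Suc k) = Mop m n (m + Suc k) m (lower m n f k)"

text \<open>Applying the odd lowering operators \<open>E\<^sub>m\<^sub>+\<^sub>k\<^sub>,\<^sub>m\<close> successively to a highest weight vector never
  gives 0 while \<open>mu (m + k) > 0\<close>, because \<open>E\<^sub>m\<^sub>,\<^sub>m\<^sub>+\<^sub>k E\<^sub>m\<^sub>+\<^sub>k\<^sub>,\<^sub>m\<close> acts by a sum of two nonnegative weights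
  one of which is positive. The weights of the results force \<open>mu m\<close> to be large.\<close>

lemma hook_condition:
  fixes f :: "'a::field_char_0 sfun"
  assumes m: "1 \<le> m" and jn: "j \<le> n" and f: "f \<in> regular_induced m n mu" "f \<in> mat_alg m n {1}" "f \<noteq> 0"
    and pos: "\<And>k. 1 \<le> k \<Longrightarrow> k \<le> j \<Longrightarrow> mu (m + k) \<ge> 1"
  shows "mu m \<ge> int j"
proof -
  let ?F = "lower m n f"
  note D = regular_inducedD[OF f(1)]
  \<comment> \<open>The conditions for l > k are those that the later steps consume: the
    supercommutator of E_{m,m+l} with the next lowering operator E_{m+k+1,m} contains E_{m+k+1,m+l},
    so both kinds of raising operators have to kill the vector.\<close>
  have inv: "k \<le> j \<Longrightarrow> ?F k \<in> mat_alg m n {1} \<and> ?F k \<noteq> 0 \<and>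
      Mop m n m m (?F k) = sconst (of_int (mu m - int k)) * ?F k \<and>
      (\<forall>l. k < l \<and> l \<le> n \<longrightarrow> Mop m n (m + l) (m + l) (?F k) = sconst (of_int (mu (m + l))) * ?F k \<and>
        Mop m n m (m + l) (?F k) = 0 \<and>
        (\<forall>q. 1 \<le> q \<and> q < l \<longrightarrow> Mop m n (m + q) (m + l) (?F k) = 0))" for k
  proof (induction k)
    case 0
    show ?case using f m D(3,4) by (auto simp del: One_nat_def)
  next
    case (Suc k)
    let ?G = "?F k" and ?s = "m + Suc k"
    let ?H = "Mop m n ?s m ?G"
    have IH: "?G \<in> mat_alg m n {1}" "?G \<noteq> 0" "Mop m n m m ?G = sconst (of_int (mu m - int k)) * ?G"
      "\<And>l. k < l \<Longrightarrow> l \<le> n \<Longrightarrow> Mop m n (m + l) (m + l) ?G = sconst (of_int (mu (m + l))) * ?G"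
      "\<And>l. k < l \<Longrightarrow> l \<le> n \<Longrightarrow> Mop m n m (m + l) ?G = 0"
      "\<And>l q. k < l \<Longrightarrow> l \<le> n \<Longrightarrow> 1 \<le> q \<Longrightarrow> q < l \<Longrightarrow> Mop m n (m + q) (m + l) ?G = 0"
      using Suc by auto
    have kn: "Suc k \<le> n" using Suc.prems jn by simp
    have r: "m \<in> {1..m + n}" "?s \<in> {1..m + n}" using m kn by auto
    have rl: "m + l \<in> {1..m + n}" if "l \<le> n" for l using m that by auto
    have Gc: "?G \<in> coord_alg m n" using IH(1) mat_alg_coord by blast
    have H: "?H \<in> mat_alg m n {1}" by (rule Mop_mat_alg[OF r(2) IH(1)])
    have "Mop m n m m ?H = Mop m n ?s m (Mop m n m m ?G) - ?H"
      using Mop_commute[OF r(1) r(1) r(2) r(1) Gc] by simp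
    moreover have "(of_int (mu m - int (Suc k)) :: 'a) = of_int (mu m - int k) - 1" by simp
    ultimately have Hm: "Mop m n m m ?H = sconst (of_int (mu m - int (Suc k))) * ?H"
      unfolding IH(3) Mop_const_mult by (simp only: sconst_diff sconst_1 left_diff_distrib mult_1)
    have Hl: "Mop m n (m + l) (m + l) ?H = sconst (of_int (mu (m + l))) * ?H" if "Suc k < l" "l \<le> n" for l
      using Mop_commute[OF rl[OF that(2)] rl[OF that(2)] r(2) r(1) Gc] IH(4)[of l] that m
      by (simp add: Mop_const_mult)
    have Hml: "Mop m n m (m + l) ?H = 0" if "Suc k < l" "l \<le> n" for l
      using Mop_commute[OF r(1) rl[OF that(2)] r(2) r(1) Gc] IH(5)[of l] IH(6)[of l "Suc k"] that m
      by simp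
    have Hql: "Mop m n (m + q) (m + l) ?H = 0" if "Suc k < l" "l \<le> n" "1 \<le> q" "q < l" for l q
      using Mop_commute[OF rl rl[OF that(2)] r(2) r(1) Gc, of q] IH(6)[of l q] that m
      by simp
    have "Mop m n m ?s ?H = Mop m n m m ?G + Mop m n ?s ?s ?G"
      using Mop_commute[OF r(1) r(2) r(2) r(1) Gc] IH(5)[of "Suc k"] kn by simp
    also have "\<dots> = sconst (of_int (mu m - int k + mu ?s)) * ?G"
      using IH(3) IH(4)[of "Suc k"] kn by (simp add: sconst_add distrib_right)
    finally have HH: "Mop m n m ?s ?H = sconst (of_int (mu m - int k + mu ?s)) * ?G" .
    \<comment> \<open>This is the m-th weight of the nonzero vector G. Together with
      \<open>mu (m + Suc k) \<ge> 1\<close> it keeps the scalar in \<open>HH\<close> from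
      vanishing.\<close>
    have "mu m - int k \<ge> 0" by (rule weight_nonneg[OF IH(1-3)])
    then have "mu m - int k + mu ?s \<noteq> 0" using pos[of "Suc k"] Suc.prems by simp
    then have "(of_int (mu m - int k + mu ?s) :: 'a) \<noteq> 0" by (simp only: of_int_eq_0_iff) simp
    then have "Mop m n m ?s ?H \<noteq> 0" unfolding HH sconst_mult_eq_0 using IH(2) by blast
    then have "?H \<noteq> 0" by auto
    then show ?case using H Hm Hl Hml Hql by simp
  qed
  have "mu m - int j \<ge> 0" by (rule weight_nonneg[of "?F j" m n m]) (use inv[of j] in auto)
  then show ?thesis by simp
qed

section \<open>The Casimir eigenvalue and contents of boxes\<close>

definition casimir_value :: "nat \<Rightarrow> nat \<Rightarrow> weight \<Rightarrow> int" where
  "casimir_value m n lam = (\<Sum>a = 1..m + n. \<Sum>b = 1..m + n.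
    if a = b then sg m a * lam a * lam a else if a < b then sg m b * lam a - sg m a * lam b else 0)"

text \<open>If b < a, then E_ba is a raising operator and kills f. If a < b, then E_ab is one, and
  moving it to the right of E_ba leaves E_aa and E_bb; the sign of the supercommutator turns
  \<open>sg m b\<close> into \<open>sg m a\<close>.\<close>

lemma left_casimir_induced:
  fixes f :: "'a::field_char_0 sfun"
  assumes f: "f \<in> regular_induced m n lam"
  shows "left_casimir m n f = sconst (of_int (casimir_value m n lam)) * f"
proof -
  note D = regular_inducedD[OF f]
  have "sg m b * Mop m n a b (Mop m n b a f) = sconst (of_int
      (if a = b then sg m a * lam a * lam a else if a < b then sg m b * lam a - sg m a * lam b else 0)) * f"
    if ab: "a \<in> {1..m + n}" "b \<in> {1..m + n}" for a b
  proof -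
    consider "a = b" | "a < b" | "b < a" by fastforce
    then show ?thesis
    proof cases
      case 1
      then show ?thesis
        using ab by (simp add: D(4) Mop_const_mult sconst_mult mult.assoc sg_def sconst_1 sconst_diff[of 0, simplified])
    next
      case 2
      have "Mop m n a b (Mop m n b a f) = sconst (of_int (lam a)) * f -
          (if par m a b then - 1 else 1) * (sconst (of_int (lam b)) * f)"
        using Mop_commute[OF ab ab(2) ab(1) D(1)] D(3)[OF ab(2,1) 2] D(4)[OF ab(1)] D(4)[OF ab(2)] by simp
      then show ?thesis
        using 2 by (auto simp: sg_def sconst_diff sconst_add sconst_diff[of 0, simplified] algebra_simps)
    next
      case 3
      then show ?thesis using D(3)[OF ab 3] by simp
    qed
  qed
  then have "left_casimir m n f = (\<Sum>a = 1..m + n. \<Sum>b = 1..m + n. sconst (of_int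
      (if a = b then sg m a * lam a * lam a else if a < b then sg m b * lam a - sg m a * lam b else 0)) * f)"
    unfolding left_casimir_def by (intro sum.cong refl) blast
  also have "\<dots> = sconst (of_int (casimir_value m n lam)) * f"
    unfolding casimir_value_def of_int_sum sconst_sum sum_distrib_right ..
  finally show ?thesis .
qed

lemma sum_less_index: "(\<Sum>k<m. if a < k + 1 then 1 else 0 :: int) = int (m - a)"
  by (induction m) auto

lemma sum_greater_index: "(\<Sum>k<m. if k + 1 < a then 1 else 0 :: int) = int (min m (a - 1))"
  by (induction m) auto

text \<open>Truncated subtraction covers both blocks: m - a is 0 beyond the first block, and a - m
  is 0 inside it.\<close>

lemma sum_sg_greater: "(\<Sum>b = 1..m + n. if a < b then sg m b else 0 :: int) = int (m - a) - int (n - (a - m))"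
proof -
  have "(\<Sum>b = 1..m + n. if a < b then sg m b else 0 :: int) =
      (\<Sum>k<m. if a < k + 1 then 1 else 0) + (\<Sum>k<n. - (if a - m < k + 1 then 1 else 0))"
    unfolding sum_blocks by (intro arg_cong2[where f = "(+)"] sum.cong) (auto simp: sg_def)
  then show ?thesis unfolding sum_negf sum_less_index by simp
qed

lemma sum_sg_less: "(\<Sum>b = 1..m + n. if b < a then sg m b else 0 :: int) =
    int (min m (a - 1)) - int (min n (a - m - 1))"
proof -
  have "(\<Sum>b = 1..m + n. if b < a then sg m b else 0 :: int) =
      (\<Sum>k<m. if k + 1 < a then 1 else 0) + (\<Sum>k<n. - (if k + 1 < a - m then 1 else 0))"
    unfolding sum_blocks by (intro arg_cong2[where f = "(+)"] sum.cong) (auto simp: sg_def)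
  then show ?thesis unfolding sum_negf sum_greater_index by simp
qed

text \<open>For a hook partition this is the sum of 2 * content + m - n over all boxes. With indices
  counted from 1, the first sum collects row i with contents x - i for 1 \<le> x \<le> lam i, the
  second one the part of column j below row m with contents j - m - y for 1 \<le> y \<le> lam (m +
  j).\<close>

lemma casimir_value_alt:
  "casimir_value m n lam =
    (\<Sum>i<m. lam (i + 1) * (lam (i + 1) + (int m - int n + 1 - 2 * int (i + 1)))) +
    (\<Sum>j<n. lam (m + j + 1) * (- lam (m + j + 1) + (2 * int (j + 1) - 1 - int n - int m)))"
proof -
  have swap: "(\<Sum>a = 1..m + n. \<Sum>b = 1..m + n. if a < b then sg m a * lam b else 0) =
      (\<Sum>a = 1..m + n. \<Sum>b = 1..m + n. if b < a then sg m b * lam a else 0)"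
    by (rule sum.swap)
  have diag: "(\<Sum>b = 1..m + n. if a = b then sg m a * lam a * lam a else 0) = sg m a * lam a * lam a"
    if "a \<in> {1..m + n}" for a
    using that by simp
  have "casimir_value m n lam = (\<Sum>a = 1..m + n. \<Sum>b = 1..m + n.
      (if a = b then sg m a * lam a * lam a else 0) + (if a < b then sg m b * lam a else 0) -
      (if a < b then sg m a * lam b else 0))"
    unfolding casimir_value_def by (intro sum.cong) auto
  also have "\<dots> = (\<Sum>a = 1..m + n. \<Sum>b = 1..m + n. if a = b then sg m a * lam a * lam a else 0) +
      (\<Sum>a = 1..m + n. \<Sum>b = 1..m + n. if a < b then sg m b * lam a else 0) -
      (\<Sum>a = 1..m + n. \<Sum>b = 1..m + n. if b < a then sg m b * lam a else 0)"
    unfolding sum_subtractf sum.distrib swap ..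
  also have "\<dots> = (\<Sum>a = 1..m + n. sg m a * lam a * lam a +
      (\<Sum>b = 1..m + n. if a < b then sg m b else 0) * lam a -
      (\<Sum>b = 1..m + n. if b < a then sg m b else 0) * lam a)"
    unfolding sum_subtractf sum.distrib sum_distrib_right
    by (intro arg_cong2[where f = "(-)"] arg_cong2[where f = "(+)"] sum.cong refl diag) auto
  also have "\<dots> = (\<Sum>i<m. lam (i + 1) * (lam (i + 1) + (int m - int n + 1 - 2 * int (i + 1)))) +
    (\<Sum>j<n. lam (m + j + 1) * (- lam (m + j + 1) + (2 * int (j + 1) - 1 - int n - int m)))"
    unfolding sum_sg_greater sum_sg_less unfolding sum_blocks
    by (intro arg_cong2[where f = "(+)"] sum.cong refl) (auto simp: sg_def algebra_simps of_nat_diff min_def)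
  finally show ?thesis .
qed

text \<open>Here \<open>a i\<close> boxes leave row i + 1 and \<open>b j\<close> boxes arrive in
  column j + 1 below row m. The former lie beyond column c in rows at most m and have contents at
  least c + 1 - m; the latter lie in columns at most c and have contents at most c - 1 - m. By
  \<open>casimir_value_alt\<close> they change the eigenvalue by at least 2 c + 2 - m - n and 2 + m
  + n - 2 c per box. These bounds add up to 4, and as equally many boxes leave and arrive, c, m and
  n cancel.\<close>

lemma casimir_value_strict:
  fixes a b :: "nat \<Rightarrow> int"
  assumes a: "\<And>i. i < m \<Longrightarrow> 0 \<le> a i" and b: "\<And>j. j < n \<Longrightarrow> 0 \<le> b j"
    and ab: "(\<Sum>i<m. a i) = k" "(\<Sum>j<n. b j) = k" "0 < k"
    and lam: "\<And>i. i < m \<Longrightarrow> lam (i + 1) = mu (i + 1) + a i"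
      "\<And>j. j < n \<Longrightarrow> mu (m + j + 1) = lam (m + j + 1) + b j"
    and nonneg: "\<And>j. j < n \<Longrightarrow> 0 \<le> lam (m + j + 1)"
    and c: "\<And>i. i < m \<Longrightarrow> c \<le> mu (i + 1)" "\<And>j. j < n \<Longrightarrow> b j \<noteq> 0 \<Longrightarrow> int (j + 1) \<le> c"
  shows "casimir_value m n mu < casimir_value m n lam"
proof -
  have 1: "a i * (2 * c + 2 - int m - int n) \<le>
      lam (i + 1) * (lam (i + 1) + (int m - int n + 1 - 2 * int (i + 1))) -
      mu (i + 1) * (mu (i + 1) + (int m - int n + 1 - 2 * int (i + 1)))" if i: "i < m" for i
  proof -
    have "lam (i + 1) * (lam (i + 1) + (int m - int n + 1 - 2 * int (i + 1))) -
        mu (i + 1) * (mu (i + 1) + (int m - int n + 1 - 2 * int (i + 1))) =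
        a i * (2 * mu (i + 1) + a i + (int m - int n + 1 - 2 * int (i + 1)))"
      unfolding lam(1)[OF i] by (simp add: algebra_simps)
    moreover have "a i * (2 * c + 2 - int m - int n) \<le>
        a i * (2 * mu (i + 1) + a i + (int m - int n + 1 - 2 * int (i + 1)))"
    proof (cases "a i = 0")
      case False
      then have "1 \<le> a i" using a[OF i] by simp
      then show ?thesis using a[OF i] c(1)[OF i] i by (intro mult_left_mono) auto
    qed simp
    ultimately show ?thesis by simp
  qed
  have 2: "b j * (2 + int m + int n - 2 * c) \<le>
      lam (m + j + 1) * (- lam (m + j + 1) + (2 * int (j + 1) - 1 - int n - int m)) -
      mu (m + j + 1) * (- mu (m + j + 1) + (2 * int (j + 1) - 1 - int n - int m))" if j: "j < n" for j
  proof -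
    have "lam (m + j + 1) * (- lam (m + j + 1) + (2 * int (j + 1) - 1 - int n - int m)) -
        mu (m + j + 1) * (- mu (m + j + 1) + (2 * int (j + 1) - 1 - int n - int m)) =
        b j * (2 * lam (m + j + 1) + b j - (2 * int (j + 1) - 1 - int n - int m))"
      unfolding lam(2)[OF j] by (simp add: algebra_simps)
    moreover have "b j * (2 + int m + int n - 2 * c) \<le>
        b j * (2 * lam (m + j + 1) + b j - (2 * int (j + 1) - 1 - int n - int m))"
    proof (cases "b j = 0")
      case False
      then have "1 \<le> b j" using b[OF j] by simp
      then show ?thesis using b[OF j] c(2)[OF j False] nonneg[OF j] by (intro mult_left_mono) auto
    qed simp
    ultimately show ?thesis by simp
  qed
  have "(\<Sum>i<m. a i * (2 * c + 2 - int m - int n)) + (\<Sum>j<n. b j * (2 + int m + int n - 2 * c)) \<le>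
      casimir_value m n lam - casimir_value m n mu"
  proof -
    have "(\<Sum>i<m. a i * (2 * c + 2 - int m - int n)) \<le> (\<Sum>i<m.
        lam (i + 1) * (lam (i + 1) + (int m - int n + 1 - 2 * int (i + 1))) -
        mu (i + 1) * (mu (i + 1) + (int m - int n + 1 - 2 * int (i + 1))))"
      by (rule sum_mono) (use 1 in blast)
    moreover have "(\<Sum>j<n. b j * (2 + int m + int n - 2 * c)) \<le> (\<Sum>j<n.
        lam (m + j + 1) * (- lam (m + j + 1) + (2 * int (j + 1) - 1 - int n - int m)) -
        mu (m + j + 1) * (- mu (m + j + 1) + (2 * int (j + 1) - 1 - int n - int m)))"
      by (rule sum_mono) (use 2 in blast)
    ultimately show ?thesis
      unfolding casimir_value_alt sum_subtractf by linarith
  qed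
  moreover have "(\<Sum>i<m. a i * (2 * c + 2 - int m - int n)) + (\<Sum>j<n. b j * (2 + int m + int n - 2 * c)) = 4 * k"
    unfolding sum_distrib_right[symmetric] ab(1,2) by (simp add: algebra_simps)
  ultimately show ?thesis using ab(3) by simp
qed

text \<open>Each \<open>K s\<close> meets exactly one position of the block, so the double sum
  counts the boxes that are moved.\<close>

lemma sum_delta_range:
  assumes "\<And>s. s < r \<Longrightarrow> c + 1 \<le> K s \<and> K s \<le> c + k"
  shows "(\<Sum>i<k. \<Sum>s<(r::nat). delta (K s) (c + i + 1)) = int r"
proof -
  have "(\<Sum>i<k. delta (K s) (c + i + 1)) = 1" if s: "s < r" for s
  proof -
    have "(\<Sum>i<k. delta (K s) (c + i + 1)) = (\<Sum>i<k. if i = K s - c - 1 then 1 else 0)"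
      using assms[OF s] by (intro sum.cong refl) (auto simp: delta_def)
    also have "\<dots> = 1" using assms[OF s] by auto
    finally show ?thesis .
  qed
  then have "(\<Sum>s<r. \<Sum>i<k. delta (K s) (c + i + 1)) = (\<Sum>s<r. 1)"
    by (intro sum.cong refl) auto
  then show ?thesis by (subst sum.swap) simp
qed

lemma nabla_nonzero:
  assumes "polynomial_weight TYPE('a::field_char_0) m n lam"
  obtains f :: "'a::field_char_0 sfun" where "f \<in> regular_induced m n lam" "f \<in> mat_alg m n {1}" "f \<noteq> 0"
proof -
  have N: "polynomial_supermodule m n (nabla m n lam :: 'a sfun set)"
    and reg: "(nabla m n lam :: 'a sfun set) \<subseteq> regular_induced m n lam"
    by (rule nabla_props)+
  have "sfun.subspace (nabla m n lam :: 'a sfun set)"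
    using N by (simp add: polynomial_supermodule_def subsupermodule_def)
  then have "0 \<in> (nabla m n lam :: 'a sfun set)" by (rule sfun.subspace_0)
  moreover have "(nabla m n lam :: 'a sfun set) \<noteq> {0}"
    using assms by (simp add: polynomial_weight_def)
  ultimately obtain f :: "'a sfun" where f: "f \<in> nabla m n lam" "f \<noteq> 0" by blast
  moreover have "f \<in> mat_alg m n {1}" using polynomial_supermodule_mat_alg[OF N] f(1) by (rule subsetD)
  moreover have "f \<in> regular_induced m n lam" using reg f(1) by (rule subsetD)
  ultimately show thesis using that by blast
qed

lemma polynomial_weight_nonneg:
  assumes "polynomial_weight TYPE('a::field_char_0) m n lam" "a \<in> {1..m + n}"
  shows "lam a \<ge> 0"
proof -
  obtain f :: "'a sfun" where f: "f \<in> regular_induced m n lam" "f \<in> mat_alg m n {1}" "f \<noteq> 0"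
    by (rule nabla_nonzero[OF assms(1)])
  show ?thesis by (rule weight_nonneg[OF f(2,3) regular_inducedD(4)[OF f(1) assms(2)]])
qed

lemma composition_factor_casimir:
  assumes "composition_factor m n (simple_module m n mu :: 'a::field_char_0 sfun set) (nabla m n lam)"
  shows "casimir_value m n mu = casimir_value m n lam"
proof -
  let ?L = "simple_module m n mu :: 'a sfun set"
  note cf = assms[unfolded composition_factor_def]
  from cf[THEN conjunct2] obtain U V \<phi> where
    "subsupermodule m n U \<and> subsupermodule m n V \<and> U \<subseteq> V \<and> V \<subseteq> nabla m n lam \<and>
      supermodule_hom m n V ?L \<phi> \<and> \<phi> ` V = ?L \<and> {f \<in> V. \<phi> f = 0} = U" by (elim exE)
  then have V: "subsupermodule m n V" "V \<subseteq> nabla m n lam" "supermodule_hom m n V ?L \<phi>" "\<phi> ` V = ?L"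
    by - (elim conjE, assumption)+
  have Ls: "subsupermodule m n ?L" "?L \<noteq> {0}"
    using cf[THEN conjunct1, unfolded simple_supermodule_def] by - (elim conjE, assumption)+
  have "0 \<in> ?L" using subsupermoduleD(2)[OF Ls(1)] by (rule sfun.subspace_0)
  then obtain g where g: "g \<in> ?L" "g \<noteq> 0" using Ls(2) by blast
  then have "g \<in> \<phi> ` V" unfolding V(4) by simp
  then obtain f where f': "g = \<phi> f" "f \<in> V" by (rule imageE)
  note f = f'(2) f'(1)[symmetric]
  have freg: "f \<in> regular_induced m n lam"
    by (rule subsetD[OF nabla_props(2) subsetD[OF V(2) f(1)]])
  have greg: "g \<in> regular_induced m n mu"
    by (rule subsetD[OF simple_module_regular g(1)])
  \<comment> \<open>The scalar on g is computed in H^0(\<mu>) and, by means of \<phi>, from the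
    preimage f in H^0(\<lambda>).\<close>
  have "sconst (of_int (casimir_value m n mu)) * g = right_casimir m n g"
    using left_casimir_induced[OF greg] left_casimir_eq_right_casimir[OF regular_inducedD(1)[OF greg]] by simp
  also have "\<dots> = \<phi> (right_casimir m n f)"
    using supermodule_hom_casimir[OF V(1) Ls(1) V(3) f(1)] f(2) by simp
  also have "right_casimir m n f = sscale (of_int (casimir_value m n lam)) f"
    using left_casimir_induced[OF freg] left_casimir_eq_right_casimir[OF regular_inducedD(1)[OF freg]]
    by (simp add: sscale_def)
  also have "\<phi> \<dots> = sconst (of_int (casimir_value m n lam)) * g"
    using V(3)[unfolded supermodule_hom_def, THEN conjunct2, THEN conjunct2, THEN conjunct1, rule_format, OF f(1)] f(2)
    by (simp add: sscale_def)
  finally have "sconst (of_int (casimir_value m n mu) - of_int (casimir_value m n lam)) * g = 0"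
    by (simp add: sconst_diff left_diff_distrib)
  then have "(of_int (casimir_value m n mu) :: 'a) = of_int (casimir_value m n lam)"
    using g(2) by (simp add: sconst_mult_eq_0)
  then show ?thesis by (simp only: of_int_eq_iff)
qed

lemma casimir_value_odd_shift:
  assumes lam: "polynomial_weight TYPE('a::field_char_0) m n lam"
    and IJ: "length I = length J" "set I \<subseteq> {1..m}" "set J \<subseteq> {1..n}" "I \<noteq> []"
    and mu: "dominant m n (odd_shift m lam I J)" "polynomial_weight TYPE('a) m n (odd_shift m lam I J)"
  shows "casimir_value m n (odd_shift m lam I J) < casimir_value m n lam"
proof -
  define mu where "mu = odd_shift m lam I J"
  define a where "a i = (\<Sum>s<length I. delta (I ! s) (i + 1))" for i
  define b where "b j = (\<Sum>s<length J. delta (m + J ! s) (m + j + 1))" for j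
  \<comment> \<open>The largest column that receives a box. It separates the columns of the removed
    boxes from those of the added ones.\<close>
  define c where "c = Max (set J)"
  have Is: "1 \<le> I ! s \<and> I ! s \<le> m" if "s < length I" for s using IJ(2) nth_mem[OF that] by auto
  have Js: "1 \<le> J ! s \<and> J ! s \<le> n" if "s < length J" for s using IJ(3) nth_mem[OF that] by auto
  have "J \<noteq> []" using IJ by auto
  then have cJ: "c \<in> set J" unfolding c_def by simp
  then obtain s0 where s0: "s0 < length J" "J ! s0 = c" by (metis in_set_conv_nth)
  have c: "1 \<le> c" "c \<le> n" using cJ IJ(3) by auto
  have m: "1 \<le> m" using Is[of 0] IJ(4) by auto
  have a: "lam (i + 1) = mu (i + 1) + a i" if "i < m" for i
  proof -
    have "i + 1 \<noteq> m + J ! s" if "s < length J" for s using Js[OF that] \<open>i < m\<close> by simp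
    then have "(\<Sum>s<length J. delta (m + J ! s) (i + 1)) = 0"
      by (intro sum.neutral ballI) (simp only: delta_def lessThan_iff if_False)
    then show ?thesis by (simp add: mu_def odd_shift_def a_def)
  qed
  have b: "mu (m + j + 1) = lam (m + j + 1) + b j" for j
  proof -
    have "(\<Sum>s<length I. delta (I ! s) (m + j + 1)) = 0"
      using Is by (intro sum.neutral) (fastforce simp: delta_def)
    then show ?thesis by (simp add: mu_def odd_shift_def b_def)
  qed
  have nonneg: "0 \<le> lam (m + j + 1)" if "j < n" for j
    by (rule polynomial_weight_nonneg[OF lam]) (use that in auto)
  have "b (c - 1) \<ge> 1"
  proof -
    have "delta (m + J ! s0) (m + (c - 1) + 1) \<le> b (c - 1)"
      unfolding b_def using s0 by (intro member_le_sum) (auto simp: delta_def)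
    then show ?thesis using s0 c by (simp add: delta_def)
  qed
  moreover have "c - 1 < n" using c by simp
  \<comment> \<open>Column c of \<mu> reaches below row m, and by dominance so do all columns before
    it. This is the positivity required by \<open>hook_condition\<close> for the first c
    columns.\<close>
  ultimately have mu_c: "mu (m + c) \<ge> 1"
    using b[of "c - 1"] nonneg[of "c - 1"] c(1) by simp
  obtain f :: "'a sfun" where f: "f \<in> regular_induced m n mu" "f \<in> mat_alg m n {1}" "f \<noteq> 0"
    by (rule nabla_nonzero[OF mu(2)[folded mu_def]])
  have "mu m \<ge> int c"
  proof (rule hook_condition[OF m c(2) f])
    fix k assume "1 \<le> k" "k \<le> c"
    then have "mu (m + k) \<ge> mu (m + c)"
      using mu(1) c unfolding mu_def[symmetric] dominant_def by blast
    then show "mu (m + k) \<ge> 1" using mu_c by simp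
  qed
  moreover have "mu (i + 1) \<ge> mu m" if "i < m" for i
    using mu(1) that unfolding mu_def[symmetric] dominant_def by auto
  ultimately have mu_ge: "int c \<le> mu (i + 1)" if "i < m" for i using that by fastforce
  have le_c: "int (j + 1) \<le> int c" if nz: "b j \<noteq> 0" for j
  proof -
    obtain s where "s \<in> {..<length J}" "delta (m + J ! s) (m + j + 1) \<noteq> 0"
      by (rule sum.not_neutral_contains_not_neutral[OF nz[unfolded b_def]])
    then have "j + 1 \<in> set J" by (auto simp: delta_def split: if_splits)
    then have "j + 1 \<le> c" unfolding c_def by (intro Max_ge) auto
    then show ?thesis by simp
  qed
  have "casimir_value m n mu < casimir_value m n lam"
  proof (rule casimir_value_strict[where a = a and b = b and k = "int (length I)" and c = "int c"])
    show "0 \<le> a i" for i by (simp add: a_def sum_nonneg delta_def)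
    show "0 \<le> b j" for j by (simp add: b_def sum_nonneg delta_def)
    show "(\<Sum>i<m. a i) = int (length I)"
      using sum_delta_range[of "length I" 0 "\<lambda>s. I ! s" m] Is by (simp add: a_def)
    show "(\<Sum>j<n. b j) = int (length I)"
      using sum_delta_range[of "length J" m "\<lambda>s. m + J ! s" n] Js by (simp add: b_def IJ(1))
  qed (use IJ(4) a b nonneg mu_ge le_c in auto)
  then show ?thesis by (simp only: mu_def)
qed

theorem theorem5p6:
  fixes m n :: nat and lam :: weight and I J :: "nat list"
  assumes "dominant m n lam"
    and "polynomial_weight TYPE('a::{alg_closed_field, field_char_0}) m n lam"
    and "admissible m n lam I J"
    and "dominant m n (odd_shift m lam I J)"
    and "polynomial_weight TYPE('a) m n (odd_shift m lam I J)"
    and "composition_factor m n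
      (simple_module m n (odd_shift m lam I J) :: 'a sfun set) (nabla m n lam)"
  shows "poly_odd_linked TYPE('a) m n lam (odd_shift m lam I J)"
proof -
  have IJ: "length I = length J" "set I \<subseteq> {1..m}" "set J \<subseteq> {1..n}"
    using assms(3) by (simp_all add: admissible_def)
  \<comment> \<open>A nonempty shift would strictly lower the Casimir value, whereas a composition
    factor preserves it.\<close>
  have "I = []"
    using casimir_value_odd_shift[OF assms(2) IJ _ assms(4,5)] composition_factor_casimir[OF assms(6)]
    by auto
  then have "odd_shift m lam I J = lam" using IJ(1) by (simp add: odd_shift_def)
  then show ?thesis
    unfolding poly_odd_linked_def by (intro exI[of _ "[lam]"]) (use assms(2) in simp)
qed

end
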